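(* Let $\mathcal{F}$ denote the Fourier transform on $L^2(\mathbb{R}^d)$. Suppose that $\{\varphi_j\}_{j\in\mathbb{N}}$ is a Riesz basis with constants $A,B>0$ for a subspace $\mathcal{W}\subset L^2(\mathbb{R}^d)$, and that there exists $T>0$ with $\mathrm{supp}(\varphi_j)\subset[-T,T]^d$ for all $j\in\mathbb{N}$. Let $0<\epsilon\leq\frac{1}{2T}$, let $\rho:\mathbb{N}\to(\epsilon\mathbb{Z})^d$ be a bijection, and let $U=(u_{ij})_{i,j\in\mathbb{N}}$ be the infinite matrix, regarded as an operator on $l^2(\mathbb{N})$, with $u_{ij}=(\mathcal{F}\varphi_j)(\rho(i))$. Set $$f=\mathcal{F}g,\qquad g=\sum_{j=1}^{\infty}\beta_j\varphi_j\in L^2(\mathbb{R}^d),\qquad \beta=\{\beta_1,\beta_2,\ldots\}.$$ Then, for every $n\in\mathbb{N}$ there is an $M\in\mathbb{N}$ such that, for all $m\geq M$, the solution $\{\tilde\beta_1,\ldots,\tilde\beta_n\}$ to $$\left(P_nU^*P_mUP_n|_{P_n l^2(\mathbb{N})}\right)\begin{pmatrix}\tilde\beta_1\\ \vdots\\ \tilde\beta_n\end{pmatrix}=P_nU^*P_m\begin{pmatrix}f(\rho(1))\\ \vdots\\ f(\rho(m))\end{pmatrix}$$ is unique. Also, if $$\tilde g=\sum_{j=1}^n\tilde\beta_j\varphi_j,\qquad \tilde f=\sum_{j=1}^n\tilde\beta_j\mathcal{F}\varphi_j,$$ then $$\|g-\tilde g\|_{L^2(\mathbb{R}^d)}\leq\sqrt{B}\,(1+K_{n,m})\,\|P_n^{\perp}\beta\|_{l^2(\mathbb{N})}$$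 and $$\|f-\tilde f\|_{L^{\infty}(\mathbb{R}^d)}\leq(2T)^{d/2}\sqrt{B}\,(1+K_{n,m})\,\|P_n^{\perp}\beta\|_{l^2(\mathbb{N})},$$ where $$K_{n,m}=\left\|\left(P_nU^*P_mUP_n|_{P_n l^2(\mathbb{N})}\right)^{-1}P_nU^*P_mUP_n^{\perp}\right\|.$$ Moreover, for fixed $n$, as $m\to\infty$, $$\left\|\left(P_nU^*P_mUP_n|_{P_n l^2(\mathbb{N})}\right)^{-1}\right\|\longrightarrow\left\|\left(P_nU^*UP_n|_{P_n l^2(\mathbb{N})}\right)^{-1}\right\|\leq\|(U^*U)^{-1}\|\leq\frac{\epsilon^d}{A}.$$ Finally, when $\{\varphi_j\}_{j\in\mathbb{N}}$ is an orthonormal set, $K_{n,m}\to0$ as $m\to\infty$ for fixed $n$.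
   Context: The Fourier transform is $(\mathcal{F}h)(y)=\int_{\mathbb{R}^d}h(x)e^{-2\pi\mathrm{i}x\cdot y}\,dx$. "Riesz basis with constants $A,B$ for $\mathcal{W}$" means that $\{\varphi_j\}$ is a Riesz basis of $\mathcal{W}$ with $A\sum_k|\alpha_k|^2\leq\|\sum_k\alpha_k\varphi_k\|^2\leq B\sum_k|\alpha_k|^2$ for all $\{\alpha_k\}\in l^2(\mathbb{N})$. $\{e_j\}_{j\in\mathbb{N}}$ is the standard basis of $l^2(\mathbb{N})$, $P_n$ is the orthogonal projection of $l^2(\mathbb{N})$ onto $\mathrm{span}\{e_1,\ldots,e_n\}$, and $P_n^{\perp}=I-P_n$. Vectors in $\mathbb{C}^m$ are identified with elements of $P_m l^2(\mathbb{N})$. Point values of $f$ and $\mathcal{F}\varphi_j$ are those of the continuous functions given by the Fourier integral (the functions $g,\varphi_j$ are supported in $[-T,T]^d$, hence integrable). *)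

theory Defs
  imports "HOL-Analysis.Analysis" "HOL-Probability.Essential_Supremum"
begin

text \<open>
  Sequences indexed by the positive integers are indexed here by \<open>nat\<close> from 0: the \<open>k\<close>-th term
  of a sequence is the value at \<open>k - 1\<close>, and the span of the first \<open>n\<close> standard basis vectors
  consists of the sequences vanishing outside \<open>{..<n}\<close>.
\<close>

subsection \<open>Square-integrable functions\<close>

text \<open>Elements of \<open>L\<^sup>2\<close> are represented by Lebesgue measurable functions; identities between
  them are understood up to null sets, i.e. up to \<open>L2_norm\<close> of the difference being 0.\<close>

definition L2 :: "('a::euclidean_space \<Rightarrow> complex) set" where
  "L2 = {h. h \<in> borel_measurable lebesgue \<and> integrable lebesgue (\<lambda>x. (cmod (h x))\<^sup>2)}"

definition L2_norm :: "('a::euclidean_space \<Rightarrow> complex) \<Rightarrow> real" where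
  "L2_norm h = sqrt (LINT x|lebesgue. (cmod (h x))\<^sup>2)"

definition L2_orthonormal :: "(nat \<Rightarrow> 'a::euclidean_space \<Rightarrow> complex) \<Rightarrow> bool" where
  "L2_orthonormal \<phi> \<longleftrightarrow>
     (\<forall>i j. (LINT x|lebesgue. \<phi> i x * cnj (\<phi> j x)) = (if i = j then 1 else 0))"

definition L2_sums :: "(nat \<Rightarrow> 'a::euclidean_space \<Rightarrow> complex) \<Rightarrow> ('a \<Rightarrow> complex) \<Rightarrow> bool" where
  "L2_sums u h \<longleftrightarrow> (\<forall>k. u k \<in> L2) \<and> h \<in> L2 \<and>
     (\<lambda>N. L2_norm (\<lambda>x. h x - (\<Sum>k<N. u k x))) \<longlonglongrightarrow> 0"

definition L2_closed_span :: "(nat \<Rightarrow> 'a::euclidean_space \<Rightarrow> complex) \<Rightarrow> ('a \<Rightarrow> complex) set" where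
  "L2_closed_span \<phi> =
     {h \<in> L2. \<forall>e>0. \<exists>N c. L2_norm (\<lambda>x. h x - (\<Sum>k<N. c k * \<phi> k x)) < e}"

text \<open>The support of a class of functions modulo null sets: the complement of the largest open set
  on which the function vanishes almost everywhere.\<close>

definition ess_support :: "('a::euclidean_space \<Rightarrow> complex) \<Rightarrow> 'a set" where
  "ess_support h = - \<Union>{S. open S \<and> (AE x in lebesgue. x \<in> S \<longrightarrow> h x = 0)}"

definition fourier :: "('a::euclidean_space \<Rightarrow> complex) \<Rightarrow> 'a \<Rightarrow> complex" where
  "fourier h y =
     (LINT x|lebesgue. h x * exp (- (2 * complex_of_real pi * \<i> * complex_of_real (x \<bullet> y))))"

definition scaled_lattice :: "real \<Rightarrow> (real ^ 'd) set" where
  "scaled_lattice \<epsilon> = {x. \<forall>i. \<exists>k::int. x $ i = \<epsilon> * of_int k}"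


subsection \<open>Square-summable sequences, infinite matrices\<close>

definition ell2 :: "(nat \<Rightarrow> complex) set" where
  "ell2 = {x. summable (\<lambda>k. (cmod (x k))\<^sup>2)}"

definition ell2_norm :: "(nat \<Rightarrow> complex) \<Rightarrow> real" where
  "ell2_norm x = sqrt (\<Sum>k. (cmod (x k))\<^sup>2)"

text \<open>A complete system satisfying the two-sided \<open>\<ell>\<^sup>2\<close> estimate; the series is required to
  converge in \<open>L\<^sup>2\<close>, which is implicit in writing its norm.\<close>

definition riesz_basis ::
  "(nat \<Rightarrow> 'a::euclidean_space \<Rightarrow> complex) \<Rightarrow> ('a \<Rightarrow> complex) set \<Rightarrow> real \<Rightarrow> real \<Rightarrow> bool" where
  "riesz_basis \<phi> W A B \<longleftrightarrow>
     (\<forall>j. \<phi> j \<in> L2) \<and> W = L2_closed_span \<phi> \<and>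
     (\<forall>\<alpha>\<in>ell2. \<exists>h. L2_sums (\<lambda>k x. \<alpha> k * \<phi> k x) h \<and>
        A * (\<Sum>k. (cmod (\<alpha> k))\<^sup>2) \<le> (L2_norm h)\<^sup>2 \<and>
        (L2_norm h)\<^sup>2 \<le> B * (\<Sum>k. (cmod (\<alpha> k))\<^sup>2))"

definition mat_op :: "(nat \<Rightarrow> nat \<Rightarrow> complex) \<Rightarrow> (nat \<Rightarrow> complex) \<Rightarrow> (nat \<Rightarrow> complex)" where
  "mat_op U x = (\<lambda>i. \<Sum>j. U i j * x j)"

definition mat_adj :: "(nat \<Rightarrow> nat \<Rightarrow> complex) \<Rightarrow> (nat \<Rightarrow> nat \<Rightarrow> complex)" where
  "mat_adj U = (\<lambda>i j. cnj (U j i))"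

text \<open>Orthogonal projection onto the span of the first \<open>n\<close> basis vectors, and its complement.
  It is defined on all sequences, so that \<open>Pn m\<close> also turns the samples of a function into a
  vector of length \<open>m\<close>.\<close>

definition Pn :: "nat \<Rightarrow> (nat \<Rightarrow> complex) \<Rightarrow> (nat \<Rightarrow> complex)" where
  "Pn n x = (\<lambda>k. if k < n then x k else 0)"

definition Pn_perp :: "nat \<Rightarrow> (nat \<Rightarrow> complex) \<Rightarrow> (nat \<Rightarrow> complex)" where
  "Pn_perp n x = (\<lambda>k. x k - Pn n x k)"

abbreviation Pn_space :: "nat \<Rightarrow> (nat \<Rightarrow> complex) set" where
  "Pn_space n \<equiv> Pn n ` ell2"

definition ell2_bounded ::
  "(nat \<Rightarrow> complex) set \<Rightarrow> ((nat \<Rightarrow> complex) \<Rightarrow> (nat \<Rightarrow> complex)) \<Rightarrow> bool" where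
  "ell2_bounded S F \<longleftrightarrow>
     (\<forall>x\<in>S. F x \<in> ell2) \<and> (\<exists>C. \<forall>x\<in>S. ell2_norm (F x) \<le> C * ell2_norm x)"

text \<open>Operator norm of \<open>F\<close> on the subspace \<open>S\<close> of \<open>\<ell>\<^sup>2\<close>; meaningful when \<open>ell2_bounded S F\<close>
  (the supremum of an unbounded set of reals is unspecified).\<close>

definition op_norm ::
  "(nat \<Rightarrow> complex) set \<Rightarrow> ((nat \<Rightarrow> complex) \<Rightarrow> (nat \<Rightarrow> complex)) \<Rightarrow> real" where
  "op_norm S F = (SUP x\<in>{x \<in> S. ell2_norm x \<le> 1}. ell2_norm (F x))"

definition ell2_invertible ::
  "(nat \<Rightarrow> complex) set \<Rightarrow> ((nat \<Rightarrow> complex) \<Rightarrow> (nat \<Rightarrow> complex)) \<Rightarrow> bool" where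
  "ell2_invertible S F \<longleftrightarrow>
     bij_betw F S S \<and> ell2_bounded S F \<and> ell2_bounded S (inv_into S F)"

text \<open>The matrix \<open>U\<close> acts as a bounded operator on \<open>\<ell>\<^sup>2\<close>.  Row summability is listed because
  \<open>suminf\<close> is unspecified on divergent series.\<close>

definition bounded_matrix :: "(nat \<Rightarrow> nat \<Rightarrow> complex) \<Rightarrow> bool" where
  "bounded_matrix U \<longleftrightarrow>
     (\<forall>x\<in>ell2. \<forall>i. summable (\<lambda>j. U i j * x j)) \<and> ell2_bounded ell2 (mat_op U)"

definition gram_op :: "(nat \<Rightarrow> nat \<Rightarrow> complex) \<Rightarrow> (nat \<Rightarrow> complex) \<Rightarrow> (nat \<Rightarrow> complex)" where
  "gram_op U = mat_op (mat_adj U) \<circ> mat_op U"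

definition gram_section ::
  "(nat \<Rightarrow> nat \<Rightarrow> complex) \<Rightarrow> nat \<Rightarrow> (nat \<Rightarrow> complex) \<Rightarrow> (nat \<Rightarrow> complex)" where
  "gram_section U n = Pn n \<circ> gram_op U \<circ> Pn n"

definition uneven_section ::
  "(nat \<Rightarrow> nat \<Rightarrow> complex) \<Rightarrow> nat \<Rightarrow> nat \<Rightarrow> (nat \<Rightarrow> complex) \<Rightarrow> (nat \<Rightarrow> complex)" where
  "uneven_section U n m = Pn n \<circ> mat_op (mat_adj U) \<circ> Pn m \<circ> mat_op U \<circ> Pn n"

definition K_const :: "(nat \<Rightarrow> nat \<Rightarrow> complex) \<Rightarrow> nat \<Rightarrow> nat \<Rightarrow> real" where
  "K_const U n m = op_norm ell2
     (inv_into (Pn_space n) (uneven_section U n m) \<circ>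
        Pn n \<circ> mat_op (mat_adj U) \<circ> Pn m \<circ> mat_op U \<circ> Pn_perp n)"

end

theory Submission
  imports Defs
begin

text \<open>
  Since \<open>\<epsilon> \<le> 1 / (2 T)\<close>, all functions involved are supported in a period cube of the lattice dual to
  \<open>(\<epsilon> \<int>)\<^sup>d\<close>, so by Parseval's identity the samples of the Fourier transform of \<open>h\<close> satisfy
  \<open>\<Sum>\<^sub>i |(F h)(\<rho> i)|\<^sup>2 = \<epsilon>\<^sup>-\<^sup>d \<parallel>h\<parallel>\<^sup>2\<close>. Combined with the Riesz bounds this gives
  \<open>(A / \<epsilon>\<^sup>d) \<parallel>x\<parallel>\<^sup>2 \<le> \<parallel>U x\<parallel>\<^sup>2 \<le> (B / \<epsilon>\<^sup>d) \<parallel>x\<parallel>\<^sup>2\<close>. Everything else is operator theory: for fixed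
  \<open>n\<close>, \<open>P\<^sub>m U P\<^sub>n \<rightarrow> U P\<^sub>n\<close> in norm, so \<open>P\<^sub>n U\<^sup>* P\<^sub>m U P\<^sub>n\<close> is coercive on the range of \<open>P\<^sub>n\<close> for large
  \<open>m\<close>, and the solution of the linear system is \<open>P\<^sub>n \<beta>\<close> plus the image of \<open>P\<^sub>n\<^sup>\<bottom> \<beta>\<close> under the operator
  whose norm is \<open>K\<^sub>n\<^sub>,\<^sub>m\<close>.
\<close>

subsection \<open>Square-integrable functions over a measure space\<close>

text \<open>Bessel's inequality falls out of an exact formula for the distance to a trigonometric
  polynomial; the reverse half of Parseval's identity needs density of the lattice exponentials in
  L2 of the cube. The obstacle there is that the exponentials identify opposite faces, so a
  continuous function is uniformly approximable only if its boundary values match. Approximants are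
  therefore forced to vanish on the boundary, at no cost in L2 because the faces form a null set.

  On the operator side two coercivity constants are needed. Half the lower frame bound suffices for
  the sections with \<open>P_m\<close>, but comparing the inverse of \<open>P_n U* U P_n\<close>
  with that of \<open>U* U\<close> requires the sharp constant, the reciprocal of the norm of the
  latter inverse.

  In the orthonormal case the given constants A and B may still be far from 1, so the operator
  theory is instantiated a second time with both Riesz constants equal to 1, which makes
  \<open>U* U\<close> a multiple of the identity.\<close>

definition sq_int :: "'a measure \<Rightarrow> ('a \<Rightarrow> complex) set" where
  "sq_int M = {f \<in> borel_measurable M. integrable M (\<lambda>x. (cmod (f x))\<^sup>2)}"

text \<open>The real part of the Hermitian product: complex numbers are treated as a real inner
  product space. That is enough for norms, Pythagoras and coercivity; the complex-valued product is
  introduced later for Fourier coefficients.\<close>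

definition sq_inner :: "'a measure \<Rightarrow> ('a \<Rightarrow> complex) \<Rightarrow> ('a \<Rightarrow> complex) \<Rightarrow> real" where
  "sq_inner M f g = (LINT x|M. f x \<bullet> g x)"

definition sq_norm :: "'a measure \<Rightarrow> ('a \<Rightarrow> complex) \<Rightarrow> real" where
  "sq_norm M f = sqrt (LINT x|M. (cmod (f x))\<^sup>2)"

lemma sq_int_measurable [measurable_dest]: "f \<in> sq_int M \<Longrightarrow> f \<in> borel_measurable M"
  by (simp add: sq_int_def)

lemma sq_int_integrable: "f \<in> sq_int M \<Longrightarrow> integrable M (\<lambda>x. (cmod (f x))\<^sup>2)"
  by (simp add: sq_int_def)

lemma abs_inner_le_sum_squares:
  fixes a b :: "'a::real_inner"
  shows "\<bar>a \<bullet> b\<bar> \<le> (norm a)\<^sup>2 + (norm b)\<^sup>2"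
proof -
  have "\<bar>a \<bullet> b\<bar> \<le> norm a * norm b"
    by (rule Cauchy_Schwarz_ineq2)
  also have "2 * (norm a * norm b) \<le> (norm a)\<^sup>2 + (norm b)\<^sup>2"
    using sum_squares_bound[of "norm a" "norm b"] by simp
  finally show ?thesis
    using zero_le_power2[of "norm a"] zero_le_power2[of "norm b"]
    by (smt (verit) mult_nonneg_nonneg norm_ge_zero)
qed

lemma sq_int_inner_integrable:
  assumes "f \<in> sq_int M" "g \<in> sq_int M"
  shows "integrable M (\<lambda>x. f x \<bullet> g x)"
proof (rule Bochner_Integration.integrable_bound)
  show "integrable M (\<lambda>x. (cmod (f x))\<^sup>2 + (cmod (g x))\<^sup>2)"
    using assms by (intro Bochner_Integration.integrable_add sq_int_integrable)
  show "(\<lambda>x. f x \<bullet> g x) \<in> borel_measurable M"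
    using assms by measurable
  show "AE x in M. norm (f x \<bullet> g x) \<le> norm ((cmod (f x))\<^sup>2 + (cmod (g x))\<^sup>2)"
    using abs_inner_le_sum_squares[where 'a=complex] by (intro AE_I2) (simp)
qed

lemma sq_int_add:
  assumes "f \<in> sq_int M" "g \<in> sq_int M"
  shows "(\<lambda>x. f x + g x) \<in> sq_int M"
proof -
  have [measurable]: "f \<in> borel_measurable M" "g \<in> borel_measurable M"
    using assms by (auto dest: sq_int_measurable)
  have eq: "(cmod (f x + g x))\<^sup>2 = (cmod (f x))\<^sup>2 + 2 * (f x \<bullet> g x) + (cmod (g x))\<^sup>2" for x
    by (simp add: power2_norm_eq_inner inner_add inner_commute)
  show ?thesis
    unfolding sq_int_def using assms
    by (auto simp: eq intro!: Bochner_Integration.integrable_add integrable_mult_right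
        sq_int_inner_integrable sq_int_integrable)
qed

lemma sq_int_scale:
  assumes "f \<in> sq_int M"
  shows "(\<lambda>x. c * f x) \<in> sq_int M"
  using assms by (auto simp: sq_int_def norm_mult power_mult_distrib)

lemma sq_int_zero [simp]: "(\<lambda>x. 0) \<in> sq_int M"
  by (simp add: sq_int_def)

lemma sq_int_diff:
  assumes "f \<in> sq_int M" "g \<in> sq_int M"
  shows "(\<lambda>x. f x - g x) \<in> sq_int M"
  using sq_int_add[OF assms(1) sq_int_scale[OF assms(2), of "-1"]] by simp

lemma sq_int_sum:
  assumes "\<And>i. i \<in> I \<Longrightarrow> f i \<in> sq_int M"
  shows "(\<lambda>x. \<Sum>i\<in>I. f i x) \<in> sq_int M"
  using assms by (induction I rule: infinite_finite_induct) (auto intro: sq_int_add)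

lemma sq_norm_nonneg [simp]: "sq_norm M f \<ge> 0"
  by (simp add: sq_norm_def)

lemma sq_norm_sq: "(sq_norm M f)\<^sup>2 = (LINT x|M. (cmod (f x))\<^sup>2)"
  by (simp add: sq_norm_def)

lemma sq_norm_inner: "(sq_norm M f)\<^sup>2 = sq_inner M f f"
  by (simp add: sq_norm_sq sq_inner_def power2_norm_eq_inner)

lemma sq_norm_zero [simp]: "sq_norm M (\<lambda>x. 0) = 0"
  by (simp add: sq_norm_def)

lemma sq_inner_commute: "sq_inner M f g = sq_inner M g f"
  by (simp add: sq_inner_def inner_commute)

lemma sq_inner_diff_left:
  assumes "f \<in> sq_int M" "g \<in> sq_int M" "h \<in> sq_int M"
  shows "sq_inner M (\<lambda>x. f x - g x) h = sq_inner M f h - sq_inner M g h"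
  using assms by (simp add: sq_inner_def inner_diff sq_int_inner_integrable)

lemma sq_inner_scale_left: "sq_inner M (\<lambda>x. complex_of_real c * f x) h = c * sq_inner M f h"
  by (simp add: sq_inner_def flip: scaleR_conv_of_real)

lemma sq_inner_scale_right: "sq_inner M h (\<lambda>x. complex_of_real c * f x) = c * sq_inner M h f"
  by (simp add: sq_inner_def flip: scaleR_conv_of_real)

lemma sq_norm_scale: "sq_norm M (\<lambda>x. c * f x) = cmod c * sq_norm M f"
  by (simp add: sq_norm_def norm_mult power_mult_distrib real_sqrt_mult)

lemma sq_norm_minus_commute: "sq_norm M (\<lambda>x. f x - g x) = sq_norm M (\<lambda>x. g x - f x)"
  by (simp add: sq_norm_def norm_minus_commute)

lemma sq_norm_add_sq:
  assumes "f \<in> sq_int M" "g \<in> sq_int M"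
  shows "(sq_norm M (\<lambda>x. f x + g x))\<^sup>2 = (sq_norm M f)\<^sup>2 + 2 * sq_inner M f g + (sq_norm M g)\<^sup>2"
  using assms
  by (simp add: sq_norm_inner sq_inner_def inner_add sq_int_inner_integrable inner_commute sq_int_add)

lemma sq_norm_eq_0_AE:
  assumes "f \<in> sq_int M"
  shows "sq_norm M f = 0 \<longleftrightarrow> (AE x in M. f x = 0)"
  using assms by (simp add: sq_norm_def integral_nonneg_eq_0_iff_AE sq_int_integrable)

text \<open>Expanding the square of \<open>b f + s a g\<close>, with \<open>a\<close> and
  \<open>b\<close> the two norms and \<open>s\<close> a sign, gives
  \<open>2 a b (a b + s <f, g>)\<close>, and the positive factor cancels. With a zero norm the
  integrand vanishes almost everywhere.\<close>

lemma sq_Cauchy_Schwarz: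
  assumes f: "f \<in> sq_int M" and g: "g \<in> sq_int M"
  shows "\<bar>sq_inner M f g\<bar> \<le> sq_norm M f * sq_norm M g"
proof (cases "sq_norm M f = 0 \<or> sq_norm M g = 0")
  case True
  then have "AE x in M. f x \<bullet> g x = 0"
    using sq_norm_eq_0_AE[OF f] sq_norm_eq_0_AE[OF g] by auto
  then have "sq_inner M f g = 0"
    unfolding sq_inner_def by (rule integral_eq_zero_AE)
  then show ?thesis
    by simp
next
  case False
  define a b where "a = sq_norm M f" and "b = sq_norm M g"
  have pos: "a > 0" "b > 0"
    using False by (simp_all add: a_def b_def order_less_le)
  have *: "0 \<le> a * b + s * sq_inner M f g" if s: "s = 1 \<or> s = -1" for s
  proof -
    have "0 \<le> (sq_norm M (\<lambda>x. complex_of_real b * f x + complex_of_real (s * a) * g x))\<^sup>2"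
      by simp
    also have "\<dots> = (sq_norm M (\<lambda>x. complex_of_real b * f x))\<^sup>2
        + 2 * sq_inner M (\<lambda>x. complex_of_real b * f x) (\<lambda>x. complex_of_real (s * a) * g x)
        + (sq_norm M (\<lambda>x. complex_of_real (s * a) * g x))\<^sup>2"
      by (intro sq_norm_add_sq sq_int_scale f g)
    also have "\<dots> = (b * a)\<^sup>2 + 2 * (b * (s * a * sq_inner M f g)) + (s * a * b)\<^sup>2"
      unfolding sq_norm_scale sq_inner_scale_left sq_inner_scale_right
      by (simp add: norm_mult power_mult_distrib a_def b_def del: of_real_mult)
    also have "\<dots> = (2 * (a * b)) * (a * b + s * sq_inner M f g)"
      using s by (auto simp: power2_eq_square algebra_simps)
    finally show ?thesis
      using pos by (simp add: zero_le_mult_iff) (smt (verit) mult_pos_pos)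
  qed
  show ?thesis
    using *[of 1] *[of "-1"] by (simp add: a_def b_def)
qed

lemma sq_norm_triangle:
  assumes "f \<in> sq_int M" "g \<in> sq_int M"
  shows "sq_norm M (\<lambda>x. f x + g x) \<le> sq_norm M f + sq_norm M g"
proof (rule power2_le_imp_le)
  show "(sq_norm M (\<lambda>x. f x + g x))\<^sup>2 \<le> (sq_norm M f + sq_norm M g)\<^sup>2"
    using sq_norm_add_sq[OF assms] sq_Cauchy_Schwarz[OF assms] by (simp add: power2_sum)
qed simp

lemma sq_norm_triangle_diff:
  assumes "f \<in> sq_int M" "g \<in> sq_int M"
  shows "sq_norm M (\<lambda>x. f x - g x) \<le> sq_norm M f + sq_norm M g"
  using sq_norm_triangle[OF assms(1) sq_int_scale[OF assms(2), of "-1"]]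
  by (simp add: sq_norm_scale[of M "-1" g, simplified])

lemma sq_norm_triangle_via:
  assumes "f \<in> sq_int M" "g \<in> sq_int M" "h \<in> sq_int M"
  shows "sq_norm M (\<lambda>x. f x - h x) \<le> sq_norm M (\<lambda>x. f x - g x) + sq_norm M (\<lambda>x. g x - h x)"
  using sq_norm_triangle[OF sq_int_diff[OF assms(1,2)] sq_int_diff[OF assms(2,3)]] by simp

lemma sq_norm_reverse_triangle:
  assumes "f \<in> sq_int M" "g \<in> sq_int M"
  shows "\<bar>sq_norm M f - sq_norm M g\<bar> \<le> sq_norm M (\<lambda>x. f x - g x)"
  using sq_norm_triangle[OF sq_int_diff[OF assms] assms(2)]
    sq_norm_triangle[OF sq_int_diff[OF assms(2,1)] assms(1)]
  by (simp add: sq_norm_minus_commute[of M f g])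

text \<open>Lebesgue measure and counting measure on the naturals give two instances of the same
  space, so functions and sequences inherit the norm inequalities alike.\<close>

lemma L2_eq: "L2 = sq_int lebesgue"
  by (simp add: L2_def sq_int_def)

lemma L2_norm_eq: "L2_norm = sq_norm lebesgue"
  by (simp add: fun_eq_iff L2_norm_def sq_norm_def)

lemma ell2_eq: "ell2 = sq_int (count_space UNIV)"
  by (simp add: ell2_def sq_int_def integrable_count_space_nat_iff)

lemma ell2_summable: "x \<in> ell2 \<Longrightarrow> summable (\<lambda>k. (cmod (x k))\<^sup>2)"
  by (simp add: ell2_def)

text \<open>Membership matters: outside \<open>ell2\<close> the integral is 0 by convention while
  \<open>suminf\<close> is unspecified.\<close>

lemma ell2_norm_eq:
  assumes "x \<in> ell2"
  shows "ell2_norm x = sq_norm (count_space UNIV) x"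
  using assms sq_int_integrable[of x "count_space UNIV"]
  by (simp add: ell2_norm_def sq_norm_def ell2_eq integral_count_space_nat)

definition ell2_inner :: "(nat \<Rightarrow> complex) \<Rightarrow> (nat \<Rightarrow> complex) \<Rightarrow> real" where
  "ell2_inner = sq_inner (count_space UNIV)"

lemma ell2_inner_sums:
  assumes "x \<in> ell2" "y \<in> ell2"
  shows "(\<lambda>k. x k \<bullet> y k) sums ell2_inner x y"
  using sums_integral_count_space_nat[OF sq_int_inner_integrable[of x "count_space UNIV" y]] assms
  by (simp add: ell2_inner_def sq_inner_def ell2_eq)

lemma ell2_zero [simp]: "(\<lambda>k. 0) \<in> ell2"
  by (simp add: ell2_eq)

lemma ell2_add: "x \<in> ell2 \<Longrightarrow> y \<in> ell2 \<Longrightarrow> (\<lambda>k. x k + y k) \<in> ell2"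
  by (simp add: ell2_eq sq_int_add)

lemma ell2_diff: "x \<in> ell2 \<Longrightarrow> y \<in> ell2 \<Longrightarrow> (\<lambda>k. x k - y k) \<in> ell2"
  by (simp add: ell2_eq sq_int_diff)

lemma ell2_scale: "x \<in> ell2 \<Longrightarrow> (\<lambda>k. c * x k) \<in> ell2"
  by (simp add: ell2_eq sq_int_scale)

lemma ell2_sum: "(\<And>i. i \<in> I \<Longrightarrow> x i \<in> ell2) \<Longrightarrow> (\<lambda>k. \<Sum>i\<in>I. x i k) \<in> ell2"
  by (simp add: ell2_eq sq_int_sum)

lemma ell2_norm_nonneg: "x \<in> ell2 \<Longrightarrow> ell2_norm x \<ge> 0"
  by (simp add: ell2_norm_eq)

lemma ell2_norm_zero [simp]: "ell2_norm (\<lambda>k. 0) = 0"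
  by (simp add: ell2_norm_def)

lemma ell2_norm_sq: "x \<in> ell2 \<Longrightarrow> (ell2_norm x)\<^sup>2 = (\<Sum>k. (cmod (x k))\<^sup>2)"
  by (simp add: ell2_norm_def suminf_nonneg ell2_summable)

lemma ell2_norm_inner: "x \<in> ell2 \<Longrightarrow> (ell2_norm x)\<^sup>2 = ell2_inner x x"
  by (simp add: ell2_norm_eq ell2_inner_def sq_norm_inner)

lemma ell2_norm_eq_0: "x \<in> ell2 \<Longrightarrow> ell2_norm x = 0 \<longleftrightarrow> x = (\<lambda>k. 0)"
  using sq_norm_eq_0_AE[of x "count_space UNIV"]
  by (auto simp: ell2_norm_eq ell2_eq AE_count_space fun_eq_iff)

lemma ell2_norm_scale: "ell2_norm (\<lambda>k. c * x k) = cmod c * ell2_norm x" if "x \<in> ell2"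
  using that by (simp add: ell2_norm_eq ell2_scale sq_norm_scale)

lemma ell2_norm_triangle:
  "x \<in> ell2 \<Longrightarrow> y \<in> ell2 \<Longrightarrow> ell2_norm (\<lambda>k. x k + y k) \<le> ell2_norm x + ell2_norm y"
  by (simp add: ell2_norm_eq ell2_add) (simp add: ell2_eq sq_norm_triangle)

lemma ell2_norm_triangle_diff:
  "x \<in> ell2 \<Longrightarrow> y \<in> ell2 \<Longrightarrow> ell2_norm (\<lambda>k. x k - y k) \<le> ell2_norm x + ell2_norm y"
  by (simp add: ell2_norm_eq ell2_diff) (simp add: ell2_eq sq_norm_triangle_diff)

lemma ell2_norm_triangle_via:
  "x \<in> ell2 \<Longrightarrow> y \<in> ell2 \<Longrightarrow> z \<in> ell2 \<Longrightarrow>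
    ell2_norm (\<lambda>k. x k - z k) \<le> ell2_norm (\<lambda>k. x k - y k) + ell2_norm (\<lambda>k. y k - z k)"
  by (simp add: ell2_norm_eq ell2_diff) (simp add: ell2_eq sq_norm_triangle_via)

lemma ell2_norm_reverse_triangle:
  "x \<in> ell2 \<Longrightarrow> y \<in> ell2 \<Longrightarrow> \<bar>ell2_norm x - ell2_norm y\<bar> \<le> ell2_norm (\<lambda>k. x k - y k)"
  by (simp add: ell2_norm_eq ell2_diff) (simp add: ell2_eq sq_norm_reverse_triangle)

lemma ell2_Cauchy_Schwarz:
  "x \<in> ell2 \<Longrightarrow> y \<in> ell2 \<Longrightarrow> \<bar>ell2_inner x y\<bar> \<le> ell2_norm x * ell2_norm y"
  by (simp add: ell2_norm_eq ell2_inner_def) (simp add: ell2_eq sq_Cauchy_Schwarz)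

lemma ell2_norm_add_sq:
  "x \<in> ell2 \<Longrightarrow> y \<in> ell2 \<Longrightarrow>
    (ell2_norm (\<lambda>k. x k + y k))\<^sup>2 = (ell2_norm x)\<^sup>2 + 2 * ell2_inner x y + (ell2_norm y)\<^sup>2"
  by (simp add: ell2_norm_eq ell2_inner_def ell2_add) (simp add: ell2_eq sq_norm_add_sq)

subsection \<open>Coercive operators on square-summable sequences\<close>

lemma ell2_boundI:
  assumes "\<And>K. (\<Sum>k<K. (cmod (x k))\<^sup>2) \<le> C\<^sup>2" and "C \<ge> 0"
  shows "x \<in> ell2" and "ell2_norm x \<le> C"
proof -
  have s: "summable (\<lambda>k. (cmod (x k))\<^sup>2)"
    using assms(1) by (intro summableI_nonneg_bounded) auto
  then show "x \<in> ell2"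
    by (simp add: ell2_def)
  have "(\<Sum>k. (cmod (x k))\<^sup>2) \<le> C\<^sup>2"
    by (intro suminf_le_const s) (use assms in auto)
  then show "ell2_norm x \<le> C"
    unfolding ell2_norm_def using assms(2) by (simp add: real_le_lsqrt suminf_nonneg s)
qed

lemma ell2_sum_le:
  assumes "x \<in> ell2" "finite I"
  shows "(\<Sum>k\<in>I. (cmod (x k))\<^sup>2) \<le> (ell2_norm x)\<^sup>2"
  unfolding ell2_norm_sq[OF assms(1)]
  using assms by (intro sum_le_suminf ell2_summable) auto

lemma ell2_coord_le:
  assumes "x \<in> ell2"
  shows "cmod (x k) \<le> ell2_norm x"
  using ell2_sum_le[OF assms, of "{k}"] ell2_norm_nonneg[OF assms]
  by (simp add: power2_le_iff_abs_le)

text \<open>Fatou's lemma for sequences: every finite partial sum of squares passes to the limit. It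
  takes the place of completeness, since limits are constructed coordinate by coordinate and the
  norm bounds follow them.\<close>

lemma ell2_limit:
  assumes "\<And>N. s N \<in> ell2" "\<And>N. ell2_norm (s N) \<le> e" "\<And>k. (\<lambda>N. s N k) \<longlonglongrightarrow> x k"
  shows "x \<in> ell2" and "ell2_norm x \<le> e"
proof -
  have e: "e \<ge> 0"
    using assms(2)[of 0] ell2_norm_nonneg[OF assms(1)[of 0]] by linarith
  have "(\<Sum>k<K. (cmod (x k))\<^sup>2) \<le> e\<^sup>2" for K
  proof (rule LIMSEQ_le_const2)
    show "(\<lambda>N. \<Sum>k<K. (cmod (s N k))\<^sup>2) \<longlonglongrightarrow> (\<Sum>k<K. (cmod (x k))\<^sup>2)"
      by (intro tendsto_intros assms)
    have "(\<Sum>k<K. (cmod (s N k))\<^sup>2) \<le> e\<^sup>2" for N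
      using ell2_sum_le[OF assms(1)[of N], of "{..<K}"]
        power_mono[OF assms(2)[of N] ell2_norm_nonneg[OF assms(1)], of 2] by simp
    then show "\<exists>N. \<forall>n\<ge>N. (\<Sum>k<K. (cmod (s n k))\<^sup>2) \<le> e\<^sup>2"
      by blast
  qed
  with e show "x \<in> ell2" "ell2_norm x \<le> e"
    using ell2_boundI[of x e] by auto
qed

lemma ell2_norm_sum_le:
  assumes "\<And>i. i \<in> I \<Longrightarrow> x i \<in> ell2"
  shows "ell2_norm (\<lambda>k. \<Sum>i\<in>I. x i k) \<le> (\<Sum>i\<in>I. ell2_norm (x i))"
  using assms
proof (induction I rule: infinite_finite_induct)
  case (insert i I)
  then show ?case
    using ell2_norm_triangle[of "x i" "\<lambda>k. \<Sum>i\<in>I. x i k"] ell2_sum[of I x] by force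
qed auto

lemma ell2_inner_diff_left:
  "x \<in> ell2 \<Longrightarrow> y \<in> ell2 \<Longrightarrow> z \<in> ell2 \<Longrightarrow>
    ell2_inner (\<lambda>k. x k - y k) z = ell2_inner x z - ell2_inner y z"
  by (simp add: ell2_inner_def ell2_eq sq_inner_diff_left)

lemma ell2_inner_scale_left:
  "ell2_inner (\<lambda>k. complex_of_real c * x k) z = c * ell2_inner x z"
  by (simp add: ell2_inner_def sq_inner_scale_left)

lemma ell2_inner_commute: "ell2_inner x y = ell2_inner y x"
  by (simp add: ell2_inner_def sq_inner_commute)

lemma ell2_norm_diff_sq:
  assumes "x \<in> ell2" "y \<in> ell2"
  shows "(ell2_norm (\<lambda>k. x k - complex_of_real t * y k))\<^sup>2 =
    (ell2_norm x)\<^sup>2 - 2 * t * ell2_inner y x + t\<^sup>2 * (ell2_norm y)\<^sup>2"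
  using ell2_norm_add_sq[OF assms(1) ell2_scale[OF assms(2), of "complex_of_real (- t)"]]
  by (simp add: ell2_norm_scale[OF assms(2), of "complex_of_real (- t)", simplified]
      ell2_inner_commute[of x] ell2_inner_scale_left[of "- t", simplified] power_mult_distrib)

text \<open>\<open>Z = {}\<close> gives all of \<open>\<ell>\<^sup>2\<close> and \<open>Z = {n..}\<close> the range of \<open>P\<^sub>n\<close>, so that one coercivity
  argument serves both.\<close>

definition ell2_off :: "nat set \<Rightarrow> (nat \<Rightarrow> complex) set" where
  "ell2_off Z = {x \<in> ell2. \<forall>k\<in>Z. x k = 0}"

lemma ell2_off_ell2: "x \<in> ell2_off Z \<Longrightarrow> x \<in> ell2"
  by (simp add: ell2_off_def)

lemma ell2_off_zero [simp]: "(\<lambda>k. 0) \<in> ell2_off Z"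
  by (simp add: ell2_off_def)

lemma ell2_off_add: "x \<in> ell2_off Z \<Longrightarrow> y \<in> ell2_off Z \<Longrightarrow> (\<lambda>k. x k + y k) \<in> ell2_off Z"
  by (simp add: ell2_off_def ell2_add)

lemma ell2_off_diff: "x \<in> ell2_off Z \<Longrightarrow> y \<in> ell2_off Z \<Longrightarrow> (\<lambda>k. x k - y k) \<in> ell2_off Z"
  by (simp add: ell2_off_def ell2_diff)

lemma ell2_off_scale: "x \<in> ell2_off Z \<Longrightarrow> (\<lambda>k. c * x k) \<in> ell2_off Z"
  by (simp add: ell2_off_def ell2_scale)

lemma ell2_off_sum: "(\<And>i. i \<in> I \<Longrightarrow> x i \<in> ell2_off Z) \<Longrightarrow> (\<lambda>k. \<Sum>i\<in>I. x i k) \<in> ell2_off Z"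
  by (simp add: ell2_off_def ell2_sum)

lemma ell2_off_empty: "ell2_off {} = ell2"
  by (simp add: ell2_off_def)

definition linear_on_seq :: "(nat \<Rightarrow> complex) set \<Rightarrow> ((nat \<Rightarrow> complex) \<Rightarrow> (nat \<Rightarrow> complex)) \<Rightarrow> bool" where
  "linear_on_seq S F \<longleftrightarrow>
     (\<forall>x\<in>S. \<forall>y\<in>S. F (\<lambda>k. x k + y k) = (\<lambda>k. F x k + F y k)) \<and>
     (\<forall>c. \<forall>x\<in>S. F (\<lambda>k. c * x k) = (\<lambda>k. c * F x k))"

lemma linear_on_seq_add:
  "linear_on_seq S F \<Longrightarrow> x \<in> S \<Longrightarrow> y \<in> S \<Longrightarrow> F (\<lambda>k. x k + y k) = (\<lambda>k. F x k + F y k)"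
  by (simp add: linear_on_seq_def)

lemma linear_on_seq_scale:
  "linear_on_seq S F \<Longrightarrow> x \<in> S \<Longrightarrow> F (\<lambda>k. c * x k) = (\<lambda>k. c * F x k)"
  by (simp add: linear_on_seq_def)

lemma linear_on_seq_diff:
  assumes "linear_on_seq (ell2_off Z) F" "x \<in> ell2_off Z" "y \<in> ell2_off Z"
  shows "F (\<lambda>k. x k - y k) = (\<lambda>k. F x k - F y k)"
  using linear_on_seq_add[OF assms(1,2) ell2_off_scale[OF assms(3), of "-1"]]
    linear_on_seq_scale[OF assms(1,3), of "-1"] by simp

lemma linear_on_seq_zero:
  assumes "linear_on_seq (ell2_off Z) F"
  shows "F (\<lambda>k. 0) = (\<lambda>k. 0)"
  using linear_on_seq_scale[OF assms ell2_off_zero, of 0] by simp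

text \<open>The setting of the Lax-Milgram theorem, on a coordinate subspace. A lower bound for the
  real part of \<open><F x, x>\<close> already yields a bijection whose inverse has norm at most
  \<open>1 / a\<close>.\<close>

locale coercive_op =
  fixes Z :: "nat set" and F :: "(nat \<Rightarrow> complex) \<Rightarrow> (nat \<Rightarrow> complex)" and a b :: real
  assumes lin: "linear_on_seq (ell2_off Z) F"
    and maps: "x \<in> ell2_off Z \<Longrightarrow> F x \<in> ell2_off Z"
    and bound: "x \<in> ell2_off Z \<Longrightarrow> ell2_norm (F x) \<le> b * ell2_norm x"
    and a_pos: "a > 0"
    and coercive: "x \<in> ell2_off Z \<Longrightarrow> a * (ell2_norm x)\<^sup>2 \<le> ell2_inner (F x) x"
begin

lemma lower_bound:
  assumes "x \<in> ell2_off Z"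
  shows "a * ell2_norm x \<le> ell2_norm (F x)"
proof (cases "ell2_norm x = 0")
  case True
  then show ?thesis
    using ell2_norm_nonneg[OF ell2_off_ell2[OF maps[OF assms]]] by simp
next
  case False
  then have pos: "ell2_norm x > 0"
    using ell2_norm_nonneg[OF ell2_off_ell2[OF assms]] by linarith
  have "a * ell2_norm x * ell2_norm x \<le> ell2_norm (F x) * ell2_norm x"
    using coercive[OF assms] ell2_Cauchy_Schwarz[OF ell2_off_ell2[OF maps[OF assms]] ell2_off_ell2[OF assms]]
    by (simp add: power2_eq_square mult.assoc)
  then show ?thesis
    using pos by simp
qed

lemma injective: "inj_on F (ell2_off Z)"
proof (rule inj_onI)
  fix x y assume xy: "x \<in> ell2_off Z" "y \<in> ell2_off Z" "F x = F y"
  have "a * ell2_norm (\<lambda>k. x k - y k) \<le> 0"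
    using lower_bound[OF ell2_off_diff[OF xy(1,2)]] linear_on_seq_diff[OF lin xy(1,2)] xy(3) by simp
  then have "ell2_norm (\<lambda>k. x k - y k) = 0"
    using a_pos ell2_norm_nonneg[OF ell2_diff[OF xy(1,2)[THEN ell2_off_ell2]]]
    by (simp add: mult_le_0_iff)
  then show "x = y"
    using ell2_norm_eq_0[OF ell2_diff[OF xy(1,2)[THEN ell2_off_ell2]]] by (simp add: fun_eq_iff)
qed

text \<open>With a small step \<open>t\<close> the map \<open>v \<mapsto> v - t F v\<close> is a contraction, so the equation \<open>F x = y\<close>
  is solved by the Neumann series \<open>x = t \<Sum>\<^sub>k (I - t F)\<^sup>k y\<close>.\<close>

lemma surjective:
  assumes y: "y \<in> ell2_off Z"
  shows "\<exists>x\<in>ell2_off Z. F x = y"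
proof -
  \<comment> \<open>\<open>b\<close> comes without a sign. The maximum is a positive upper bound
    that is at least \<open>a\<close>, which keeps \<open>a^2 / c^2\<close> in (0, 1].\<close>
  define c where "c = max a b"
  have c: "c \<ge> a" "c > 0" "b \<le> c"
    using a_pos by (auto simp: c_def)
  \<comment> \<open>This \<open>t\<close> minimises \<open>1 - 2 t a + t^2 c^2\<close>, the bound
    for the squared contraction factor; the minimum is \<open>1 - a^2 / c^2\<close>, whose root is
    \<open>q\<close>.\<close>
  define t where "t = a / c\<^sup>2"
  define q where "q = sqrt (1 - a\<^sup>2 / c\<^sup>2)"
  have t: "t > 0"
    using a_pos c by (simp add: t_def)
  have "a\<^sup>2 / c\<^sup>2 > 0" "a\<^sup>2 / c\<^sup>2 \<le> 1"
    using a_pos c by (simp_all add: divide_le_eq power_mono)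
  then have q: "q \<ge> 0" "q < 1" "q\<^sup>2 = 1 - a\<^sup>2 / c\<^sup>2"
    by (auto simp: q_def)
  define R where "R v = (\<lambda>k. v k - complex_of_real t * F v k)" for v
  have R: "R v \<in> ell2_off Z" if "v \<in> ell2_off Z" for v
    unfolding R_def by (intro ell2_off_diff ell2_off_scale maps that)
  have contr: "ell2_norm (R v) \<le> q * ell2_norm v" if v: "v \<in> ell2_off Z" for v
  proof (rule power2_le_imp_le)
    have ve: "v \<in> ell2" "F v \<in> ell2"
      using v maps[OF v] by (auto dest: ell2_off_ell2)
    have Fv: "(ell2_norm (F v))\<^sup>2 \<le> c\<^sup>2 * (ell2_norm v)\<^sup>2"
    proof -
      have "ell2_norm (F v) \<le> c * ell2_norm v"
        using bound[OF v] mult_right_mono[OF c(3) ell2_norm_nonneg[OF ve(1)]] by linarith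
      then show ?thesis
        using power_mono[of "ell2_norm (F v)" "c * ell2_norm v" 2] ell2_norm_nonneg[OF ve(2)]
        by (simp add: power_mult_distrib)
    qed
    have "(ell2_norm (R v))\<^sup>2 = (ell2_norm v)\<^sup>2 - 2 * t * ell2_inner (F v) v + t\<^sup>2 * (ell2_norm (F v))\<^sup>2"
      unfolding R_def by (rule ell2_norm_diff_sq[OF ve])
    also have "\<dots> \<le> (ell2_norm v)\<^sup>2 - 2 * t * (a * (ell2_norm v)\<^sup>2) + t\<^sup>2 * (c\<^sup>2 * (ell2_norm v)\<^sup>2)"
      using t coercive[OF v] Fv by (intro add_mono diff_mono mult_left_mono) auto
    also have "\<dots> = (q * ell2_norm v)\<^sup>2"
      unfolding power_mult_distrib q(3) using c by (simp add: t_def field_simps power2_eq_square)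
    finally show "(ell2_norm (R v))\<^sup>2 \<le> (q * ell2_norm v)\<^sup>2" .
  qed (use q ell2_norm_nonneg[OF ell2_off_ell2[OF v]] in simp)
  define v where "v k = (R ^^ k) y" for k
  have v: "v k \<in> ell2_off Z" for k
    by (induction k) (simp_all add: v_def y R)
  have v_norm: "ell2_norm (v k) \<le> q ^ k * ell2_norm y" for k
  proof (induction k)
    case (Suc k)
    have "ell2_norm (v (Suc k)) \<le> q * ell2_norm (v k)"
      using contr[OF v[of k]] by (simp add: v_def)
    with mult_left_mono[OF Suc q(1)] show ?case
      by (simp add: mult.assoc)
  qed (simp add: v_def)
  have gs: "summable (\<lambda>k. q ^ k * ell2_norm y)"
    using q by (intro summable_mult2 summable_geometric) simp
  have "summable (\<lambda>k. v k j)" for j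
    by (rule summable_comparison_test[OF _ gs])
       (use ell2_coord_le[OF ell2_off_ell2[OF v]] v_norm order_trans in blast)
  note sums = summable_LIMSEQ[OF this]
  define s where "s N = (\<lambda>j. complex_of_real t * (\<Sum>k<N. v k j))" for N
  define x where "x j = complex_of_real t * (\<Sum>k. v k j)" for j
  define C where "C = t * (ell2_norm y / (1 - q))"
  have s: "s N \<in> ell2_off Z" for N
    unfolding s_def by (intro ell2_off_scale ell2_off_sum v)
  have s_lim: "(\<lambda>N. s N j) \<longlonglongrightarrow> x j" for j
    unfolding s_def x_def by (intro tendsto_intros sums)
  \<comment> \<open>Differences of partial sums are bounded by a geometric tail uniformly in
    \<open>M\<close>, so that \<open>ell2_limit\<close> can send \<open>M\<close> to infinity and
    bound the distance from \<open>s N\<close> to the limit.\<close>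
  have block: "ell2_norm (\<lambda>j. s (N + M) j - s N j) \<le> q ^ N * C" for N M
  proof -
    have "s (N + M) j - s N j = complex_of_real t * (\<Sum>k<M. v (N + k) j)" for j
      unfolding s_def sum.nat_group[symmetric]
      by (induction M) (auto simp: algebra_simps)
    then have "ell2_norm (\<lambda>j. s (N + M) j - s N j) = t * ell2_norm (\<lambda>j. \<Sum>k<M. v (N + k) j)"
      using t ell2_norm_scale[OF ell2_sum[of "{..<M}" "\<lambda>k. v (N + k)"], of "complex_of_real t"]
      by (simp add: ell2_off_ell2[OF v])
    also have "\<dots> \<le> t * (\<Sum>k<M. ell2_norm (v (N + k)))"
      using t by (intro mult_left_mono ell2_norm_sum_le ell2_off_ell2[OF v]) auto
    also have "\<dots> \<le> t * (\<Sum>k<M. q ^ N * ell2_norm y * q ^ k)"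
      using t v_norm[of "N + _"] by (intro mult_left_mono sum_mono) (simp_all add: power_add mult_ac)
    also have "\<dots> = t * (q ^ N * ell2_norm y * (\<Sum>k<M. q ^ k))"
      by (simp add: sum_distrib_left)
    also have "(\<Sum>k<M. q ^ k) \<le> 1 / (1 - q)"
      using q suminf_geometric[of q] sum_le_suminf[OF summable_geometric[of q], of "{..<M}"] by simp
    then have "t * (q ^ N * ell2_norm y * (\<Sum>k<M. q ^ k)) \<le> t * (q ^ N * ell2_norm y * (1 / (1 - q)))"
      using t q ell2_norm_nonneg[OF ell2_off_ell2[OF y]] by (intro mult_left_mono) auto
    finally show ?thesis
      by (simp add: C_def mult_ac)
  qed
  have tail: "(\<lambda>j. x j - s N j) \<in> ell2" "ell2_norm (\<lambda>j. x j - s N j) \<le> q ^ N * C" for N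
  proof -
    have 1: "(\<lambda>j. s (N + M) j - s N j) \<in> ell2" for M
      by (intro ell2_diff ell2_off_ell2[OF s])
    have 2: "(\<lambda>M. s (N + M) j - s N j) \<longlonglongrightarrow> x j - s N j" for j
      using LIMSEQ_ignore_initial_segment[OF s_lim[of j], of N]
      by (intro tendsto_diff tendsto_const) (simp add: add.commute)
    show "(\<lambda>j. x j - s N j) \<in> ell2" "ell2_norm (\<lambda>j. x j - s N j) \<le> q ^ N * C"
      using ell2_limit[OF 1 block 2] by auto
  qed
  have x: "x \<in> ell2_off Z"
  proof -
    have "s 0 = (\<lambda>j. 0)"
      by (simp add: s_def)
    then have "x \<in> ell2"
      using tail(1)[of 0] by simp
    moreover have "x j = 0" if "j \<in> Z" for j
      using v that by (simp add: x_def ell2_off_def)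
    ultimately show ?thesis
      by (simp add: ell2_off_def)
  qed
  \<comment> \<open>Telescoping: the residual \<open>y - F (s N)\<close> is the Neumann iterate
    \<open>v N\<close>, of norm at most \<open>q ^ N * ell2_norm y\<close>.\<close>
  have Fs: "F (s N) = (\<lambda>j. y j - v N j)" for N
  proof (induction N)
    case 0
    then show ?case
      by (simp add: s_def linear_on_seq_zero[OF lin] v_def)
  next
    case (Suc N)
    have "s (Suc N) = (\<lambda>j. s N j + complex_of_real t * v N j)"
      by (simp add: s_def algebra_simps)
    moreover have "v (Suc N) = (\<lambda>j. v N j - complex_of_real t * F (v N) j)"
      by (simp add: v_def R_def)
    ultimately show ?case
      using Suc linear_on_seq_add[OF lin s[of N] ell2_off_scale[OF v[of N]], of "complex_of_real t"]
        linear_on_seq_scale[OF lin v[of N], of "complex_of_real t"]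
      by (simp add: diff_diff_eq2 diff_add_eq)
  qed
  have Fy: "(\<lambda>j. F x j - y j) \<in> ell2"
    by (rule ell2_diff[OF ell2_off_ell2[OF maps[OF x]] ell2_off_ell2[OF y]])
  have est: "ell2_norm (\<lambda>j. F x j - y j) \<le> q ^ N * (c * C + ell2_norm y)" for N
  proof -
    have "ell2_norm (\<lambda>j. F x j - y j) \<le> ell2_norm (\<lambda>j. F x j - F (s N) j) + ell2_norm (\<lambda>j. F (s N) j - y j)"
      by (rule ell2_norm_triangle_via[OF ell2_off_ell2[OF maps[OF x]] ell2_off_ell2[OF maps[OF s]] ell2_off_ell2[OF y]])
    also have "ell2_norm (\<lambda>j. F (s N) j - y j) = ell2_norm (v N)"
      by (simp add: Fs ell2_norm_def)
    also have "(\<lambda>j. F x j - F (s N) j) = F (\<lambda>j. x j - s N j)"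
      by (rule linear_on_seq_diff[OF lin x s, symmetric])
    also have "ell2_norm (F (\<lambda>j. x j - s N j)) \<le> c * (q ^ N * C)"
      using bound[OF ell2_off_diff[OF x s[of N]]] mult_right_mono[OF c(3) ell2_norm_nonneg[OF tail(1)[of N]]]
        mult_left_mono[OF tail(2)[of N], of c] c(2) by linarith
    finally show ?thesis
      using v_norm[of N] by (simp add: algebra_simps)
  qed
  have "(\<lambda>N. q ^ N * (c * C + ell2_norm y)) \<longlonglongrightarrow> 0"
    using q by (intro tendsto_mult_left_zero LIMSEQ_realpow_zero) auto
  then have "ell2_norm (\<lambda>j. F x j - y j) \<le> 0"
    using est by (intro LIMSEQ_le_const) auto
  then have "F x = y"
    using ell2_norm_eq_0[OF Fy] ell2_norm_nonneg[OF Fy] by (simp add: fun_eq_iff)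
  with x show ?thesis
    by blast
qed

lemma bij: "bij_betw F (ell2_off Z) (ell2_off Z)"
  unfolding bij_betw_def using injective surjective maps by (auto simp: image_iff)

lemma inv_mem: "y \<in> ell2_off Z \<Longrightarrow> inv_into (ell2_off Z) F y \<in> ell2_off Z"
  using bij by (metis bij_betw_def inv_into_into)

lemma F_inv: "y \<in> ell2_off Z \<Longrightarrow> F (inv_into (ell2_off Z) F y) = y"
  using bij by (metis bij_betw_inv_into_right)

lemma inv_F: "x \<in> ell2_off Z \<Longrightarrow> inv_into (ell2_off Z) F (F x) = x"
  using bij by (metis bij_betw_inv_into_left)

lemma inv_bound:
  assumes "y \<in> ell2_off Z"
  shows "ell2_norm (inv_into (ell2_off Z) F y) \<le> 1 / a * ell2_norm y"
  using lower_bound[OF inv_mem[OF assms]] a_pos by (simp add: F_inv assms field_simps)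

lemma inv_linear: "linear_on_seq (ell2_off Z) (inv_into (ell2_off Z) F)"
  unfolding linear_on_seq_def
proof safe
  fix x y assume xy: "x \<in> ell2_off Z" "y \<in> ell2_off Z"
  show "inv_into (ell2_off Z) F (\<lambda>k. x k + y k) = (\<lambda>k. inv_into (ell2_off Z) F x k + inv_into (ell2_off Z) F y k)"
    by (rule inj_onD[OF injective])
       (simp_all add: F_inv inv_mem xy ell2_off_add linear_on_seq_add[OF lin])
next
  fix c x assume x: "x \<in> ell2_off Z"
  show "inv_into (ell2_off Z) F (\<lambda>k. c * x k) = (\<lambda>k. c * inv_into (ell2_off Z) F x k)"
    by (rule inj_onD[OF injective])
       (simp_all add: F_inv inv_mem x ell2_off_scale linear_on_seq_scale[OF lin])
qed

lemma invertible: "ell2_invertible (ell2_off Z) F"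
  unfolding ell2_invertible_def ell2_bounded_def
  using bij bound inv_bound maps inv_mem by (blast intro: ell2_off_ell2)

end

section \<open>Operator norms on coordinate subspaces\<close>

lemma op_norm_bdd:
  assumes "\<And>x. x \<in> S \<Longrightarrow> ell2_norm (F x) \<le> C * ell2_norm x" "C \<ge> 0"
  shows "bdd_above ((\<lambda>x. ell2_norm (F x)) ` {x \<in> S. ell2_norm x \<le> 1})"
proof (rule bdd_aboveI2)
  fix x assume "x \<in> {x \<in> S. ell2_norm x \<le> 1}"
  then show "ell2_norm (F x) \<le> C"
    using assms(1)[of x] mult_left_mono[of "ell2_norm x" 1 C] assms(2) by simp
qed

lemma op_norm_le:
  assumes "\<And>x. x \<in> ell2_off Z \<Longrightarrow> ell2_norm (F x) \<le> C * ell2_norm x" "C \<ge> 0"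
  shows "op_norm (ell2_off Z) F \<le> C"
  unfolding op_norm_def
proof (rule cSUP_least)
  show "{x \<in> ell2_off Z. ell2_norm x \<le> 1} \<noteq> {}"
    by (auto intro!: exI[of _ "\<lambda>k. 0"])
  fix x assume "x \<in> {x \<in> ell2_off Z. ell2_norm x \<le> 1}"
  then show "ell2_norm (F x) \<le> C"
    using assms(1)[of x] mult_left_mono[of "ell2_norm x" 1 C] assms(2) by simp
qed

lemma op_norm_upper_unit:
  assumes "\<And>x. x \<in> S \<Longrightarrow> ell2_norm (F x) \<le> C * ell2_norm x" "C \<ge> 0"
    and "x \<in> S" "ell2_norm x \<le> 1"
  shows "ell2_norm (F x) \<le> op_norm S F"
  unfolding op_norm_def using assms by (intro cSUP_upper op_norm_bdd) auto

text \<open>The crude bound \<open>C\<close> guarantees that the supremum is over a bounded set;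
  rescaling to the unit sphere then replaces \<open>C\<close> by the operator norm.\<close>

lemma op_norm_upper:
  assumes lin: "linear_on_seq (ell2_off Z) F" and F: "\<And>x. x \<in> ell2_off Z \<Longrightarrow> F x \<in> ell2"
    and bd: "\<And>x. x \<in> ell2_off Z \<Longrightarrow> ell2_norm (F x) \<le> C * ell2_norm x" "C \<ge> 0"
    and x: "x \<in> ell2_off Z"
  shows "ell2_norm (F x) \<le> op_norm (ell2_off Z) F * ell2_norm x"
proof (cases "ell2_norm x = 0")
  case True
  then show ?thesis
    using bd(1)[OF x] by simp
next
  case False
  define r where "r = ell2_norm x"
  have r: "r > 0"
    using False ell2_norm_nonneg[OF ell2_off_ell2[OF x]] by (simp add: r_def)
  have unit: "ell2_norm (\<lambda>k. complex_of_real (1 / r) * x k) = 1"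
    unfolding ell2_norm_scale[OF ell2_off_ell2[OF x]] using r by (simp add: norm_divide flip: r_def)
  have "ell2_norm (F (\<lambda>k. complex_of_real (1 / r) * x k)) \<le> op_norm (ell2_off Z) F"
    by (intro op_norm_upper_unit[where C=C] bd ell2_off_scale x eq_refl[OF unit])
  also have "F (\<lambda>k. complex_of_real (1 / r) * x k) = (\<lambda>k. complex_of_real (1 / r) * F x k)"
    by (rule linear_on_seq_scale[OF lin x])
  also have "ell2_norm \<dots> = ell2_norm (F x) / r"
    using r by (simp only: ell2_norm_scale[OF F[OF x]]) (simp add: norm_divide)
  finally show ?thesis
    using r by (simp add: field_simps flip: r_def)
qed

lemma op_norm_nonneg:
  assumes "\<And>x. x \<in> ell2_off Z \<Longrightarrow> ell2_norm (F x) \<le> C * ell2_norm x" "C \<ge> 0"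
    and "\<And>x. x \<in> ell2_off Z \<Longrightarrow> F x \<in> ell2"
  shows "op_norm (ell2_off Z) F \<ge> 0"
proof -
  have "ell2_norm (F (\<lambda>k. 0)) \<le> op_norm (ell2_off Z) F"
    using assms(1,2) by (intro op_norm_upper_unit[where C=C]) auto
  then show ?thesis
    using ell2_norm_nonneg[OF assms(3)[OF ell2_off_zero]] by linarith
qed

text \<open>The reverse triangle inequality for operator norms, which turns a pointwise estimate of
  the difference of two inverses into closeness of their norms.\<close>

lemma op_norm_diff_le:
  assumes F: "\<And>x. x \<in> ell2_off Z \<Longrightarrow> ell2_norm (F x) \<le> C * ell2_norm x" "C \<ge> 0"
      "\<And>x. x \<in> ell2_off Z \<Longrightarrow> F x \<in> ell2"
    and G: "\<And>x. x \<in> ell2_off Z \<Longrightarrow> ell2_norm (G x) \<le> D * ell2_norm x" "D \<ge> 0"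
      "\<And>x. x \<in> ell2_off Z \<Longrightarrow> G x \<in> ell2"
    and e: "\<And>x. x \<in> ell2_off Z \<Longrightarrow> ell2_norm (\<lambda>k. F x k - G x k) \<le> e * ell2_norm x" "e \<ge> 0"
  shows "\<bar>op_norm (ell2_off Z) F - op_norm (ell2_off Z) G\<bar> \<le> e"
proof -
  have ne: "{x \<in> ell2_off Z. ell2_norm x \<le> 1} \<noteq> {}"
    by (auto intro!: exI[of _ "\<lambda>k. 0"])
  have d: "\<bar>ell2_norm (F x) - ell2_norm (G x)\<bar> \<le> e" if "x \<in> ell2_off Z" "ell2_norm x \<le> 1" for x
    using ell2_norm_reverse_triangle[OF F(3)[OF that(1)] G(3)[OF that(1)]] e(1)[OF that(1)]
      mult_left_mono[OF that(2) e(2)] by simp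
  have "op_norm (ell2_off Z) F \<le> op_norm (ell2_off Z) G + e"
    unfolding op_norm_def[of _ F]
  proof (rule cSUP_least[OF ne])
    fix x assume "x \<in> {x \<in> ell2_off Z. ell2_norm x \<le> 1}"
    then show "ell2_norm (F x) \<le> op_norm (ell2_off Z) G + e"
      using d[of x] op_norm_upper_unit[of "ell2_off Z" G D x] G(1,2) by auto
  qed
  moreover have "op_norm (ell2_off Z) G \<le> op_norm (ell2_off Z) F + e"
    unfolding op_norm_def[of _ G]
  proof (rule cSUP_least[OF ne])
    fix x assume "x \<in> {x \<in> ell2_off Z. ell2_norm x \<le> 1}"
    then show "ell2_norm (G x) \<le> op_norm (ell2_off Z) F + e"
      using d[of x] op_norm_upper_unit[of "ell2_off Z" F C x] F(1,2) by auto
  qed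
  ultimately show ?thesis
    by linarith
qed

subsection \<open>Sections of matrices bounded above and below\<close>

lemma Pn_less [simp]: "k < n \<Longrightarrow> Pn n x k = x k"
  and Pn_ge [simp]: "n \<le> k \<Longrightarrow> Pn n x k = 0"
  by (simp_all add: Pn_def)

lemma Pn_sq_le: "(\<Sum>k<K. (cmod (Pn n x k))\<^sup>2) \<le> (\<Sum>k<n. (cmod (x k))\<^sup>2)"
proof -
  have "(\<Sum>k<K. (cmod (Pn n x k))\<^sup>2) = (\<Sum>k\<in>{..<K} \<inter> {..<n}. (cmod (x k))\<^sup>2)"
    by (auto simp: Pn_def sum.inter_restrict intro!: sum.cong)
  also have "\<dots> \<le> (\<Sum>k<n. (cmod (x k))\<^sup>2)"
    by (intro sum_mono2) auto
  finally show ?thesis .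
qed

lemma Pn_in_ell2 [simp]: "Pn n x \<in> ell2"
  using Pn_sq_le[of n x] by (intro ell2_boundI[of _ "sqrt (\<Sum>k<n. (cmod (x k))\<^sup>2)"]) (auto simp: sum_nonneg)

lemma Pn_norm_sq: "(ell2_norm (Pn n x))\<^sup>2 = (\<Sum>k<n. (cmod (x k))\<^sup>2)"
proof -
  have "(\<Sum>k. (cmod (Pn n x k))\<^sup>2) = (\<Sum>k<n. (cmod (Pn n x k))\<^sup>2)"
    by (rule suminf_finite) auto
  then show ?thesis
    by (simp add: ell2_norm_sq)
qed

lemma Pn_norm_le: "x \<in> ell2 \<Longrightarrow> ell2_norm (Pn n x) \<le> ell2_norm x"
  by (rule power2_le_imp_le) (simp_all add: Pn_norm_sq ell2_sum_le ell2_norm_nonneg)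

lemma Pn_space_eq: "Pn n ` ell2 = ell2_off {n..}"
proof
  show "Pn n ` ell2 \<subseteq> ell2_off {n..}"
    by (auto simp: ell2_off_def)
  show "ell2_off {n..} \<subseteq> Pn n ` ell2"
  proof
    fix x assume x: "x \<in> ell2_off {n..}"
    then have "x = Pn n x"
      by (auto simp: Pn_def ell2_off_def)
    then show "x \<in> Pn n ` ell2"
      using x by (auto dest: ell2_off_ell2)
  qed
qed

lemma Pn_in_off [simp]: "Pn n x \<in> ell2_off {n..}"
  by (simp add: ell2_off_def)

lemma Pn_fix: "x \<in> ell2_off {n..} \<Longrightarrow> Pn n x = x"
  by (auto simp: Pn_def ell2_off_def)

lemma Pn_add: "Pn n (\<lambda>k. x k + y k) = (\<lambda>k. Pn n x k + Pn n y k)"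
  and Pn_diff: "Pn n (\<lambda>k. x k - y k) = (\<lambda>k. Pn n x k - Pn n y k)"
  and Pn_scale: "Pn n (\<lambda>k. c * x k) = (\<lambda>k. c * Pn n x k)"
  by (auto simp: Pn_def)

lemma Pn_perp_ell2: "x \<in> ell2 \<Longrightarrow> Pn_perp n x \<in> ell2"
  unfolding Pn_perp_def by (intro ell2_diff) auto

lemma Pn_perp_alt: "Pn_perp n x k = (if k < n then 0 else x k)"
  by (simp add: Pn_perp_def Pn_def)

lemma Pn_perp_Pn_perp: "Pn_perp n (Pn_perp n x) = Pn_perp n x"
  by (auto simp: Pn_perp_alt)

lemma Pn_perp_add: "Pn_perp n (\<lambda>k. x k + y k) = (\<lambda>k. Pn_perp n x k + Pn_perp n y k)"
  and Pn_perp_scale: "Pn_perp n (\<lambda>k. c * x k) = (\<lambda>k. c * Pn_perp n x k)"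
  by (auto simp: Pn_perp_alt)

lemma inner_sums_restrict:
  "(\<lambda>k. if k < n then x k \<bullet> y k else 0) sums (\<Sum>k<n. x k \<bullet> y k)"
  using sums_If_finite_set[of "{..<n}" "\<lambda>k. x k \<bullet> y k"] by simp

lemma Pn_inner:
  assumes "y \<in> ell2"
  shows "ell2_inner (Pn n x) y = (\<Sum>k<n. x k \<bullet> y k)"
proof -
  have "(\<lambda>k. Pn n x k \<bullet> y k) = (\<lambda>k. if k < n then x k \<bullet> y k else 0)"
    by (auto simp: Pn_def)
  then show ?thesis
    using ell2_inner_sums[of "Pn n x" y] inner_sums_restrict[of n x y] assms sums_unique2 by force
qed

lemma Pn_self_adjoint:
  assumes "x \<in> ell2" "y \<in> ell2"
  shows "ell2_inner (Pn n x) y = ell2_inner x (Pn n y)"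
  using assms by (simp add: Pn_inner ell2_inner_commute[of x] inner_commute)

lemma Pn_inner_Pn:
  assumes "x \<in> ell2" "y \<in> ell2"
  shows "ell2_inner (Pn n x) y = ell2_inner (Pn n x) (Pn n y)"
  using assms by (simp add: Pn_inner)

lemma Pn_perp_self_adjoint:
  assumes "x \<in> ell2" "y \<in> ell2"
  shows "ell2_inner (Pn_perp n x) y = ell2_inner x (Pn_perp n y)"
  unfolding Pn_perp_def using assms
  by (simp add: ell2_inner_diff_left ell2_inner_commute[of x "\<lambda>k. y k - Pn n y k"] Pn_self_adjoint
      ell2_inner_commute[of y x] ell2_inner_commute[of "Pn n y" x])

lemma Pn_perp_norm_sq:
  assumes "x \<in> ell2"
  shows "(ell2_norm (Pn_perp n x))\<^sup>2 = (ell2_norm x)\<^sup>2 - (ell2_norm (Pn n x))\<^sup>2"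
  using Pn_inner_Pn[OF assms assms, of n] assms
    ell2_norm_diff_sq[OF assms, of "Pn n x" 1] unfolding Pn_perp_def
  by (simp add: ell2_norm_inner)

lemma Pn_perp_norm_le: "x \<in> ell2 \<Longrightarrow> ell2_norm (Pn_perp n x) \<le> ell2_norm x"
  by (rule power2_le_imp_le) (simp_all add: Pn_perp_norm_sq ell2_norm_nonneg)

lemma Pn_perp_norm_tendsto_0:
  assumes "x \<in> ell2"
  shows "(\<lambda>n. ell2_norm (Pn_perp n x)) \<longlonglongrightarrow> 0"
proof -
  have "(\<lambda>n. (ell2_norm x)\<^sup>2 - (\<Sum>k<n. (cmod (x k))\<^sup>2)) \<longlonglongrightarrow> (ell2_norm x)\<^sup>2 - (\<Sum>k. (cmod (x k))\<^sup>2)"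
    by (intro tendsto_intros summable_LIMSEQ ell2_summable assms)
  then have "(\<lambda>n. (ell2_norm (Pn_perp n x))\<^sup>2) \<longlonglongrightarrow> 0"
    using assms by (simp add: Pn_perp_norm_sq Pn_norm_sq ell2_norm_sq)
  from tendsto_real_sqrt[OF this] show ?thesis
    by (simp add: ell2_norm_nonneg Pn_perp_ell2 assms)
qed

text \<open>\<open>a\<close> bounds the square of the norm and \<open>r\<close> the norm itself: the
  first becomes the coercivity constant of \<open>U* U\<close>, the second is an operator bound for
  both \<open>U\<close> and its adjoint. Convergence of the rows is what makes the series action
  additive.\<close>

locale frame_matrix =
  fixes U :: "nat \<Rightarrow> nat \<Rightarrow> complex" and a r :: real
  assumes row: "x \<in> ell2 \<Longrightarrow> summable (\<lambda>j. U i j * x j)"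
    and U_ell2: "x \<in> ell2 \<Longrightarrow> mat_op U x \<in> ell2"
    and U_lower: "x \<in> ell2 \<Longrightarrow> a * (ell2_norm x)\<^sup>2 \<le> (ell2_norm (mat_op U x))\<^sup>2"
    and U_upper: "x \<in> ell2 \<Longrightarrow> ell2_norm (mat_op U x) \<le> r * ell2_norm x"
    and a_pos: "a > 0" and r_nonneg: "r \<ge> 0"
begin

abbreviation adj :: "(nat \<Rightarrow> complex) \<Rightarrow> nat \<Rightarrow> complex" where
  "adj \<equiv> mat_op (mat_adj U)"

abbreviation col :: "nat \<Rightarrow> nat \<Rightarrow> complex" where
  "col j \<equiv> \<lambda>i. U i j"

lemma bounded_matrix: "bounded_matrix U"
  unfolding bounded_matrix_def ell2_bounded_def using row U_ell2 U_upper by blast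

lemma U_add: "x \<in> ell2 \<Longrightarrow> y \<in> ell2 \<Longrightarrow>
    mat_op U (\<lambda>k. x k + y k) = (\<lambda>i. mat_op U x i + mat_op U y i)"
  unfolding mat_op_def by (simp add: distrib_left suminf_add row)

lemma U_scale: "x \<in> ell2 \<Longrightarrow> mat_op U (\<lambda>k. c * x k) = (\<lambda>i. c * mat_op U x i)"
  unfolding mat_op_def using row by (simp add: mult.left_commute suminf_mult)

lemma U_linear: "linear_on_seq ell2 (mat_op U)"
  by (simp add: linear_on_seq_def U_add U_scale)

lemma U_diff: "x \<in> ell2 \<Longrightarrow> y \<in> ell2 \<Longrightarrow>
    mat_op U (\<lambda>k. x k - y k) = (\<lambda>i. mat_op U x i - mat_op U y i)"
  using linear_on_seq_diff[of "{}" "mat_op U"] U_linear by (simp add: ell2_off_empty)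

lemma U_finite:
  assumes "x \<in> ell2_off {n..}"
  shows "mat_op U x = (\<lambda>i. \<Sum>j<n. x j * U i j)"
proof
  fix i
  have "(\<Sum>j. U i j * x j) = (\<Sum>j<n. U i j * x j)"
    using assms by (intro suminf_finite) (auto simp: ell2_off_def)
  then show "mat_op U x i = (\<Sum>j<n. x j * U i j)"
    by (simp add: mat_op_def mult.commute)
qed

text \<open>A column is the image of a standard basis vector. Its square summability makes the
  series that define the adjoint converge.\<close>

lemma col_ell2: "col j \<in> ell2"
proof -
  define e :: "nat \<Rightarrow> complex" where "e k = (if k = j then 1 else 0)" for k
  have e: "e = Pn (Suc j) e"
    by (auto simp: e_def Pn_def)
  then have "e \<in> ell2_off {Suc j..}"
    by (metis Pn_in_off)
  from U_finite[OF this] have "mat_op U e = col j"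
    by (simp add: e_def if_distrib[of "\<lambda>x. x * _"] cong: if_cong)
  moreover have "mat_op U e \<in> ell2"
    using e U_ell2 by (metis Pn_in_ell2)
  ultimately show ?thesis
    by simp
qed

lemma adj_row:
  assumes "y \<in> ell2"
  shows "summable (\<lambda>i. cnj (U i j) * y i)"
proof (rule summable_comparison_test)
  show "summable (\<lambda>i. (cmod (U i j))\<^sup>2 + (cmod (y i))\<^sup>2)"
    by (intro summable_add ell2_summable assms col_ell2[of j, unfolded])
  have "cmod u * cmod v \<le> (cmod u)\<^sup>2 + (cmod v)\<^sup>2" for u v
  proof -
    have "2 * (cmod u * cmod v) \<le> (cmod u)\<^sup>2 + (cmod v)\<^sup>2"
      using sum_squares_bound[of "cmod u" "cmod v"] by simp
    moreover have "0 \<le> cmod u * cmod v"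
      by simp
    ultimately show ?thesis
      by linarith
  qed
  then show "\<exists>N. \<forall>i\<ge>N. cmod (cnj (U i j) * y i) \<le> (cmod (U i j))\<^sup>2 + (cmod (y i))\<^sup>2"
    by (simp add: norm_mult)
qed

lemma adj_eq: "adj y j = (\<Sum>i. cnj (U i j) * y i)"
  by (simp add: mat_op_def mat_adj_def)

text \<open>For finitely supported \<open>x\<close> the interchange of the two summations involves
  only finitely many convergent series. This is enough to bound the adjoint, and the general
  identity then follows by density.\<close>

lemma adj_finite:
  assumes x: "x \<in> ell2_off {n..}" and y: "y \<in> ell2"
  shows "ell2_inner (mat_op U x) y = (\<Sum>j<n. x j \<bullet> adj y j)"
proof -
  have move: "(u * v) \<bullet> w = v \<bullet> (cnj u * w)" for u v w :: complex
    by (simp add: inner_complex_def algebra_simps)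
  have "(\<lambda>i. mat_op U x i \<bullet> y i) sums (\<Sum>j<n. x j \<bullet> adj y j)"
  proof -
    have "(\<lambda>i. \<Sum>j<n. x j \<bullet> (cnj (U i j) * y i)) sums (\<Sum>j<n. x j \<bullet> adj y j)"
      unfolding adj_eq
      by (intro sums_sum bounded_linear.sums[OF bounded_linear_inner_right] summable_sums adj_row y)
    then show ?thesis
      unfolding U_finite[OF x] by (simp add: inner_sum_left move mult.commute[of "x _"])
  qed
  then show ?thesis
    using ell2_inner_sums[OF U_ell2[OF ell2_off_ell2[OF x]] y] sums_unique2 by blast
qed

text \<open>Duality: pair \<open>adj y\<close> with its own truncation \<open>w\<close>. Then
  \<open><w, w> = <U w, y>\<close>, and cancelling one factor \<open>ell2_norm w\<close> bounds all
  partial sums, which yields membership and norm bound together.\<close>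

lemma adj_bounds:
  assumes y: "y \<in> ell2"
  shows "adj y \<in> ell2" and adj_upper: "ell2_norm (adj y) \<le> r * ell2_norm y"
proof -
  have "(\<Sum>k<N. (cmod (adj y k))\<^sup>2) \<le> (r * ell2_norm y)\<^sup>2" for N
  proof -
    define w where "w = Pn N (adj y)"
    have w: "w \<in> ell2" "w \<in> ell2_off {N..}"
      by (simp_all add: w_def)
    have "(ell2_norm w)\<^sup>2 = (\<Sum>k<N. w k \<bullet> adj y k)"
      unfolding w_def Pn_norm_sq by (simp add: power2_norm_eq_inner)
    also have "\<dots> = ell2_inner (mat_op U w) y"
      by (rule adj_finite[OF w(2) y, symmetric])
    also have "\<dots> \<le> ell2_norm (mat_op U w) * ell2_norm y"
      using ell2_Cauchy_Schwarz[OF U_ell2[OF w(1)] y] by linarith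
    also have "\<dots> \<le> r * ell2_norm w * ell2_norm y"
      by (intro mult_right_mono U_upper w ell2_norm_nonneg y)
    finally have "ell2_norm w * ell2_norm w \<le> ell2_norm w * (r * ell2_norm y)"
      by (simp add: power2_eq_square mult_ac)
    then have "ell2_norm w \<le> r * ell2_norm y"
      using ell2_norm_nonneg[OF w(1)] r_nonneg ell2_norm_nonneg[OF y]
      by (cases "ell2_norm w = 0") (auto simp: mult_le_cancel_left)
    then have "(ell2_norm w)\<^sup>2 \<le> (r * ell2_norm y)\<^sup>2"
      using ell2_norm_nonneg[OF w(1)] by (rule power_mono)
    then show ?thesis
      by (simp add: w_def Pn_norm_sq)
  qed
  then show "adj y \<in> ell2" "ell2_norm (adj y) \<le> r * ell2_norm y"
    using ell2_boundI[of "adj y" "r * ell2_norm y"] r_nonneg ell2_norm_nonneg[OF y] by auto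
qed

lemmas adj_ell2 = adj_bounds(1)

text \<open>Both sides are limits along the truncations of \<open>x\<close>: the left one since
  \<open>U\<close> is bounded and the tails of \<open>x\<close> tend to 0, the right one as a series
  of coordinate products.\<close>

lemma adjoint:
  assumes x: "x \<in> ell2" and y: "y \<in> ell2"
  shows "ell2_inner (mat_op U x) y = ell2_inner x (adj y)"
proof (rule LIMSEQ_unique)
  show "(\<lambda>N. ell2_inner (mat_op U (Pn N x)) y) \<longlonglongrightarrow> ell2_inner x (adj y)"
    using ell2_inner_sums[OF x adj_ell2[OF y]] by (simp add: adj_finite[OF Pn_in_off y] sums_def)
  show "(\<lambda>N. ell2_inner (mat_op U (Pn N x)) y) \<longlonglongrightarrow> ell2_inner (mat_op U x) y"
  proof (rule LIM_zero_cancel, rule Lim_null_comparison)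
    show "(\<lambda>N. r * ell2_norm (Pn_perp N x) * ell2_norm y) \<longlonglongrightarrow> 0"
      by (intro tendsto_mult_left_zero tendsto_mult_right_zero Pn_perp_norm_tendsto_0 x)
    have "\<bar>ell2_inner (mat_op U (Pn N x)) y - ell2_inner (mat_op U x) y\<bar>
        \<le> r * ell2_norm (Pn_perp N x) * ell2_norm y" for N
    proof -
      have "ell2_inner (mat_op U (Pn_perp N x)) y =
          ell2_inner (mat_op U x) y - ell2_inner (mat_op U (Pn N x)) y"
        unfolding Pn_perp_def by (simp add: U_diff x ell2_inner_diff_left U_ell2 y)
      moreover have "\<bar>ell2_inner (mat_op U (Pn_perp N x)) y\<bar>
          \<le> ell2_norm (mat_op U (Pn_perp N x)) * ell2_norm y"
        by (intro ell2_Cauchy_Schwarz U_ell2 Pn_perp_ell2 x y)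
      moreover have "\<dots> \<le> r * ell2_norm (Pn_perp N x) * ell2_norm y"
        by (intro mult_right_mono U_upper Pn_perp_ell2 x ell2_norm_nonneg y)
      ultimately show ?thesis
        by linarith
    qed
    then show "\<forall>\<^sub>F N in sequentially.
        norm (ell2_inner (mat_op U (Pn N x)) y - ell2_inner (mat_op U x) y)
        \<le> r * ell2_norm (Pn_perp N x) * ell2_norm y"
      by simp
  qed
qed

lemma adj_add: "x \<in> ell2 \<Longrightarrow> y \<in> ell2 \<Longrightarrow> adj (\<lambda>k. x k + y k) = (\<lambda>i. adj x i + adj y i)"
  by (simp add: fun_eq_iff adj_eq distrib_left suminf_add adj_row)

lemma adj_scale: "x \<in> ell2 \<Longrightarrow> adj (\<lambda>k. c * x k) = (\<lambda>i. c * adj x i)"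
  using adj_row by (simp add: fun_eq_iff adj_eq mult.left_commute suminf_mult)

lemma adj_diff: "x \<in> ell2 \<Longrightarrow> y \<in> ell2 \<Longrightarrow> adj (\<lambda>k. x k - y k) = (\<lambda>i. adj x i - adj y i)"
  using linear_on_seq_diff[of "{}" adj] by (simp add: ell2_off_empty linear_on_seq_def adj_add adj_scale)

section \<open>The Gram operator and the norm of its inverse\<close>

lemma gram_op_eq: "gram_op U x = adj (mat_op U x)"
  by (simp add: gram_op_def)

lemma gram_inner:
  assumes "x \<in> ell2" "y \<in> ell2"
  shows "ell2_inner (gram_op U x) y = ell2_inner (mat_op U x) (mat_op U y)"
  using adjoint[OF assms(2) U_ell2[OF assms(1)]] by (simp add: gram_op_eq ell2_inner_commute)

lemma gram_ell2: "x \<in> ell2 \<Longrightarrow> gram_op U x \<in> ell2"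
  by (simp add: gram_op_eq adj_ell2 U_ell2)

lemma gram_upper: "x \<in> ell2 \<Longrightarrow> ell2_norm (gram_op U x) \<le> r * r * ell2_norm x"
  using adj_upper[of "mat_op U x"] mult_left_mono[OF U_upper[of x] r_nonneg]
  by (simp add: gram_op_eq U_ell2)

lemma gram_linear: "linear_on_seq ell2 (gram_op U)"
  by (simp add: linear_on_seq_def gram_op_eq U_add U_scale adj_add adj_scale U_ell2)

sublocale gram: coercive_op "{}" "gram_op U" a "r * r"
  by unfold_locales
     (simp_all add: ell2_off_empty gram_linear gram_ell2 gram_upper a_pos gram_inner U_lower
       flip: ell2_norm_inner[OF U_ell2])

lemma gram_invertible: "ell2_invertible ell2 (gram_op U)"
  using gram.invertible by (simp add: ell2_off_empty)

abbreviation gram_inv_norm :: real where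
  "gram_inv_norm \<equiv> op_norm ell2 (inv_into ell2 (gram_op U))"

lemma gram_inv_norm_le: "gram_inv_norm \<le> 1 / a"
  using op_norm_le[of "{}" "inv_into ell2 (gram_op U)" "1 / a"] gram.inv_bound a_pos
  by (simp add: ell2_off_empty)

lemma gram_inv_upper:
  assumes "x \<in> ell2"
  shows "ell2_norm (inv_into ell2 (gram_op U) x) \<le> gram_inv_norm * ell2_norm x"
  using op_norm_upper[OF gram.inv_linear _ gram.inv_bound, of x] a_pos gram.inv_mem assms
  by (simp add: ell2_off_empty)

text \<open>The optimal lower bound of \<open>U\<^sup>* U\<close> is the reciprocal of the norm of its inverse: apply the
  Cauchy-Schwarz inequality to \<open>\<langle>x, x\<rangle> = \<langle>U w, U x\<rangle>\<close> with \<open>w = (U\<^sup>* U)\<^sup>-\<^sup>1 x\<close>.\<close>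

lemma U_lower_gram_inv_norm:
  assumes x: "x \<in> ell2"
  shows "(ell2_norm x)\<^sup>2 \<le> gram_inv_norm * (ell2_norm (mat_op U x))\<^sup>2"
proof (cases "ell2_norm x = 0")
  case True
  then have "x = (\<lambda>k. 0)"
    using ell2_norm_eq_0[OF x] by simp
  moreover have "mat_op U (\<lambda>k. 0) = (\<lambda>k. 0)"
    by (simp add: mat_op_def)
  ultimately show ?thesis
    by simp
next
  case False
  define w where "w = inv_into ell2 (gram_op U) x"
  have w: "w \<in> ell2" "gram_op U w = x"
    using gram.inv_mem[of x] gram.F_inv[of x] x by (simp_all add: ell2_off_empty w_def)
  note Ux = U_ell2[OF x] and Uw = U_ell2[OF w(1)]
  have "(ell2_norm x)\<^sup>2 = ell2_inner (mat_op U w) (mat_op U x)"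
    using gram_inner[OF w(1) x] by (simp add: w(2) ell2_norm_inner[OF x])
  also have "\<dots> \<le> ell2_norm (mat_op U w) * ell2_norm (mat_op U x)"
    using ell2_Cauchy_Schwarz[OF Uw Ux] by linarith
  finally have "((ell2_norm x)\<^sup>2)\<^sup>2 \<le> (ell2_norm (mat_op U w))\<^sup>2 * (ell2_norm (mat_op U x))\<^sup>2"
    by (metis power_mono power_mult_distrib zero_le_power2)
  also have "(ell2_norm (mat_op U w))\<^sup>2 \<le> gram_inv_norm * (ell2_norm x)\<^sup>2"
  proof -
    have "(ell2_norm (mat_op U w))\<^sup>2 = ell2_inner x w"
      using gram_inner[OF w(1) w(1)] by (simp add: w(2) ell2_norm_inner[OF Uw])
    also have "\<dots> \<le> ell2_norm x * ell2_norm w"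
      using ell2_Cauchy_Schwarz[OF x w(1)] by linarith
    also have "\<dots> \<le> ell2_norm x * (gram_inv_norm * ell2_norm x)"
      using gram_inv_upper[OF x] by (intro mult_left_mono ell2_norm_nonneg x) (simp add: w_def)
    finally show ?thesis
      by (simp add: power2_eq_square mult_ac)
  qed
  then have "(ell2_norm (mat_op U w))\<^sup>2 * (ell2_norm (mat_op U x))\<^sup>2
      \<le> gram_inv_norm * (ell2_norm x)\<^sup>2 * (ell2_norm (mat_op U x))\<^sup>2"
    by (rule mult_right_mono) simp
  finally have "(ell2_norm x)\<^sup>2 * (ell2_norm x)\<^sup>2
      \<le> (ell2_norm x)\<^sup>2 * (gram_inv_norm * (ell2_norm (mat_op U x))\<^sup>2)"
    by (simp add: power2_eq_square mult_ac)
  then show ?thesis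
    by (rule mult_left_le_imp_le) (use False in simp)
qed

text \<open>Testing on the first basis vector. Strict positivity allows the reciprocal to serve as a
  coercivity constant.\<close>

lemma gram_inv_norm_pos: "gram_inv_norm > 0"
proof -
  define e :: "nat \<Rightarrow> complex" where "e k = (if k = 0 then 1 else 0)" for k
  have e: "Pn 1 e = e"
    by (auto simp: e_def Pn_def)
  then have ell: "e \<in> ell2"
    by (metis Pn_in_ell2)
  have "(ell2_norm e)\<^sup>2 = 1"
    using Pn_norm_sq[of 1 e] unfolding e by (simp add: e_def)
  then have "1 \<le> gram_inv_norm * (ell2_norm (mat_op U e))\<^sup>2"
    using U_lower_gram_inv_norm[OF ell] by simp
  then show ?thesis
    by (smt (verit) mult_nonneg_nonneg mult_nonpos_nonneg zero_le_power2)
qed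

section \<open>Finite and uneven sections\<close>

lemma gram_section_eq: "gram_section U n x = Pn n (gram_op U (Pn n x))"
  by (simp add: gram_section_def)

lemma uneven_section_eq: "uneven_section U n m x = Pn n (adj (Pn m (mat_op U (Pn n x))))"
  by (simp add: uneven_section_def)

lemma section_inner:
  assumes x: "x \<in> ell2_off {n..}" and z: "z \<in> ell2"
  shows "ell2_inner (Pn n (adj z)) x = ell2_inner z (mat_op U x)"
  using Pn_self_adjoint[OF adj_ell2[OF z] ell2_off_ell2[OF x], of n] adjoint[OF ell2_off_ell2[OF x] z]
  by (simp add: Pn_fix[OF x] ell2_inner_commute)

lemma section_upper: "z \<in> ell2 \<Longrightarrow> ell2_norm (Pn n (adj z)) \<le> r * ell2_norm z"
  using Pn_norm_le[OF adj_ell2[of z], of n] adj_upper[of z] by linarith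

lemma gram_section_upper:
  "x \<in> ell2_off {n..} \<Longrightarrow> ell2_norm (gram_section U n x) \<le> r * r * ell2_norm x"
  using section_upper[of "mat_op U x" n] mult_left_mono[OF U_upper[of x] r_nonneg]
  by (simp add: gram_section_eq gram_op_eq Pn_fix U_ell2 ell2_off_ell2)

lemma gram_section_linear: "linear_on_seq (ell2_off {n..}) (gram_section U n)"
  by (simp add: linear_on_seq_def gram_section_eq gram_op_eq Pn_add Pn_scale U_add U_scale adj_add
      adj_scale U_ell2)

text \<open>\<open><S x, x>\<close> is the squared norm of \<open>U x\<close>. With the reciprocal
  of \<open>gram_inv_norm\<close> instead of \<open>a\<close> as the constant, the inverse of every
  section is bounded by the norm of the inverse of the full operator.\<close>

lemma gram_section_coercive:
  "coercive_op {n..} (gram_section U n) (1 / gram_inv_norm) (r * r)"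
proof unfold_locales
  fix x assume x: "x \<in> ell2_off {n..}"
  have "ell2_inner (gram_section U n x) x = (ell2_norm (mat_op U x))\<^sup>2"
    using section_inner[OF x U_ell2[OF ell2_off_ell2[OF x]]]
    by (simp add: gram_section_eq gram_op_eq Pn_fix[OF x] ell2_norm_inner U_ell2 ell2_off_ell2[OF x])
  then show "1 / gram_inv_norm * (ell2_norm x)\<^sup>2 \<le> ell2_inner (gram_section U n x) x"
    using U_lower_gram_inv_norm[OF ell2_off_ell2[OF x]] gram_inv_norm_pos by (simp add: field_simps)
qed (simp_all add: gram_section_linear gram_section_upper gram_inv_norm_pos, simp add: gram_section_eq)

lemma gram_section_invertible: "ell2_invertible (Pn_space n) (gram_section U n)"
  unfolding Pn_space_eq by (rule coercive_op.invertible[OF gram_section_coercive])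

lemma gram_section_inv_norm_le:
  "op_norm (Pn_space n) (inv_into (Pn_space n) (gram_section U n)) \<le> gram_inv_norm"
  unfolding Pn_space_eq using coercive_op.inv_bound[OF gram_section_coercive] gram_inv_norm_pos
  by (intro op_norm_le) auto

text \<open>An upper bound for the norm of \<open>P_m^perp U P_n\<close>, read off column by column.
  For fixed \<open>n\<close> there are finitely many columns, all square-summable, hence it tends to
  0.\<close>

definition tail :: "nat \<Rightarrow> nat \<Rightarrow> real" where
  "tail n m = (\<Sum>j<n. ell2_norm (Pn_perp m (col j)))"

lemma tail_nonneg: "tail n m \<ge> 0"
  unfolding tail_def by (intro sum_nonneg ell2_norm_nonneg Pn_perp_ell2 col_ell2)

lemma tail_tendsto_0: "tail n \<longlonglongrightarrow> 0"
  unfolding tail_def by (intro tendsto_null_sum Pn_perp_norm_tendsto_0 col_ell2)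

lemma Pn_perp_U_le:
  assumes x: "x \<in> ell2_off {n..}"
  shows "ell2_norm (Pn_perp m (mat_op U x)) \<le> tail n m * ell2_norm x"
proof -
  have "Pn_perp m (mat_op U x) = (\<lambda>i. \<Sum>j<n. x j * Pn_perp m (col j) i)"
    by (auto simp: U_finite[OF x] Pn_perp_alt)
  then have "ell2_norm (Pn_perp m (mat_op U x)) \<le> (\<Sum>j<n. ell2_norm (\<lambda>i. x j * Pn_perp m (col j) i))"
    using ell2_norm_sum_le[of "{..<n}" "\<lambda>j i. x j * Pn_perp m (col j) i"]
    by (simp add: ell2_scale Pn_perp_ell2 col_ell2)
  also have "\<dots> = (\<Sum>j<n. cmod (x j) * ell2_norm (Pn_perp m (col j)))"
    by (simp add: ell2_norm_scale Pn_perp_ell2 col_ell2)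
  also have "\<dots> \<le> (\<Sum>j<n. ell2_norm x * ell2_norm (Pn_perp m (col j)))"
    by (intro sum_mono mult_right_mono ell2_coord_le ell2_off_ell2[OF x] ell2_norm_nonneg
        Pn_perp_ell2 col_ell2)
  also have "\<dots> = tail n m * ell2_norm x"
    unfolding tail_def sum_distrib_right by (intro sum.cong) (simp_all add: mult.commute)
  finally show ?thesis .
qed

lemma uneven_upper:
  "x \<in> ell2_off {n..} \<Longrightarrow> ell2_norm (uneven_section U n m x) \<le> r * r * ell2_norm x"
  using section_upper[of "Pn m (mat_op U x)" n] mult_left_mono[OF U_upper[of x] r_nonneg]
    mult_left_mono[OF Pn_norm_le[of "mat_op U x" m] r_nonneg]
  by (simp add: uneven_section_eq Pn_fix U_ell2 ell2_off_ell2)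

lemma uneven_linear: "linear_on_seq (ell2_off {n..}) (uneven_section U n m)"
  by (simp add: linear_on_seq_def uneven_section_eq Pn_add Pn_scale U_add U_scale adj_add
      adj_scale)

text \<open>\<open><S_m x, x>\<close> is \<open>|P_m U x|^2\<close>, which is \<open>|U x|^2\<close>
  less the squared norm of the part cut off. The smallness condition lets that part consume at most
  half of the lower bound \<open>a\<close>.\<close>

lemma uneven_coercive:
  assumes "(tail n m)\<^sup>2 \<le> a / 2"
  shows "coercive_op {n..} (uneven_section U n m) (a / 2) (r * r)"
proof unfold_locales
  fix x assume x: "x \<in> ell2_off {n..}"
  note xe = ell2_off_ell2[OF x]
  note Ux = U_ell2[OF xe]
  have "ell2_inner (uneven_section U n m x) x = ell2_inner (Pn m (mat_op U x)) (mat_op U x)"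
    using section_inner[OF x, of "Pn m (mat_op U x)"] by (simp add: uneven_section_eq Pn_fix[OF x])
  also have "\<dots> = (ell2_norm (Pn m (mat_op U x)))\<^sup>2"
    using Pn_inner_Pn[OF Ux Ux, of m] by (simp add: ell2_norm_inner)
  also have "\<dots> = (ell2_norm (mat_op U x))\<^sup>2 - (ell2_norm (Pn_perp m (mat_op U x)))\<^sup>2"
    by (simp add: Pn_perp_norm_sq Ux)
  also have "(ell2_norm (Pn_perp m (mat_op U x)))\<^sup>2 \<le> (tail n m * ell2_norm x)\<^sup>2"
    by (intro power_mono Pn_perp_U_le x ell2_norm_nonneg Pn_perp_ell2 Ux)
  then have "(ell2_norm (mat_op U x))\<^sup>2 - (ell2_norm (Pn_perp m (mat_op U x)))\<^sup>2
      \<ge> a * (ell2_norm x)\<^sup>2 - a / 2 * (ell2_norm x)\<^sup>2"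
    using U_lower[OF xe] mult_right_mono[OF assms zero_le_power2[of "ell2_norm x"]]
    by (simp add: power_mult_distrib)
  finally show "a / 2 * (ell2_norm x)\<^sup>2 \<le> ell2_inner (uneven_section U n m x) x"
    by simp
qed (use a_pos in \<open>simp_all add: uneven_linear uneven_upper\<close>, simp add: uneven_section_eq)

lemma eventually_uneven_coercive:
  "\<forall>\<^sub>F m in sequentially. coercive_op {n..} (uneven_section U n m) (a / 2) (r * r)"
proof -
  have "(\<lambda>m. (tail n m)\<^sup>2) \<longlonglongrightarrow> 0\<^sup>2"
    by (intro tendsto_intros tail_tendsto_0)
  then have "\<forall>\<^sub>F m in sequentially. (tail n m)\<^sup>2 < a / 2"
    using a_pos by (intro order_tendstoD(2)[where y="0\<^sup>2"]) auto
  then show ?thesis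
    by eventually_elim (simp add: uneven_coercive)
qed

lemma uneven_diff:
  assumes x: "x \<in> ell2_off {n..}"
  shows "(\<lambda>k. gram_section U n x k - uneven_section U n m x k) = Pn n (adj (Pn_perp m (mat_op U x)))"
  unfolding gram_section_eq uneven_section_eq gram_op_eq Pn_fix[OF x] Pn_perp_def
    adj_diff[OF U_ell2[OF ell2_off_ell2[OF x]] Pn_in_ell2] Pn_diff ..

text \<open>Resolvent identity \<open>S\<^sub>m\<^sup>-\<^sup>1 - S\<^sup>-\<^sup>1 = S\<^sub>m\<^sup>-\<^sup>1 (S - S\<^sub>m) S\<^sup>-\<^sup>1\<close>.\<close>

lemma uneven_inv_norm_tendsto:
  "(\<lambda>m. op_norm (Pn_space n) (inv_into (Pn_space n) (uneven_section U n m)))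
    \<longlonglongrightarrow> op_norm (Pn_space n) (inv_into (Pn_space n) (gram_section U n))"
proof -
  let ?S = "ell2_off {n..}"
  \<comment> \<open>The factors bound \<open>S_m^-1\<close> by \<open>2 / a\<close>,
    \<open>S - S_m\<close> by \<open>r * tail n m\<close>, and \<open>S^-1\<close> by
    \<open>gram_inv_norm\<close>.\<close>
  define e where "e m = 2 / a * (r * tail n m * gram_inv_norm)" for m
  interpret g: coercive_op "{n..}" "gram_section U n" "1 / gram_inv_norm" "r * r"
    by (rule gram_section_coercive)
  have est: "\<bar>op_norm ?S (inv_into ?S (uneven_section U n m)) - op_norm ?S (inv_into ?S (gram_section U n))\<bar> \<le> e m"
    if co: "coercive_op {n..} (uneven_section U n m) (a / 2) (r * r)" for m
  proof -
    interpret u: coercive_op "{n..}" "uneven_section U n m" "a / 2" "r * r"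
      by (rule co)
    show ?thesis
    proof (rule op_norm_diff_le[OF u.inv_bound _ ell2_off_ell2[OF u.inv_mem] g.inv_bound _ ell2_off_ell2[OF g.inv_mem]])
      show "1 / (a / 2) \<ge> 0" "1 / (1 / gram_inv_norm) \<ge> 0"
        using a_pos gram_inv_norm_pos by simp_all
      show "e m \<ge> 0"
        unfolding e_def
        by (intro mult_nonneg_nonneg divide_nonneg_nonneg r_nonneg tail_nonneg
            less_imp_le[OF gram_inv_norm_pos] less_imp_le[OF a_pos]) simp
    next
      fix x assume x: "x \<in> ?S"
      define w where "w = inv_into ?S (gram_section U n) x"
      have w: "w \<in> ?S" "gram_section U n w = x"
        by (simp_all add: w_def g.inv_mem g.F_inv x)
      define d where "d = Pn n (adj (Pn_perp m (mat_op U w)))"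
      have d: "d = (\<lambda>k. x k - uneven_section U n m w k)"
        using uneven_diff[OF w(1), of m] by (simp add: d_def w(2))
      have dS: "d \<in> ?S"
        by (simp add: d_def)
      \<comment> \<open>As \<open>d\<close> is \<open>x - S_m w\<close> and \<open>S_m^-1\<close> is
        linear, \<open>S_m^-1 d\<close> equals \<open>S_m^-1 x - w\<close> with
        \<open>w = S^-1 x\<close>.\<close>
      have eq: "(\<lambda>k. inv_into ?S (uneven_section U n m) x k - inv_into ?S (gram_section U n) x k)
          = inv_into ?S (uneven_section U n m) d"
        using linear_on_seq_diff[OF u.inv_linear x u.maps[OF w(1)]]
        by (simp add: d u.inv_F[OF w(1)] flip: w_def)
      have "ell2_norm (inv_into ?S (uneven_section U n m) d) \<le> 1 / (a / 2) * ell2_norm d"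
        by (rule u.inv_bound[OF dS])
      also have "\<dots> \<le> 1 / (a / 2) * (r * (tail n m * (gram_inv_norm * ell2_norm x)))"
      proof (rule mult_left_mono)
        have "ell2_norm d \<le> r * ell2_norm (Pn_perp m (mat_op U w))"
          unfolding d_def by (intro section_upper Pn_perp_ell2 U_ell2 ell2_off_ell2[OF w(1)])
        also have "\<dots> \<le> r * (tail n m * (gram_inv_norm * ell2_norm x))"
        proof (rule mult_left_mono[OF _ r_nonneg])
          have "ell2_norm (Pn_perp m (mat_op U w)) \<le> tail n m * ell2_norm w"
            by (rule Pn_perp_U_le[OF w(1)])
          also have "\<dots> \<le> tail n m * (gram_inv_norm * ell2_norm x)"
            using g.inv_bound[OF x] by (intro mult_left_mono tail_nonneg) (simp add: w_def)
          finally show "ell2_norm (Pn_perp m (mat_op U w)) \<le> tail n m * (gram_inv_norm * ell2_norm x)" .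
        qed
        finally show "ell2_norm d \<le> r * (tail n m * (gram_inv_norm * ell2_norm x))" .
      qed (use a_pos in simp)
      finally show "ell2_norm (\<lambda>k. inv_into ?S (uneven_section U n m) x k - inv_into ?S (gram_section U n) x k)
          \<le> e m * ell2_norm x"
        unfolding eq e_def by (simp add: mult.assoc)
    qed
  qed
  have lim: "e \<longlonglongrightarrow> 0"
    unfolding e_def using tail_tendsto_0[of n] a_pos by (auto intro!: tendsto_eq_intros)
  have "\<forall>\<^sub>F m in sequentially. norm (op_norm ?S (inv_into ?S (uneven_section U n m))
      - op_norm ?S (inv_into ?S (gram_section U n))) \<le> e m"
    using eventually_uneven_coercive[of n] by (rule eventually_mono) (simp add: est)
  from Lim_null_comparison[OF this lim] show ?thesis
    unfolding Pn_space_eq by (rule LIM_zero_cancel)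
qed

section \<open>The operator behind the constant K, and the error of the solution\<close>

definition coupling :: "nat \<Rightarrow> nat \<Rightarrow> (nat \<Rightarrow> complex) \<Rightarrow> (nat \<Rightarrow> complex)" where
  "coupling n m x = inv_into (Pn_space n) (uneven_section U n m)
     (Pn n (adj (Pn m (mat_op U (Pn_perp n x)))))"

lemma K_const_eq: "K_const U n m = op_norm ell2 (coupling n m)"
  by (simp add: K_const_def coupling_def[abs_def] comp_def)

context
  fixes n m assumes co: "coercive_op {n..} (uneven_section U n m) (a / 2) (r * r)"
begin

interpretation u: coercive_op "{n..}" "uneven_section U n m" "a / 2" "r * r"
  by (rule co)

lemma coupling_eq: "coupling n m x = inv_into (ell2_off {n..}) (uneven_section U n m)
     (Pn n (adj (Pn m (mat_op U (Pn_perp n x)))))"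
  by (simp add: coupling_def Pn_space_eq)

lemma coupling_ell2: "coupling n m x \<in> ell2"
  unfolding coupling_eq by (rule ell2_off_ell2[OF u.inv_mem]) simp

lemma coupling_linear: "linear_on_seq ell2 (coupling n m)"
  by (simp add: linear_on_seq_def coupling_eq Pn_add Pn_scale U_add U_scale adj_add adj_scale
      Pn_perp_add Pn_perp_scale Pn_perp_ell2 linear_on_seq_add[OF u.inv_linear] linear_on_seq_scale[OF u.inv_linear])

lemma coupling_bound:
  assumes "x \<in> ell2"
  shows "ell2_norm (coupling n m x) \<le> 2 / a * (r * r) * ell2_norm x"
proof -
  note Ux = U_ell2[OF Pn_perp_ell2[OF assms, of n]]
  have "ell2_norm (coupling n m x) \<le> 1 / (a / 2) * ell2_norm (Pn n (adj (Pn m (mat_op U (Pn_perp n x)))))"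
    unfolding coupling_eq by (rule u.inv_bound) simp
  also have "\<dots> \<le> 1 / (a / 2) * (r * (r * ell2_norm x))"
  proof (rule mult_left_mono)
    have "ell2_norm (Pn n (adj (Pn m (mat_op U (Pn_perp n x))))) \<le> r * ell2_norm (Pn m (mat_op U (Pn_perp n x)))"
      by (rule section_upper) simp
    also have "\<dots> \<le> r * (r * ell2_norm x)"
      using Pn_norm_le[OF Ux, of m] U_upper[OF Pn_perp_ell2[OF assms, of n]]
        mult_left_mono[OF Pn_perp_norm_le[OF assms, of n] r_nonneg]
      by (intro mult_left_mono r_nonneg) linarith
    finally show "ell2_norm (Pn n (adj (Pn m (mat_op U (Pn_perp n x))))) \<le> r * (r * ell2_norm x)" .
  qed (use a_pos in simp)
  finally show ?thesis
    by (simp add: mult_ac)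
qed

lemma K_const_nonneg: "0 \<le> K_const U n m"
  unfolding K_const_eq
  by (rule op_norm_nonneg[of "{}", unfolded ell2_off_empty, OF coupling_bound _ coupling_ell2])
     (use a_pos r_nonneg in simp_all)

lemma coupling_le_K_const: "x \<in> ell2 \<Longrightarrow> ell2_norm (coupling n m x) \<le> K_const U n m * ell2_norm x"
  unfolding K_const_eq
  by (rule op_norm_upper[of "{}", unfolded ell2_off_empty, OF coupling_linear coupling_ell2 coupling_bound])
     (use a_pos r_nonneg in simp_all)

text \<open>Split \<open>U x\<close> along \<open>P_n\<close>: the first part of the right-hand side
  is the section applied to \<open>Pn n x\<close>, which the inverse undoes. \<open>coupling\<close>
  projects again, harmlessly; feeding it \<open>Pn_perp n x\<close> makes the norm of that vector
  the factor in the error bound.\<close>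

lemma solution_eq:
  assumes x: "x \<in> ell2" and b: "b \<in> Pn_space n"
    and sol: "uneven_section U n m b = Pn n (adj (Pn m (mat_op U x)))"
  shows "b = (\<lambda>k. Pn n x k + coupling n m (Pn_perp n x) k)"
proof -
  have split: "mat_op U x = (\<lambda>i. mat_op U (Pn n x) i + mat_op U (Pn_perp n x) i)"
    using U_add[OF Pn_in_ell2[of n x] Pn_perp_ell2[OF x, of n]] by (simp add: Pn_perp_def)
  have b': "b \<in> ell2_off {n..}"
    using b by (simp add: Pn_space_eq)
  have "b = inv_into (ell2_off {n..}) (uneven_section U n m) (uneven_section U n m b)"
    by (simp add: u.inv_F b')
  also have "uneven_section U n m b =
      (\<lambda>k. uneven_section U n m (Pn n x) k + Pn n (adj (Pn m (mat_op U (Pn_perp n x)))) k)"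
    unfolding sol unfolding uneven_section_eq Pn_fix[OF Pn_in_off]
    by (subst split) (simp only: Pn_add adj_add[OF Pn_in_ell2 Pn_in_ell2])
  also have "inv_into (ell2_off {n..}) (uneven_section U n m) \<dots> =
      (\<lambda>k. Pn n x k + coupling n m (Pn_perp n x) k)"
    using linear_on_seq_add[OF u.inv_linear u.maps[OF Pn_in_off] Pn_in_off]
    unfolding coupling_eq Pn_perp_Pn_perp by (simp only: u.inv_F[OF Pn_in_off])
  finally show ?thesis .
qed

lemma solution_error:
  assumes x: "x \<in> ell2" and b: "b \<in> Pn_space n"
    and sol: "uneven_section U n m b = Pn n (adj (Pn m (mat_op U x)))"
  shows "ell2_norm (\<lambda>k. x k - b k) \<le> (1 + K_const U n m) * ell2_norm (Pn_perp n x)"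
proof -
  have "ell2_norm (\<lambda>k. x k - b k) = ell2_norm (\<lambda>k. Pn_perp n x k - coupling n m (Pn_perp n x) k)"
    unfolding solution_eq[OF assms] by (simp add: Pn_perp_def diff_diff_eq)
  also have "\<dots> \<le> ell2_norm (Pn_perp n x) + ell2_norm (coupling n m (Pn_perp n x))"
    by (intro ell2_norm_triangle_diff Pn_perp_ell2 x coupling_ell2)
  also have "\<dots> \<le> ell2_norm (Pn_perp n x) + K_const U n m * ell2_norm (Pn_perp n x)"
    by (intro add_left_mono coupling_le_K_const Pn_perp_ell2 x)
  finally show ?thesis
    by (simp add: algebra_simps)
qed

lemma uneven_invertible: "ell2_invertible (Pn_space n) (uneven_section U n m)"
  unfolding Pn_space_eq by (rule u.invertible)

lemma solution_exists_unique:
  "\<exists>!b. b \<in> Pn_space n \<and> uneven_section U n m b = Pn n (adj z)"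
  unfolding Pn_space_eq
proof (rule ex1I)
  show "inv_into (ell2_off {n..}) (uneven_section U n m) (Pn n (adj z)) \<in> ell2_off {n..} \<and>
      uneven_section U n m (inv_into (ell2_off {n..}) (uneven_section U n m) (Pn n (adj z))) = Pn n (adj z)"
    by (simp add: u.inv_mem u.F_inv)
  fix b assume b: "b \<in> ell2_off {n..} \<and> uneven_section U n m b = Pn n (adj z)"
  then show "b = inv_into (ell2_off {n..}) (uneven_section U n m) (Pn n (adj z))"
    by (metis u.inv_F)
qed

text \<open>If \<open>U\<^sup>* U\<close> is a multiple of the identity then \<open>P\<^sub>n U\<^sup>* U P\<^sub>n\<^sup>\<bottom> = 0\<close>, so \<open>P\<^sub>m\<close> may be
  replaced by \<open>P\<^sub>m\<^sup>\<bottom>\<close>, which is small next to \<open>U P\<^sub>n\<close>.\<close>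

lemma K_const_le_tail:
  assumes iso: "\<And>x. x \<in> ell2 \<Longrightarrow> (ell2_norm (mat_op U x))\<^sup>2 = a * (ell2_norm x)\<^sup>2"
  shows "K_const U n m \<le> 2 / a * (tail n m * r)"
proof -
  have "ell2_norm (coupling n m x) \<le> 2 / a * (tail n m * r) * ell2_norm x" if x: "x \<in> ell2" for x
  proof -
    define p where "p = Pn_perp n x"
    define w where "w = Pn n (adj (Pn m (mat_op U p)))"
    have p: "p \<in> ell2" and w: "w \<in> ell2" "w \<in> ell2_off {n..}"
      by (simp_all add: p_def Pn_perp_ell2 x w_def)
    note Up = U_ell2[OF p] and Uw = U_ell2[OF w(1)]
    have perp: "ell2_inner p w = 0"
    proof -
      have "ell2_inner p w = ell2_inner x (Pn_perp n w)"
        unfolding p_def by (rule Pn_perp_self_adjoint[OF x w(1)])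
      also have "Pn_perp n w = (\<lambda>k. 0)"
        by (simp add: Pn_perp_def Pn_fix w(2))
      finally show ?thesis
        by (simp add: ell2_inner_def sq_inner_def)
    qed
    \<comment> \<open>Polarisation: \<open>U\<close> multiplies all squared norms by
      \<open>a\<close>, so comparing the two expansions of the squared norm of \<open>p + w\<close>
      transfers orthogonality of \<open>p\<close> and \<open>w\<close> to their images.\<close>
    have orth: "ell2_inner (mat_op U p) (mat_op U w) = 0"
      using ell2_norm_add_sq[OF Up Uw] ell2_norm_add_sq[OF p w(1)] iso[OF ell2_add[OF p w(1)]]
      by (simp add: iso p w perp U_add algebra_simps)
    have "(ell2_norm w)\<^sup>2 = ell2_inner (Pn m (mat_op U p)) (mat_op U w)"
      using section_inner[OF w(2), of "Pn m (mat_op U p)"] by (simp add: ell2_norm_inner w) (simp add: w_def)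
    also have "\<dots> = - ell2_inner (Pn_perp m (mat_op U p)) (mat_op U w)"
      unfolding Pn_perp_def by (simp add: ell2_inner_diff_left Up Uw orth)
    \<comment> \<open>The complementary projection moves to the other factor, since
      \<open>tail\<close> controls it on images of the range of \<open>P_n\<close>, to which
      \<open>w\<close> belongs.\<close>
    also have "\<dots> = - ell2_inner (mat_op U p) (Pn_perp m (mat_op U w))"
      by (simp add: Pn_perp_self_adjoint Up Uw)
    also have "\<dots> \<le> ell2_norm (mat_op U p) * ell2_norm (Pn_perp m (mat_op U w))"
      using ell2_Cauchy_Schwarz[OF Up Pn_perp_ell2[OF Uw, of m]] by linarith
    also have "\<dots> \<le> (r * ell2_norm x) * (tail n m * ell2_norm w)"
    proof (rule mult_mono)
      show "ell2_norm (mat_op U p) \<le> r * ell2_norm x"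
        using U_upper[OF p] mult_left_mono[OF Pn_perp_norm_le[OF x, of n] r_nonneg] by (simp add: p_def)
    qed (use r_nonneg in \<open>simp_all add: Pn_perp_U_le w ell2_norm_nonneg x Pn_perp_ell2 Uw\<close>)
    finally have "ell2_norm w * ell2_norm w \<le> ell2_norm w * (tail n m * r * ell2_norm x)"
      by (simp add: power2_eq_square mult_ac)
    then have "ell2_norm w \<le> tail n m * r * ell2_norm x"
      using ell2_norm_nonneg[OF w(1)] r_nonneg ell2_norm_nonneg[OF x] tail_nonneg[of n m]
      by (cases "ell2_norm w = 0") (auto simp: mult_le_cancel_left)
    then have "1 / (a / 2) * ell2_norm w \<le> 1 / (a / 2) * (tail n m * r * ell2_norm x)"
      using a_pos by (intro mult_left_mono) auto
    moreover have "ell2_norm (coupling n m x) \<le> 1 / (a / 2) * ell2_norm w"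
      unfolding coupling_eq p_def[symmetric] w_def[symmetric] by (rule u.inv_bound[OF w(2)])
    ultimately show ?thesis
      by (simp add: mult_ac)
  qed
  then show ?thesis
    using op_norm_le[of "{}" "coupling n m" "2 / a * (tail n m * r)"] a_pos r_nonneg tail_nonneg
    by (simp add: K_const_eq ell2_off_empty)
qed

end

lemma K_const_tendsto_0:
  assumes iso: "\<And>x. x \<in> ell2 \<Longrightarrow> (ell2_norm (mat_op U x))\<^sup>2 = a * (ell2_norm x)\<^sup>2"
  shows "(\<lambda>m. K_const U n m) \<longlonglongrightarrow> 0"
proof (rule Lim_null_comparison)
  show "(\<lambda>m. 2 / a * (tail n m * r)) \<longlonglongrightarrow> 0"
    by (intro tendsto_mult_right_zero tendsto_mult_left_zero tail_tendsto_0)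
  show "\<forall>\<^sub>F m in sequentially. norm (K_const U n m) \<le> 2 / a * (tail n m * r)"
    using eventually_uneven_coercive[of n]
    by eventually_elim (use K_const_le_tail[OF _ iso] K_const_nonneg in simp)
qed

end

subsection \<open>Trigonometric polynomials on the cube\<close>

definition cube :: "real \<Rightarrow> (real ^ 'd) set" where
  "cube L = cbox (\<chi> i. - L) (\<chi> i. L)"

lemma mem_cube: "x \<in> cube L \<longleftrightarrow> (\<forall>i. \<bar>x $ i\<bar> \<le> L)"
proof -
  have "\<bar>t\<bar> \<le> L \<longleftrightarrow> - L \<le> t \<and> t \<le> L" for t
    by auto
  then show ?thesis
    by (simp add: cube_def mem_box_cart)
qed

definition wave :: "real ^ 'd \<Rightarrow> real ^ 'd \<Rightarrow> complex" where
  "wave y x = cis (2 * pi * (x \<bullet> y))"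

lemma norm_wave [simp]: "cmod (wave y x) = 1"
  by (simp add: wave_def)

lemma wave_zero [simp]: "wave 0 x = 1"
  by (simp add: wave_def)

lemma wave_mult: "wave y x * wave z x = wave (y + z) x"
  by (simp add: wave_def cis_mult inner_add_right algebra_simps)

lemma cnj_wave: "cnj (wave y x) = wave (- y) x"
  by (simp add: wave_def cis_cnj)

lemma continuous_on_wave [continuous_intros]: "continuous_on S (wave y)"
  unfolding wave_def cis_conv_exp by (intro continuous_intros)

lemma fourier_wave: "fourier h y = (LINT x|lebesgue. h x * cnj (wave y x))"
  unfolding fourier_def wave_def cis_cnj unfolding cis_conv_exp by (simp add: mult_ac)

lemma scaled_lattice_zero: "0 \<in> scaled_lattice \<epsilon>"
  by (auto simp: scaled_lattice_def intro: exI[of _ 0])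

lemma scaled_lattice_add:
  assumes "y \<in> scaled_lattice \<epsilon>" "z \<in> scaled_lattice \<epsilon>"
  shows "y + z \<in> scaled_lattice \<epsilon>"
  unfolding scaled_lattice_def
proof safe
  fix i
  obtain k l :: int where "y $ i = \<epsilon> * of_int k" "z $ i = \<epsilon> * of_int l"
    using assms unfolding scaled_lattice_def mem_Collect_eq by metis
  then have "(y + z) $ i = \<epsilon> * of_int (k + l)"
    by (simp add: algebra_simps)
  then show "\<exists>m::int. (y + z) $ i = \<epsilon> * of_int m"
    by blast
qed

lemma scaled_lattice_minus:
  assumes "y \<in> scaled_lattice \<epsilon>"
  shows "- y \<in> scaled_lattice \<epsilon>"
  unfolding scaled_lattice_def
proof safe
  fix i
  obtain k :: int where "y $ i = \<epsilon> * of_int k"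
    using assms unfolding scaled_lattice_def mem_Collect_eq by metis
  then have "(- y) $ i = \<epsilon> * of_int (- k)"
    by simp
  then show "\<exists>m::int. (- y) $ i = \<epsilon> * of_int m"
    by blast
qed

lemma scaled_lattice_axis: "axis i \<epsilon> \<in> scaled_lattice \<epsilon>"
proof -
  have "axis i \<epsilon> $ j = \<epsilon> * of_int (if j = i then 1 else 0)" for j
    by (simp add: axis_def)
  then show ?thesis
    unfolding scaled_lattice_def by blast
qed

text \<open>Generating by waves and sums keeps closure under products a short induction, because the
  frequencies form a group; the explicit finite sum is recovered when coefficients are
  needed.\<close>

inductive trig_poly :: "real \<Rightarrow> (real ^ 'd \<Rightarrow> complex) \<Rightarrow> bool" for \<epsilon> where
  wave: "y \<in> scaled_lattice \<epsilon> \<Longrightarrow> trig_poly \<epsilon> (\<lambda>x. c * wave y x)"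
| add: "trig_poly \<epsilon> p \<Longrightarrow> trig_poly \<epsilon> q \<Longrightarrow> trig_poly \<epsilon> (\<lambda>x. p x + q x)"

lemma trig_poly_const: "trig_poly \<epsilon> (\<lambda>x. c)"
  using trig_poly.wave[OF scaled_lattice_zero, of \<epsilon> c] by simp

lemma trig_poly_wave_mult:
  assumes "trig_poly \<epsilon> p" "y \<in> scaled_lattice \<epsilon>"
  shows "trig_poly \<epsilon> (\<lambda>x. c * wave y x * p x)"
  using assms(1)
proof induction
  case (wave z d)
  have "(\<lambda>x. c * wave y x * (d * wave z x)) = (\<lambda>x. (c * d) * wave (y + z) x)"
    by (simp add: fun_eq_iff wave_mult[symmetric])
  then show ?case
    using trig_poly.wave[OF scaled_lattice_add[OF assms(2) wave], of "c * d"] by simp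
next
  case (add p q)
  then show ?case
    using trig_poly.add by (simp add: distrib_left)
qed

lemma trig_poly_mult:
  assumes "trig_poly \<epsilon> p" "trig_poly \<epsilon> q"
  shows "trig_poly \<epsilon> (\<lambda>x. p x * q x)"
  using assms(1)
proof induction
  case (wave y c)
  then show ?case
    using trig_poly_wave_mult[OF assms(2)] by simp
next
  case (add p r)
  then show ?case
    using trig_poly.add by (simp add: distrib_right)
qed

lemma trig_poly_sum:
  "(\<And>i. i \<in> I \<Longrightarrow> trig_poly \<epsilon> (p i)) \<Longrightarrow> trig_poly \<epsilon> (\<lambda>x. \<Sum>i\<in>I. p i x)"
  by (induction I rule: infinite_finite_induct) (auto intro: trig_poly_const trig_poly.add)

lemma trig_poly_finite_sum:
  assumes "trig_poly \<epsilon> p"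
  obtains F c where "finite F" "F \<subseteq> scaled_lattice \<epsilon>" "p = (\<lambda>x. \<Sum>y\<in>F. c y * wave y x)"
  using assms
proof (induction arbitrary: thesis)
  case (wave y c)
  then show ?case
    by (intro wave(2)[of "{y}" "\<lambda>_. c"]) auto
next
  case (add p q)
  obtain F c where F: "finite F" "F \<subseteq> scaled_lattice \<epsilon>" "p = (\<lambda>x. \<Sum>y\<in>F. c y * wave y x)"
    using add.IH(1) by blast
  obtain G d where G: "finite G" "G \<subseteq> scaled_lattice \<epsilon>" "q = (\<lambda>x. \<Sum>y\<in>G. d y * wave y x)"
    using add.IH(2) by blast
  \<comment> \<open>Coefficients at shared frequencies are merged, so that the sum runs over a set
    of distinct frequencies, as orthogonality requires.\<close>
  define e where "e y = (if y \<in> F then c y else 0) + (if y \<in> G then d y else 0)" for y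
  have p: "(\<Sum>y\<in>F. c y * wave y x) = (\<Sum>y\<in>F \<union> G. (if y \<in> F then c y else 0) * wave y x)" for x
    using F(1) G(1) by (intro sum.mono_neutral_cong_left) auto
  have q: "(\<Sum>y\<in>G. d y * wave y x) = (\<Sum>y\<in>F \<union> G. (if y \<in> G then d y else 0) * wave y x)" for x
    using F(1) G(1) by (intro sum.mono_neutral_cong_left) auto
  have "(\<lambda>x. p x + q x) = (\<lambda>x. \<Sum>y\<in>F \<union> G. e y * wave y x)"
    by (simp add: fun_eq_iff F(3) G(3) p q e_def sum.distrib[symmetric] distrib_right)
  then show ?case
    using F(1,2) G(1,2) by (intro add.prems[of "F \<union> G" e]) auto
qed

lemma continuous_on_trig_poly: "trig_poly \<epsilon> p \<Longrightarrow> continuous_on S p"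
  by (induction rule: trig_poly.induct) (auto intro!: continuous_intros)

text \<open>The quotient map of the cube onto the torus in \<open>C^d\<close>, identifying opposite
  faces. Its coordinates are lattice waves, hence polynomials in their real and imaginary parts are
  trigonometric polynomials.\<close>

definition torus_map :: "real \<Rightarrow> real ^ 'd \<Rightarrow> complex ^ 'd" where
  "torus_map \<epsilon> x = (\<chi> i. cis (2 * pi * (\<epsilon> * x $ i)))"

lemma continuous_on_torus_map: "continuous_on S (torus_map \<epsilon>)"
  unfolding torus_map_def cis_conv_exp by (intro continuous_intros)

lemma torus_map_wave: "torus_map \<epsilon> x $ i = wave (axis i \<epsilon>) x"
  by (simp add: torus_map_def wave_def inner_axis mult.commute)

text \<open>Real and imaginary parts of a wave combine the wave with its conjugate, which has the
  opposite lattice frequency.\<close>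

lemma trig_poly_torus_basis:
  assumes "b \<in> (Basis :: (complex ^ 'd) set)"
  shows "trig_poly \<epsilon> (\<lambda>x::real ^ 'd. complex_of_real (torus_map \<epsilon> x \<bullet> b))"
proof -
  obtain i u where b: "b = axis i u" "u \<in> Basis"
    using assms by (auto simp: Basis_vec_def)
  have w: "trig_poly \<epsilon> (\<lambda>x. c * wave (axis i \<epsilon>) x + d * wave (- axis i \<epsilon>) x)" for c d
    by (intro trig_poly.intros scaled_lattice_axis scaled_lattice_minus)
  have Re: "complex_of_real (Re z) = 1 / 2 * z + 1 / 2 * cnj z"
    and Im: "complex_of_real (Im z) = - \<i> / 2 * z + \<i> / 2 * cnj z" for z
    by (auto simp: complex_eq_iff)
  show ?thesis
    using b(2) w[of "1 / 2" "1 / 2"] w[of "- \<i> / 2" "\<i> / 2"]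
    unfolding b(1) inner_axis torus_map_wave
    by (auto simp: Basis_complex_def Re Im cnj_wave inner_complex_def)
qed

lemma trig_poly_real_polynomial:
  fixes r :: "complex ^ 'd \<Rightarrow> real"
  assumes "real_polynomial_function r"
  shows "trig_poly \<epsilon> (\<lambda>x::real ^ 'd. complex_of_real (r (torus_map \<epsilon> x)))"
  using assms
proof induction
  case (linear f)
  interpret bounded_linear f by fact
  have "f z = (\<Sum>b\<in>Basis. (z \<bullet> b) * f b)" for z
    using arg_cong[OF euclidean_representation[of z, symmetric], of f] by (simp add: sum scaleR)
  then have eq: "(\<lambda>x::real ^ 'd. complex_of_real (f (torus_map \<epsilon> x))) =
      (\<lambda>x. \<Sum>b\<in>Basis. complex_of_real (f b) * complex_of_real (torus_map \<epsilon> x \<bullet> b))"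
    by (metis (no_types, lifting) mult.commute of_real_mult of_real_sum sum.cong)
  show ?case
    unfolding eq by (rule trig_poly_sum) (rule trig_poly_mult[OF trig_poly_const trig_poly_torus_basis])
qed (auto intro: trig_poly_const trig_poly.add trig_poly_mult)

lemma trig_poly_polynomial:
  fixes p :: "complex ^ 'd \<Rightarrow> complex"
  assumes "polynomial_function p"
  shows "trig_poly \<epsilon> (\<lambda>x::real ^ 'd. p (torus_map \<epsilon> x))"
proof -
  have "real_polynomial_function (Re \<circ> p)" "real_polynomial_function (Im \<circ> p)"
    using assms bounded_linear_Re bounded_linear_Im by (auto simp: polynomial_function_def)
  then have "trig_poly \<epsilon> (\<lambda>x::real ^ 'd. complex_of_real ((Re \<circ> p) (torus_map \<epsilon> x))
      + \<i> * complex_of_real ((Im \<circ> p) (torus_map \<epsilon> x)))"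
    by (rule trig_poly.add[OF trig_poly_real_polynomial trig_poly_mult[OF trig_poly_const trig_poly_real_polynomial]])
  then show ?thesis
    by (simp flip: complex_eq)
qed

text \<open>On the cube each \<open>\<epsilon> x_i\<close> lies in [-1/2, 1/2]. Points with equal
  images differ there by an integer of modulus at most 1, so distinct coordinates are opposite
  endpoints.\<close>

lemma torus_map_eq_cube:
  assumes \<epsilon>: "\<epsilon> > 0" and x: "x \<in> cube (1 / (2 * \<epsilon>))" and y: "y \<in> cube (1 / (2 * \<epsilon>))"
    and eq: "torus_map \<epsilon> x = torus_map \<epsilon> y"
  shows "x = y \<or> (\<exists>i. \<bar>x $ i\<bar> = 1 / (2 * \<epsilon>)) \<and> (\<exists>i. \<bar>y $ i\<bar> = 1 / (2 * \<epsilon>))"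
proof (cases "x = y")
  case False
  then obtain i where i: "x $ i \<noteq> y $ i"
    by (auto simp: vec_eq_iff)
  have "exp (\<i> * complex_of_real (2 * pi * (\<epsilon> * x $ i))) = exp (\<i> * complex_of_real (2 * pi * (\<epsilon> * y $ i)))"
    using eq by (simp add: torus_map_def vec_eq_iff cis_conv_exp)
  then obtain n :: int where "\<i> * complex_of_real (2 * pi * (\<epsilon> * x $ i)) =
      \<i> * complex_of_real (2 * pi * (\<epsilon> * y $ i)) + (of_int (2 * n) * pi) * \<i>"
    unfolding exp_eq by blast
  then have "Im (\<i> * complex_of_real (2 * pi * (\<epsilon> * x $ i))) =
      Im (\<i> * complex_of_real (2 * pi * (\<epsilon> * y $ i)) + (of_int (2 * n) * pi) * \<i>)"
    by (rule arg_cong)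
  then have "(2 * pi) * (\<epsilon> * x $ i) = (2 * pi) * (\<epsilon> * y $ i + of_int n)"
    by (simp add: algebra_simps)
  then have n: "\<epsilon> * x $ i - \<epsilon> * y $ i = of_int n"
    by simp
  have bd: "\<bar>\<epsilon> * x $ i\<bar> \<le> 1 / 2" "\<bar>\<epsilon> * y $ i\<bar> \<le> 1 / 2"
    using x[unfolded mem_cube, rule_format, of i] y[unfolded mem_cube, rule_format, of i] \<epsilon>
    by (simp_all add: abs_mult field_simps)
  have "n \<noteq> 0"
    using n i \<epsilon> by auto
  then have "\<bar>real_of_int n\<bar> \<ge> 1"
    by linarith
  then have "\<bar>\<epsilon> * x $ i\<bar> = 1 / 2" "\<bar>\<epsilon> * y $ i\<bar> = 1 / 2"
    using n bd by linarith+
  then have "\<bar>x $ i\<bar> = 1 / (2 * \<epsilon>)" "\<bar>y $ i\<bar> = 1 / (2 * \<epsilon>)"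
    using \<epsilon> by (simp_all add: abs_mult field_simps)
  then show ?thesis
    by blast
qed simp

text \<open>A continuous function on the cube which vanishes on the boundary descends to the torus, where
  the Stone-Weierstrass theorem applies.\<close>

lemma trig_poly_dense_continuous:
  fixes f :: "real ^ 'd \<Rightarrow> complex"
  assumes \<epsilon>: "\<epsilon> > 0" and f: "continuous_on (cube (1 / (2 * \<epsilon>))) f"
    and bdry: "\<And>x i. x \<in> cube (1 / (2 * \<epsilon>)) \<Longrightarrow> \<bar>x $ i\<bar> = 1 / (2 * \<epsilon>) \<Longrightarrow> f x = 0"
    and e: "e > 0"
  obtains q where "trig_poly \<epsilon> q" "\<And>x. x \<in> cube (1 / (2 * \<epsilon>)) \<Longrightarrow> cmod (f x - q x) < e"
proof -
  define Q :: "(real ^ 'd) set" where "Q = cube (1 / (2 * \<epsilon>))"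
  define F where "F z = f (SOME x. x \<in> Q \<and> torus_map \<epsilon> x = z)" for z
  have Q: "compact Q"
    by (simp add: Q_def cube_def)
  have F: "F (torus_map \<epsilon> x) = f x" if x: "x \<in> Q" for x
  proof -
    define y where "y = (SOME y. y \<in> Q \<and> torus_map \<epsilon> y = torus_map \<epsilon> x)"
    have "y \<in> Q \<and> torus_map \<epsilon> y = torus_map \<epsilon> x"
      unfolding y_def by (rule someI[of _ x]) (simp add: x)
    then have "f y = f x"
      using torus_map_eq_cube[OF \<epsilon>, of y x] bdry[of x] bdry[of y] x by (auto simp: Q_def)
    then show ?thesis
      by (simp add: F_def y_def)
  qed
  \<comment> \<open>A continuous map on a compact set is closed, so preimages of closed sets under
    \<open>F\<close> are, within the torus, images of compact subsets of \<open>Q\<close>.\<close>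
  have "continuous_on (torus_map \<epsilon> ` Q) F"
    unfolding continuous_on_closed_invariant
  proof (intro allI impI)
    fix B :: "complex set" assume B: "closed B"
    have "closed (Q \<inter> f -` B)"
      using continuous_closed_preimage[OF f _ B] Q by (simp add: Q_def compact_imp_closed Int_commute)
    then have "compact (torus_map \<epsilon> ` (Q \<inter> f -` B))"
      using Q by (intro compact_continuous_image continuous_on_torus_map)
        (metis compact_Int_closed inf.left_idem)
    then have "closed (torus_map \<epsilon> ` (Q \<inter> f -` B))"
      by (rule compact_imp_closed)
    moreover have "torus_map \<epsilon> ` (Q \<inter> f -` B) \<inter> torus_map \<epsilon> ` Q = F -` B \<inter> torus_map \<epsilon> ` Q"
      using F by auto
    ultimately show "\<exists>A. closed A \<and> A \<inter> torus_map \<epsilon> ` Q = F -` B \<inter> torus_map \<epsilon> ` Q"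
      by blast
  qed
  then obtain p where p: "polynomial_function p" "\<forall>z\<in>torus_map \<epsilon> ` Q. cmod (F z - p z) < e"
    using Stone_Weierstrass_polynomial_function[OF compact_continuous_image[OF continuous_on_torus_map Q] _ e]
    by blast
  show ?thesis
  proof (rule that[of "\<lambda>x. p (torus_map \<epsilon> x)"])
    show "trig_poly \<epsilon> (\<lambda>x::real ^ 'd. p (torus_map \<epsilon> x))"
      by (rule trig_poly_polynomial[OF p(1)])
    fix x :: "real ^ 'd"
    assume "x \<in> cube (1 / (2 * \<epsilon>))"
    then show "cmod (f x - p (torus_map \<epsilon> x)) < e"
      using p(2) F[of x] by (force simp: Q_def)
  qed
qed

subsection \<open>Orthogonality of the lattice exponentials\<close>

text \<open>Fubini in coordinates: Lebesgue measure is the image of a product measure under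
  assembling a vector from its coordinates.\<close>

lemma integral_lborel_prod:
  fixes g :: "'a::euclidean_space \<Rightarrow> real \<Rightarrow> complex"
  assumes g: "\<And>b. b \<in> Basis \<Longrightarrow> integrable lborel (g b)"
  shows "(LINT x|lborel. (\<Prod>b\<in>Basis. g b (x \<bullet> b))) = (\<Prod>b\<in>Basis. (LINT t|lborel. g b t))"
proof -
  interpret product_sigma_finite "\<lambda>_::'a. lborel :: real measure"
    by standard
  have [measurable]: "g b \<in> borel_measurable borel" if "b \<in> Basis" for b
    using borel_measurable_integrable[OF g[OF that]] by simp
  have "(LINT x|lborel. (\<Prod>b\<in>Basis. g b (x \<bullet> b))) =
      (LINT f|(\<Pi>\<^sub>M b\<in>Basis. lborel). (\<Prod>b\<in>Basis. g b ((\<Sum>i\<in>Basis. f i *\<^sub>R i) \<bullet> b)))"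
    by (subst lborel_eq, subst integral_distr) measurable
  also have "\<dots> = (LINT f|(\<Pi>\<^sub>M b\<in>Basis. lborel). (\<Prod>b\<in>Basis. g b (f b)))"
    by (intro Bochner_Integration.integral_cong refl prod.cong) simp
  also have "\<dots> = (\<Prod>b\<in>Basis. (LINT t|lborel. g b t))"
    by (rule product_integral_prod) (simp_all add: g)
  finally show ?thesis .
qed

text \<open>The interval has length \<open>1 / \<epsilon>\<close>, a whole number of periods of the
  integrand, so for nonzero \<open>n\<close> the antiderivative takes the same value at both
  ends.\<close>

lemma has_integral_cis_period:
  fixes n :: int
  assumes \<epsilon>: "\<epsilon> > 0"
  defines "L \<equiv> 1 / (2 * \<epsilon>)"
  shows "has_bochner_integral lborel (\<lambda>t. indicator {- L..L} t *\<^sub>R cis (2 * pi * (t * (\<epsilon> * of_int n))))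
    (if n = 0 then 1 / complex_of_real \<epsilon> else 0)"
proof (cases "n = 0")
  case True
  have "has_bochner_integral lborel (\<lambda>t. indicator {- L..L} t *\<^sub>R (1::complex)) (complex_of_real L - complex_of_real (- L))"
    using \<epsilon> by (intro has_bochner_integral_FTC_Icc)
      (auto simp: L_def intro!: derivative_eq_intros)
  then show ?thesis
    using \<epsilon> True by (simp add: L_def field_simps)
next
  case False
  define w where "w = 2 * pi * (\<epsilon> * of_int n)"
  have w: "w \<noteq> 0"
    using False \<epsilon> by (simp add: w_def)
  define G where "G t = cis (t * w) / (\<i> * complex_of_real w)" for t
  have G: "(G has_vector_derivative cis (t * w)) (at t within {- L..L})" for t
  proof -
    have "((\<lambda>t. exp (\<i> * complex_of_real w * complex_of_real t) / (\<i> * complex_of_real w)) has_vector_derivative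
        exp (\<i> * complex_of_real w * complex_of_real t)) (at t within {- L..L})"
      using w by (auto intro!: derivative_eq_intros has_vector_derivative_real_field simp: field_simps)
    then show ?thesis
      by (simp add: G_def[abs_def] cis_conv_exp mult_ac)
  qed
  have "has_bochner_integral lborel (\<lambda>t. indicator {- L..L} t *\<^sub>R cis (t * w)) (G L - G (- L))"
  proof (rule has_bochner_integral_FTC_Icc)
    show "- L \<le> L"
      using \<epsilon> by (simp add: L_def)
    show "continuous_on {- L..L} (\<lambda>t. cis (t * w))"
      unfolding cis_conv_exp by (intro continuous_intros)
  qed (rule G)
  moreover have "G L = G (- L)"
  proof -
    have "cis (L * w) = cis (- L * w) * cis (2 * pi * of_int n)"
      using \<epsilon> by (simp add: cis_mult L_def w_def field_simps)
    also have "cis (2 * pi * of_int n) = 1"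
      by (simp add: cis_multiple_2pi)
    finally show ?thesis
      by (simp add: G_def)
  qed
  ultimately show ?thesis
    using False by (simp add: w_def mult_ac)
qed

lemma cube_measurable [measurable, simp]: "cube L \<in> sets borel"
  by (simp add: cube_def)

lemma cube_indicator:
  "indicator (cube L) x = (\<Prod>b\<in>Basis. indicator {- L..L} (x \<bullet> b) :: real)" for x :: "real ^ 'd"
proof (cases "x \<in> cube L")
  case True
  then have "\<bar>x \<bullet> b\<bar> \<le> L" if "b \<in> Basis" for b
    using that by (auto simp: mem_cube Basis_vec_def inner_axis)
  then show ?thesis
    using True by (auto simp: abs_le_iff indicator_def minus_le_iff intro!: prod.neutral[symmetric])
next
  case False
  then obtain i where i: "\<bar>x $ i\<bar> > L"
    by (auto simp: mem_cube not_le)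
  have "axis i 1 \<in> (Basis :: (real ^ 'd) set)"
    by (simp add: axis_in_Basis_iff)
  moreover have "indicator {- L..L} (x \<bullet> axis i 1) = (0::real)"
    using i by (auto simp: inner_axis indicator_def)
  ultimately show ?thesis
    using False by (auto simp: prod_zero_iff)
qed

lemma cis_sum: "cis (\<Sum>i\<in>I. f i) = (\<Prod>i\<in>I. cis (f i))"
  by (induction I rule: infinite_finite_induct) (simp_all add: cis_mult[symmetric])

definition cube_wave :: "real \<Rightarrow> real ^ 'd \<Rightarrow> real ^ 'd \<Rightarrow> complex" where
  "cube_wave L y x = indicator (cube L) x * wave y x"

text \<open>The integral factorises over coordinates, and a nonzero frequency has a nonzero
  coordinate, whose factor vanishes.\<close>

lemma integral_cube_wave:
  fixes y :: "real ^ 'd"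
  assumes \<epsilon>: "\<epsilon> > 0" and y: "y \<in> scaled_lattice \<epsilon>"
  shows "(LINT x|lebesgue. cube_wave (1 / (2 * \<epsilon>)) y x) = (if y = 0 then 1 / complex_of_real (\<epsilon> ^ CARD('d)) else 0)"
proof -
  define L where "L = 1 / (2 * \<epsilon>)"
  have "\<forall>b\<in>Basis. \<exists>k::int. y \<bullet> b = \<epsilon> * of_int k"
    using y by (auto simp: Basis_vec_def inner_axis scaled_lattice_def)
  then obtain k :: "real ^ 'd \<Rightarrow> int" where k: "\<And>b. b \<in> Basis \<Longrightarrow> y \<bullet> b = \<epsilon> * of_int (k b)"
    by metis
  define g where "g b t = indicator {- L..L} t *\<^sub>R cis (2 * pi * (t * (\<epsilon> * of_int (k b))))" for b t
  have g: "integrable lborel (g b)" "(LINT t|lborel. g b t) = (if k b = 0 then 1 / complex_of_real \<epsilon> else 0)" for b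
    using has_integral_cis_period[OF \<epsilon>, of "k b"]
    by (simp_all add: has_bochner_integral_iff g_def[abs_def] L_def)
  have prod: "cube_wave L y x = (\<Prod>b\<in>Basis. g b (x \<bullet> b))" for x
  proof -
    have "x \<bullet> y = (\<Sum>b\<in>Basis. (x \<bullet> b) * (\<epsilon> * of_int (k b)))"
      by (subst euclidean_inner) (simp add: k)
    then have "wave y x = (\<Prod>b\<in>Basis. cis (2 * pi * ((x \<bullet> b) * (\<epsilon> * of_int (k b)))))"
      by (simp add: wave_def sum_distrib_left cis_sum)
    moreover have "(indicator (cube L) x :: complex) = complex_of_real (indicator (cube L) x)"
      by (simp add: indicator_def)
    ultimately show ?thesis
      by (simp add: cube_wave_def cube_indicator g_def prod.distrib scaleR_conv_of_real)
  qed
  have "cube_wave L y \<in> borel_measurable borel"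
    unfolding cube_wave_def[abs_def]
    by (intro borel_measurable_times borel_measurable_continuous_onI continuous_on_wave borel_measurable_indicator) simp
  then have "(LINT x|lebesgue. cube_wave L y x) = (LINT x|lborel. cube_wave L y x)"
    by (intro integral_completion) simp
  also have "\<dots> = (\<Prod>b\<in>Basis. (LINT t|lborel. g b t))"
    unfolding prod by (rule integral_lborel_prod) (rule g)
  also have "\<dots> = (\<Prod>b\<in>(Basis :: (real ^ 'd) set). if k b = 0 then 1 / complex_of_real \<epsilon> else 0)"
    by (simp add: g)
  also have "\<dots> = (if y = 0 then 1 / complex_of_real (\<epsilon> ^ CARD('d)) else 0)"
  proof (cases "y = 0")
    case True
    then have "k b = 0" if "b \<in> Basis" for b
      using k[OF that] \<epsilon> by simp
    then show ?thesis
      using True by (simp add: power_one_over)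
  next
    case False
    then obtain b where b: "b \<in> Basis" "y \<bullet> b \<noteq> 0"
      using euclidean_all_zero_iff[of y] by blast
    then have "k b \<noteq> 0"
      using k[OF b(1)] by auto
    then show ?thesis
      using False b(1) by (auto simp: prod_zero_iff)
  qed
  finally show ?thesis
    by (simp add: L_def)
qed

lemma integrable_cube_indicator: "integrable lebesgue (\<lambda>x. indicator (cube L) x :: real)"
  unfolding cube_def by (intro integrable_real_indicator) (auto simp: emeasure_lborel_cbox_eq)

lemma measure_cube:
  assumes "L \<ge> 0"
  shows "measure lebesgue (cube L :: (real ^ 'd) set) = (2 * L) ^ CARD('d)"
proof -
  have "(cbox (\<chi> i. - L) (\<chi> i. L) :: (real ^ 'd) set) \<noteq> {}"
    using assms by (simp add: interval_ne_empty_cart)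
  from content_cbox_cart[OF this] show ?thesis
    by (simp add: cube_def measure_completion)
qed

lemma sq_int_bounded_cube:
  assumes f: "f \<in> borel_measurable lebesgue" and bd: "\<And>x. cmod (f x) \<le> C * indicator (cube L) x"
  shows "f \<in> sq_int lebesgue"
proof -
  have "integrable lebesgue (\<lambda>x. (cmod (f x))\<^sup>2)"
  proof (rule Bochner_Integration.integrable_bound[OF integrable_mult_right[OF integrable_cube_indicator[of L], of "C\<^sup>2"]])
    show "AE x in lebesgue. norm ((cmod (f x))\<^sup>2) \<le> norm (C\<^sup>2 * indicator (cube L) x :: real)"
    proof (rule AE_I2)
      fix x
      show "norm ((cmod (f x))\<^sup>2) \<le> norm (C\<^sup>2 * indicator (cube L) x :: real)"
        using bd[of x] power_mono[OF bd[of x] norm_ge_zero, of 2] by (auto simp: indicator_def split: if_splits)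
    qed
  qed (use f in measurable)
  with f show ?thesis
    by (simp add: sq_int_def)
qed

lemma borel_imp_lebesgue_measurable:
  fixes f :: "'a::euclidean_space \<Rightarrow> 'b::topological_space"
  assumes "f \<in> borel_measurable borel"
  shows "f \<in> borel_measurable lebesgue"
  by (rule measurable_completion) (simp add: assms)

lemma cube_wave_sq_int: "cube_wave L y \<in> sq_int lebesgue"
proof (rule sq_int_bounded_cube[where C=1 and L=L])
  show "cube_wave L y \<in> borel_measurable lebesgue"
    unfolding cube_wave_def[abs_def]
    by (intro borel_imp_lebesgue_measurable borel_measurable_times borel_measurable_continuous_onI
        continuous_on_wave borel_measurable_indicator) simp
qed (simp add: cube_wave_def norm_mult indicator_def)

section \<open>Complex inner products and orthogonal expansion\<close>

definition sq_cinner :: "'a measure \<Rightarrow> ('a \<Rightarrow> complex) \<Rightarrow> ('a \<Rightarrow> complex) \<Rightarrow> complex" where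
  "sq_cinner M f g = (LINT x|M. f x * cnj (g x))"

lemma sq_cinner_integrable:
  assumes "f \<in> sq_int M" "g \<in> sq_int M"
  shows "integrable M (\<lambda>x. f x * cnj (g x))"
proof (rule Bochner_Integration.integrable_bound)
  show "integrable M (\<lambda>x. (cmod (f x))\<^sup>2 + (cmod (g x))\<^sup>2)"
    using assms by (intro Bochner_Integration.integrable_add sq_int_integrable)
  show "(\<lambda>x. f x * cnj (g x)) \<in> borel_measurable M"
  proof -
    have [measurable]: "cnj \<in> borel_measurable borel"
      by (intro borel_measurable_continuous_onI continuous_intros)
    have [measurable]: "f \<in> borel_measurable M" "g \<in> borel_measurable M"
      using assms by (auto dest: sq_int_measurable)
    show ?thesis
      by measurable
  qed
  show "AE x in M. norm (f x * cnj (g x)) \<le> norm ((cmod (f x))\<^sup>2 + (cmod (g x))\<^sup>2)"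
  proof (rule AE_I2)
    fix x
    have "2 * (cmod (f x) * cmod (g x)) \<le> (cmod (f x))\<^sup>2 + (cmod (g x))\<^sup>2"
      using sum_squares_bound[of "cmod (f x)" "cmod (g x)"] by simp
    moreover have "0 \<le> cmod (f x) * cmod (g x)"
      by simp
    ultimately have "cmod (f x) * cmod (g x) \<le> (cmod (f x))\<^sup>2 + (cmod (g x))\<^sup>2"
      by linarith
    then show "norm (f x * cnj (g x)) \<le> norm ((cmod (f x))\<^sup>2 + (cmod (g x))\<^sup>2)"
      by (simp add: norm_mult)
  qed
qed

lemma sq_cinner_diff_left:
  assumes "f \<in> sq_int M" "g \<in> sq_int M" "h \<in> sq_int M"
  shows "sq_cinner M (\<lambda>x. f x - g x) h = sq_cinner M f h - sq_cinner M g h"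
  using assms by (simp add: sq_cinner_def left_diff_distrib sq_cinner_integrable)

lemma sq_cinner_scale_left: "sq_cinner M (\<lambda>x. c * f x) g = c * sq_cinner M f g"
  by (simp add: sq_cinner_def mult.assoc)

lemma sq_inner_scale_cinner:
  assumes "f \<in> sq_int M" "g \<in> sq_int M"
  shows "sq_inner M f (\<lambda>x. c * g x) = Re (cnj c * sq_cinner M f g)"
proof -
  have "sq_inner M f (\<lambda>x. c * g x) = (LINT x|M. Re (cnj c * (f x * cnj (g x))))"
    by (simp add: sq_inner_def inner_complex_def algebra_simps)
  also have "\<dots> = Re (LINT x|M. cnj c * (f x * cnj (g x)))"
    by (intro integral_Re integrable_mult_right sq_cinner_integrable assms)
  finally show ?thesis
    by (simp add: sq_cinner_def)
qed

lemma cube_wave_orthogonal: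
  fixes y z :: "real ^ 'd"
  assumes \<epsilon>: "\<epsilon> > 0" and "y \<in> scaled_lattice \<epsilon>" "z \<in> scaled_lattice \<epsilon>"
  shows "sq_cinner lebesgue (cube_wave (1 / (2 * \<epsilon>)) y) (cube_wave (1 / (2 * \<epsilon>)) z) =
    (if y = z then 1 / complex_of_real (\<epsilon> ^ CARD('d)) else 0)"
proof -
  have "cube_wave L y x * cnj (cube_wave L z x) = cube_wave L (y + - z) x" for L and x :: "real ^ 'd"
    by (auto simp: cube_wave_def cnj_wave indicator_def wave_mult[of y x "- z"])
  then have "sq_cinner lebesgue (cube_wave (1 / (2 * \<epsilon>)) y) (cube_wave (1 / (2 * \<epsilon>)) z) =
      (LINT x|lebesgue. cube_wave (1 / (2 * \<epsilon>)) (y + - z) x)"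
    by (simp add: sq_cinner_def)
  also have "\<dots> = (if y = z then 1 / complex_of_real (\<epsilon> ^ CARD('d)) else 0)"
    using integral_cube_wave[OF \<epsilon> scaled_lattice_add[OF assms(2) scaled_lattice_minus[OF assms(3)]]] by simp
  finally show ?thesis .
qed

lemma cube_wave_norm_sq:
  fixes y :: "real ^ 'd"
  assumes "L \<ge> 0"
  shows "(sq_norm lebesgue (cube_wave L y))\<^sup>2 = (2 * L) ^ CARD('d)"
proof -
  have "(cmod (cube_wave L y x))\<^sup>2 = indicator (cube L) x" for x
    by (simp add: cube_wave_def norm_mult indicator_def)
  then show ?thesis
    using measure_cube[OF assms, where 'd='d] by (simp add: sq_norm_sq)
qed

text \<open>Induction with \<open>h\<close> arbitrary: one wave is absorbed into \<open>h\<close>,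
  and orthogonality leaves the coefficients at the other frequencies unchanged.
  \<open>1 / \<kappa>\<close> is the volume of the cube and thus the squared norm of each
  wave.\<close>

lemma sq_norm_diff_waves:
  fixes h :: "real ^ 'd \<Rightarrow> complex"
  assumes \<epsilon>: "\<epsilon> > 0" and F: "finite F" "F \<subseteq> scaled_lattice \<epsilon>" and h: "h \<in> sq_int lebesgue"
  defines "e \<equiv> cube_wave (1 / (2 * \<epsilon>))" and "\<kappa> \<equiv> \<epsilon> ^ CARD('d)"
  shows "(sq_norm lebesgue (\<lambda>x. h x - (\<Sum>y\<in>F. c y * e y x)))\<^sup>2 =
    (sq_norm lebesgue h)\<^sup>2 + (\<Sum>y\<in>F. (cmod (c y))\<^sup>2 / \<kappa> - 2 * Re (cnj (c y) * sq_cinner lebesgue h (e y)))"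
  using F h
proof (induction F arbitrary: h)
  case (insert y F)
  define h' where "h' x = h x - c y * e y x" for x
  have e: "e y \<in> sq_int lebesgue" for y
    by (simp add: e_def cube_wave_sq_int)
  have h': "h' \<in> sq_int lebesgue"
    unfolding h'_def by (intro sq_int_diff sq_int_scale e insert.prems)
  have ip: "sq_cinner lebesgue h' (e z) = sq_cinner lebesgue h (e z)" if "z \<in> F" for z
  proof -
    have "sq_cinner lebesgue (e y) (e z) = 0"
      using cube_wave_orthogonal[OF \<epsilon>, of y z] that insert by (auto simp: e_def)
    then show ?thesis
      unfolding h'_def by (simp add: sq_cinner_diff_left sq_int_scale e insert.prems sq_cinner_scale_left)
  qed
  have "(\<lambda>x. h x - (\<Sum>z\<in>insert y F. c z * e z x)) = (\<lambda>x. h' x - (\<Sum>z\<in>F. c z * e z x))"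
    using insert.hyps by (simp add: h'_def fun_eq_iff)
  then have "(sq_norm lebesgue (\<lambda>x. h x - (\<Sum>z\<in>insert y F. c z * e z x)))\<^sup>2 =
      (sq_norm lebesgue h')\<^sup>2 + (\<Sum>y\<in>F. (cmod (c y))\<^sup>2 / \<kappa> - 2 * Re (cnj (c y) * sq_cinner lebesgue h' (e y)))"
    using insert.IH[OF _ h'] insert.prems by simp
  also have "(sq_norm lebesgue h')\<^sup>2 = (sq_norm lebesgue h)\<^sup>2
      + ((cmod (c y))\<^sup>2 / \<kappa> - 2 * Re (cnj (c y) * sq_cinner lebesgue h (e y)))"
  proof -
    have "h' = (\<lambda>x. h x + (- c y) * e y x)"
      by (simp add: h'_def fun_eq_iff)
    then have "(sq_norm lebesgue h')\<^sup>2 = (sq_norm lebesgue h)\<^sup>2 + 2 * sq_inner lebesgue h (\<lambda>x. (- c y) * e y x)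
        + (sq_norm lebesgue (\<lambda>x. (- c y) * e y x))\<^sup>2"
      using sq_norm_add_sq[OF insert.prems(2) sq_int_scale[OF e, of "- c y"]] by simp
    also have "\<dots> = (sq_norm lebesgue h)\<^sup>2 - 2 * Re (cnj (c y) * sq_cinner lebesgue h (e y))
        + (cmod (c y))\<^sup>2 / \<kappa>"
      unfolding sq_inner_scale_cinner[OF insert.prems(2) e] sq_norm_scale power_mult_distrib
      using cube_wave_norm_sq[of "1 / (2 * \<epsilon>)" y] \<epsilon> by (simp add: e_def \<kappa>_def power_one_over)
    finally show ?thesis
      by simp
  qed
  finally show ?case
    using insert.hyps ip by simp
qed simp

text \<open>Completing the square in every coefficient. The optimal choice
  \<open>c y = \<kappa> * sq_cinner lebesgue h (e y)\<close> kills the last sum and gives Bessel's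
  inequality; for any other choice its sign turns a good approximation into a lower bound for the
  coefficient sum.\<close>

lemma sq_norm_diff_waves_square:
  fixes h :: "real ^ 'd \<Rightarrow> complex"
  assumes \<epsilon>: "\<epsilon> > 0" and F: "finite F" "F \<subseteq> scaled_lattice \<epsilon>" and h: "h \<in> sq_int lebesgue"
  defines "e \<equiv> cube_wave (1 / (2 * \<epsilon>))" and "\<kappa> \<equiv> \<epsilon> ^ CARD('d)"
  shows "(sq_norm lebesgue (\<lambda>x. h x - (\<Sum>y\<in>F. c y * e y x)))\<^sup>2 =
    (sq_norm lebesgue h)\<^sup>2 - \<kappa> * (\<Sum>y\<in>F. (cmod (sq_cinner lebesgue h (e y)))\<^sup>2)
     + (\<Sum>y\<in>F. (cmod (c y - \<kappa> * sq_cinner lebesgue h (e y)))\<^sup>2) / \<kappa>"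
proof -
  have \<kappa>: "\<kappa> > 0"
    using \<epsilon> by (simp add: \<kappa>_def)
  have "(cmod a)\<^sup>2 / \<kappa> - 2 * Re (cnj a * b) = - \<kappa> * (cmod b)\<^sup>2 + (cmod (a - \<kappa> * b))\<^sup>2 / \<kappa>" for a b :: complex
  proof -
    have "(cmod (a - \<kappa> * b))\<^sup>2 = (cmod a)\<^sup>2 - 2 * \<kappa> * Re (cnj a * b) + \<kappa>\<^sup>2 * (cmod b)\<^sup>2"
      unfolding cmod_power2 by (simp add: power2_eq_square algebra_simps)
    then show ?thesis
      using \<kappa> by (simp add: field_simps power2_eq_square)
  qed
  note key = this
  show ?thesis
    unfolding sq_norm_diff_waves[OF \<epsilon> F h, folded e_def \<kappa>_def] key
    by (simp add: sum.distrib sum_subtractf sum_negf sum_distrib_left sum_divide_distrib)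
qed

subsection \<open>Completeness of the lattice exponentials\<close>

lemma sq_norm_le_sup_cube:
  fixes f :: "real ^ 'd \<Rightarrow> complex"
  assumes f: "f \<in> borel_measurable lebesgue" and L: "L \<ge> 0" and C: "C \<ge> 0"
    and bd: "\<And>x. cmod (f x) \<le> C * indicator (cube L) x"
  shows "sq_norm lebesgue f \<le> C * sqrt ((2 * L) ^ CARD('d))"
proof -
  have "(LINT x|lebesgue. (cmod (f x))\<^sup>2) \<le> (LINT x::real ^ 'd|lebesgue. C\<^sup>2 * indicator (cube L) x)"
  proof (rule integral_mono)
    show "integrable lebesgue (\<lambda>x. (cmod (f x))\<^sup>2)"
      by (rule sq_int_integrable[OF sq_int_bounded_cube[OF f bd]])
    show "integrable lebesgue (\<lambda>x::real ^ 'd. C\<^sup>2 * indicator (cube L) x :: real)"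
      by (rule integrable_mult_right[OF integrable_cube_indicator])
    show "(cmod (f x))\<^sup>2 \<le> C\<^sup>2 * indicator (cube L) x" for x
      using bd[of x] power_mono[OF bd[of x] norm_ge_zero, of 2] by (auto simp: indicator_def split: if_splits)
  qed
  also have "\<dots> = C\<^sup>2 * (2 * L) ^ CARD('d)"
    using measure_cube[OF L, where 'd='d] by simp
  finally have "sq_norm lebesgue f \<le> sqrt (C\<^sup>2 * (2 * L) ^ CARD('d))"
    unfolding sq_norm_def by (rule real_sqrt_le_mono)
  then show ?thesis
    using C by (simp add: real_sqrt_mult)
qed

lemma sq_norm_dominated_convergence:
  fixes s :: "nat \<Rightarrow> 'a \<Rightarrow> complex"
  assumes s: "\<And>n. s n \<in> borel_measurable M" and h: "h \<in> borel_measurable M"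
    and w: "integrable M w" and bd: "\<And>n. AE x in M. (cmod (h x - s n x))\<^sup>2 \<le> w x"
    and lim: "AE x in M. (\<lambda>n. s n x) \<longlonglongrightarrow> h x"
  shows "(\<lambda>n. sq_norm M (\<lambda>x. h x - s n x)) \<longlonglongrightarrow> 0"
proof -
  have "(\<lambda>n. LINT x|M. (cmod (h x - s n x))\<^sup>2) \<longlonglongrightarrow> (LINT x|M. 0)"
  proof (rule integral_dominated_convergence[OF _ _ w])
    show "AE x in M. (\<lambda>n. (cmod (h x - s n x))\<^sup>2) \<longlonglongrightarrow> 0"
      using lim
    proof eventually_elim
      case (elim x)
      have "(\<lambda>n. (cmod (h x - s n x))\<^sup>2) \<longlonglongrightarrow> (cmod (h x - h x))\<^sup>2"
        by (intro tendsto_intros elim)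
      then show ?case
        by simp
    qed
    show "AE x in M. norm ((cmod (h x - s n x))\<^sup>2) \<le> w x" for n
      using bd[of n] by simp
  qed (use s h in measurable)
  then show ?thesis
    unfolding sq_norm_def using tendsto_real_sqrt[of _ 0] by fastforce
qed

text \<open>The cut-off is essential: a nonzero trigonometric polynomial is not square-integrable
  over the whole space.\<close>

definition trig_approx :: "real \<Rightarrow> (real ^ 'd \<Rightarrow> complex) \<Rightarrow> bool" where
  "trig_approx \<epsilon> h \<longleftrightarrow>
     (\<forall>\<delta>>0. \<exists>q. trig_poly \<epsilon> q \<and> sq_norm lebesgue (\<lambda>x. h x - indicator (cube (1 / (2 * \<epsilon>))) x * q x) < \<delta>)"

lemma cut_trig_poly_sq_int:
  assumes "trig_poly \<epsilon> q"
  shows "(\<lambda>x. indicator (cube L) x * q x) \<in> sq_int lebesgue"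
proof -
  obtain F c where q: "q = (\<lambda>x. \<Sum>y\<in>F. c y * wave y x)"
    using trig_poly_finite_sum[OF assms] by metis
  have "(\<lambda>x. indicator (cube L) x * q x) = (\<lambda>x. \<Sum>y\<in>F. c y * cube_wave L y x)"
    by (simp add: q cube_wave_def sum_distrib_left mult_ac)
  then show ?thesis
    by (simp add: sq_int_sum sq_int_scale cube_wave_sq_int)
qed

lemma trig_approx_limit:
  assumes h: "h \<in> sq_int lebesgue"
    and "\<And>n. s n \<in> sq_int lebesgue" "\<And>n. trig_approx \<epsilon> (s n)"
    and lim: "(\<lambda>n. sq_norm lebesgue (\<lambda>x. h x - s n x)) \<longlonglongrightarrow> 0"
  shows "trig_approx \<epsilon> h"
  unfolding trig_approx_def
proof (intro allI impI)
  fix \<delta> :: real assume \<delta>: "\<delta> > 0"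
  obtain n where n: "sq_norm lebesgue (\<lambda>x. h x - s n x) < \<delta> / 2"
    using order_tendstoD(2)[OF lim, of "\<delta> / 2"] \<delta> by (auto simp: eventually_sequentially)
  obtain q where q: "trig_poly \<epsilon> q"
    "sq_norm lebesgue (\<lambda>x. s n x - indicator (cube (1 / (2 * \<epsilon>))) x * q x) < \<delta> / 2"
    using assms(3)[of n] \<delta> unfolding trig_approx_def by (meson half_gt_zero)
  have "sq_norm lebesgue (\<lambda>x. h x - indicator (cube (1 / (2 * \<epsilon>))) x * q x) < \<delta>"
    using sq_norm_triangle_via[OF h assms(2)[of n] cut_trig_poly_sq_int[OF q(1), of "1 / (2 * \<epsilon>)"]] n q(2)
    by linarith
  with q(1) show "\<exists>q. trig_poly \<epsilon> q \<and> sq_norm lebesgue (\<lambda>x. h x - indicator (cube (1 / (2 * \<epsilon>))) x * q x) < \<delta>"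
    by blast
qed

definition open_cube :: "real \<Rightarrow> (real ^ 'd) set" where
  "open_cube L = box (\<chi> i. - L) (\<chi> i. L)"

lemma mem_open_cube: "x \<in> open_cube L \<longleftrightarrow> (\<forall>i. \<bar>x $ i\<bar> < L)"
proof -
  have "\<bar>t\<bar> < L \<longleftrightarrow> - L < t \<and> t < L" for t
    by auto
  then show ?thesis
    by (simp add: open_cube_def mem_box_cart)
qed

lemma trig_approx_continuous:
  fixes f :: "real ^ 'd \<Rightarrow> complex"
  assumes \<epsilon>: "\<epsilon> > 0" and f: "continuous_on UNIV f"
    and vanish: "\<And>x. x \<notin> open_cube (1 / (2 * \<epsilon>)) \<Longrightarrow> f x = 0"
  shows "trig_approx \<epsilon> f"
  unfolding trig_approx_def
proof (intro allI impI)
  define L where "L = 1 / (2 * \<epsilon>)"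
  have L: "L > 0"
    using \<epsilon> by (simp add: L_def)
  fix \<delta> :: real assume \<delta>: "\<delta> > 0"
  define V where "V = sqrt ((2 * L) ^ CARD('d))"
  have V: "V > 0"
    using L by (simp add: V_def)
  \<comment> \<open>A uniform error \<open>e\<close> on the cube costs at most \<open>e * V\<close>
    in norm, where \<open>V\<close> is the square root of the volume.\<close>
  define e where "e = \<delta> / (2 * V)"
  have e: "e > 0"
    using V \<delta> by (simp add: e_def)
  obtain q where q: "trig_poly \<epsilon> q" "\<And>x. x \<in> cube L \<Longrightarrow> cmod (f x - q x) < e"
  proof (rule trig_poly_dense_continuous[OF \<epsilon>, folded L_def, of f e])
    show "continuous_on (cube L) f"
      using f continuous_on_subset by blast
    show "f x = 0" if "x \<in> cube L" "\<bar>x $ i\<bar> = L" for x i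
      using vanish[of x] that(2) by (auto simp: mem_open_cube L_def[symmetric])
  qed (use e in auto)
  have "sq_norm lebesgue (\<lambda>x. f x - indicator (cube L) x * q x) \<le> e * V"
    unfolding V_def
  proof (rule sq_norm_le_sup_cube)
    show "(\<lambda>x. f x - indicator (cube L) x * q x) \<in> borel_measurable lebesgue"
      by (intro borel_imp_lebesgue_measurable borel_measurable_diff borel_measurable_times
          borel_measurable_continuous_onI f continuous_on_trig_poly[OF q(1)] borel_measurable_indicator) simp
    show "cmod (f x - indicator (cube L) x * q x) \<le> e * indicator (cube L) x" for x
    proof (cases "x \<in> cube L")
      case True
      then show ?thesis
        using q(2)[of x] by simp
    next
      case False
      then have "x \<notin> open_cube L"
        by (meson mem_cube mem_open_cube less_imp_le)
      then show ?thesis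
        using vanish[of x] False by (simp add: L_def)
    qed
  qed (use L e in auto)
  also have "e * V < \<delta>"
    using V \<delta> by (simp add: e_def)
  finally show "\<exists>q. trig_poly \<epsilon> q \<and> sq_norm lebesgue (\<lambda>x. f x - indicator (cube (1 / (2 * \<epsilon>))) x * q x) < \<delta>"
    using q(1) by (auto simp: L_def)
qed

text \<open>The faces form a null set, so approximants that vanish there can still converge almost
  everywhere.\<close>

lemma AE_cube_open_cube: "AE x in lebesgue. x \<in> cube L \<longrightarrow> x \<in> (open_cube L :: (real ^ 'd) set)"
proof -
  have "negligible (cube L - open_cube L :: (real ^ 'd) set)"
    unfolding cube_def open_cube_def by (rule negligible_frontier_interval)
  then have "cube L - open_cube L \<in> null_sets (lebesgue :: (real ^ 'd) measure)"
    by (simp add: negligible_iff_null_sets)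
  from AE_not_in[OF this] show ?thesis
    by eventually_elim blast
qed

text \<open>Measurable functions are almost everywhere limits of continuous ones; clamping the values and
  multiplying with cutoffs \<open>min 1 (n \<sqdot> dist(x, boundary))\<close> makes the limit dominated.\<close>

lemma trig_approx_bounded:
  fixes h :: "real ^ 'd \<Rightarrow> complex"
  assumes \<epsilon>: "\<epsilon> > 0" and h: "h \<in> borel_measurable lebesgue"
    and bd: "\<And>x. cmod (h x) \<le> C * indicator (cube (1 / (2 * \<epsilon>))) x"
  shows "trig_approx \<epsilon> h"
proof -
  define L where "L = 1 / (2 * \<epsilon>)"
  have L: "L > 0"
    using \<epsilon> by (simp add: L_def)
  have C: "C \<ge> 0"
    using order_trans[OF norm_ge_zero bd[of 0]] L by (simp add: L_def[symmetric] mem_cube)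
  have hC: "cmod (h x) \<le> C" for x
    using bd[of x] C by (cases "x \<in> cube (1 / (2 * \<epsilon>))") simp_all
  have "h measurable_on UNIV"
    using lebesgue_measurable_imp_measurable_on[OF h] by simp
  then obtain N g where N: "negligible N" and g: "\<And>n. continuous_on UNIV (g n)"
    and lim: "\<And>x. x \<notin> N \<Longrightarrow> (\<lambda>n. g n x) \<longlonglongrightarrow> h x"
    unfolding measurable_on_def by auto
  \<comment> \<open>The closest-point map onto the disc of radius \<open>C\<close> is continuous and
    fixes the values of \<open>h\<close>, so it bounds the approximants without changing their
    limit.\<close>
  define P where "P = closest_point (cball (0::complex) C)"
  have P: "continuous_on UNIV P"
    unfolding P_def using C by (intro continuous_on_closest_point) auto
  have P_bd: "cmod (P z) \<le> C" for z
    using closest_point_in_set[of "cball (0::complex) C" z] C by (auto simp: P_def)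
  have P_id: "P (h x) = h x" for x
    using hC by (auto simp: P_def intro: closest_point_self)
  define X where "X = - (open_cube L :: (real ^ 'd) set)"
  have X: "closed X"
    unfolding X_def open_cube_def by (simp add: closed_Compl open_box)
  have X_ne: "X \<noteq> {}"
  proof -
    have "(\<chi> i. L) \<in> X"
      using L by (simp add: X_def mem_open_cube)
    then show ?thesis
      by blast
  qed
  define cut where "cut n x = min 1 (real n * infdist x X)" for n :: nat and x
  have cut: "continuous_on UNIV (cut n)" "0 \<le> cut n x" "cut n x \<le> 1" for n x
    unfolding cut_def by (auto intro!: continuous_intros simp: infdist_nonneg)
  have cut_out: "cut n x = 0" if "x \<notin> open_cube L" for n x
    using that by (simp add: cut_def X_def)
  have cut_lim: "(\<lambda>n. cut n x) \<longlonglongrightarrow> 1" if "x \<in> open_cube L" for x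
  proof -
    have pos: "infdist x X > 0"
      using that X X_ne by (intro infdist_pos_not_in_closed) (auto simp: X_def)
    have "\<forall>\<^sub>F n in sequentially. cut n x = 1"
    proof -
      obtain m where "1 / infdist x X < real m"
        using reals_Archimedean2 by blast
      then have "cut n x = 1" if "n \<ge> m" for n
      proof -
        have "1 / infdist x X \<le> real n"
          using that \<open>1 / infdist x X < real m\<close> by linarith
        then show ?thesis
          using pos by (simp add: cut_def field_simps)
      qed
      then show ?thesis
        by (auto simp: eventually_sequentially)
    qed
    then show ?thesis
      by (rule tendsto_eventually)
  qed
  define s where "s n x = complex_of_real (cut n x) * P (g n x)" for n x
  have s_cont: "continuous_on UNIV (s n)" for n
    unfolding s_def
    by (intro continuous_intros cut continuous_on_compose2[OF P g]) simp
  have s_out: "s n x = 0" if "x \<notin> open_cube L" for n x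
    using that by (simp add: s_def cut_out)
  have s_bd: "cmod (s n x) \<le> C * indicator (cube L) x" for n x
  proof (cases "x \<in> open_cube L")
    case True
    then have "x \<in> cube L"
      by (meson mem_cube mem_open_cube less_imp_le)
    moreover have "cmod (s n x) \<le> 1 * C"
      unfolding s_def norm_mult using cut[of n] P_bd by (intro mult_mono) auto
    ultimately show ?thesis
      by simp
  next
    case False
    then show ?thesis
      using C by (simp add: s_out)
  qed
  have s_meas: "s n \<in> borel_measurable lebesgue" for n
    by (intro borel_imp_lebesgue_measurable borel_measurable_continuous_onI s_cont)
  have "(\<lambda>n. sq_norm lebesgue (\<lambda>x. h x - s n x)) \<longlonglongrightarrow> 0"
  proof (rule sq_norm_dominated_convergence[OF s_meas h])
    show "integrable lebesgue (\<lambda>x::real ^ 'd. (2 * C)\<^sup>2 * indicator (cube L) x :: real)"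
      by (rule integrable_mult_right[OF integrable_cube_indicator])
    show "AE x in lebesgue. (cmod (h x - s n x))\<^sup>2 \<le> (2 * C)\<^sup>2 * indicator (cube L) x" for n
    proof (rule AE_I2)
      fix x
      have "cmod (h x - s n x) \<le> (2 * C) * indicator (cube L) x"
        using norm_triangle_ineq4[of "h x" "s n x"] bd[of x] s_bd[of n x] by (simp add: L_def)
      from power_mono[OF this norm_ge_zero, of 2]
      show "(cmod (h x - s n x))\<^sup>2 \<le> (2 * C)\<^sup>2 * indicator (cube L) x"
        by (auto simp: indicator_def split: if_splits)
    qed
    have "AE x in lebesgue. x \<notin> N"
      using N by (intro AE_not_in) (simp add: negligible_iff_null_sets)
    with AE_cube_open_cube[of L] show "AE x in lebesgue. (\<lambda>n. s n x) \<longlonglongrightarrow> h x"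
    proof eventually_elim
      case (elim x)
      show ?case
      proof (cases "x \<in> open_cube L")
        case True
        have "(\<lambda>n. s n x) \<longlonglongrightarrow> complex_of_real 1 * P (h x)"
          unfolding s_def
          by (intro tendsto_mult tendsto_of_real cut_lim True continuous_on_tendsto_compose[OF P lim[OF elim(2)]]) auto
        then show ?thesis
          by (simp add: P_id)
      next
        case False
        then have "x \<notin> cube L"
          using elim by blast
        then have "h x = 0"
          using bd[of x] by (simp add: L_def)
        then show ?thesis
          using False by (simp add: s_out)
      qed
    qed
  qed
  moreover have "s n \<in> sq_int lebesgue" "trig_approx \<epsilon> (s n)" for n
    using sq_int_bounded_cube[OF s_meas s_bd] trig_approx_continuous[OF \<epsilon> s_cont s_out[unfolded L_def]] by auto
  ultimately show ?thesis
    using trig_approx_limit[OF sq_int_bounded_cube[OF h bd]] by blast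
qed

text \<open>Truncation in value reduces to the bounded case; \<open>|h|^2\<close> dominates the
  squared errors.\<close>

lemma trig_approx_sq_int:
  fixes h :: "real ^ 'd \<Rightarrow> complex"
  assumes \<epsilon>: "\<epsilon> > 0" and h: "h \<in> sq_int lebesgue"
    and supp: "AE x in lebesgue. x \<notin> cube (1 / (2 * \<epsilon>)) \<longrightarrow> h x = 0"
  shows "trig_approx \<epsilon> h"
proof -
  define s where "s n x = (if x \<in> cube (1 / (2 * \<epsilon>)) \<and> cmod (h x) \<le> real n then h x else 0)" for n :: nat and x
  have [measurable]: "h \<in> borel_measurable lebesgue" "cube (1 / (2 * \<epsilon>)) \<in> sets (lebesgue :: (real ^ 'd) measure)"
    using sq_int_measurable[OF h] by (auto simp: cube_def)
  have s_meas: "s n \<in> borel_measurable lebesgue" for n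
    unfolding s_def[abs_def] by measurable
  have s_bd: "cmod (s n x) \<le> real n * indicator (cube (1 / (2 * \<epsilon>))) x" for n x
    by (simp add: s_def)
  have "(\<lambda>n. sq_norm lebesgue (\<lambda>x. h x - s n x)) \<longlonglongrightarrow> 0"
  proof (rule sq_norm_dominated_convergence[OF s_meas sq_int_measurable[OF h] sq_int_integrable[OF h]])
    show "AE x in lebesgue. (cmod (h x - s n x))\<^sup>2 \<le> (cmod (h x))\<^sup>2" for n
      by (auto simp: s_def)
    show "AE x in lebesgue. (\<lambda>n. s n x) \<longlonglongrightarrow> h x"
      using supp
    proof eventually_elim
      case (elim x)
      obtain m where m: "cmod (h x) \<le> real m"
        using real_arch_simple by blast
      have "s n x = h x" if "n \<ge> m" for n
        using elim m that by (auto simp: s_def)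
      then show ?case
        by (intro tendsto_eventually) (auto simp: eventually_sequentially)
    qed
  qed
  then show ?thesis
    by (rule trig_approx_limit[where s=s, OF h sq_int_bounded_cube[OF s_meas s_bd] trig_approx_bounded[OF \<epsilon> s_meas s_bd]])
qed

text \<open>Support in the cube turns the Fourier integral, whose kernel is not square-integrable,
  into an inner product with a fixed element of L2, so that Cauchy-Schwarz makes point values
  continuous in \<open>h\<close>.\<close>

lemma fourier_eq_cinner:
  fixes h :: "real ^ 'd \<Rightarrow> complex"
  assumes h: "h \<in> sq_int lebesgue" and supp: "AE x in lebesgue. x \<notin> cube L \<longrightarrow> h x = 0"
  shows "fourier h y = sq_cinner lebesgue h (cube_wave L y)"
  unfolding fourier_wave sq_cinner_def
proof (rule integral_cong_AE)
  show "(\<lambda>x. h x * cnj (cube_wave L y x)) \<in> borel_measurable lebesgue"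
    using borel_measurable_integrable[OF sq_cinner_integrable[OF h cube_wave_sq_int]] .
  show "(\<lambda>x. h x * cnj (wave y x)) \<in> borel_measurable lebesgue"
    unfolding cnj_wave
    by (intro borel_measurable_times sq_int_measurable[OF h] borel_imp_lebesgue_measurable
        borel_measurable_continuous_onI continuous_on_wave)
  show "AE x in lebesgue. h x * cnj (wave y x) = h x * cnj (cube_wave L y x)"
    using supp by eventually_elim (auto simp: cube_wave_def indicator_def)
qed

text \<open>Bessel's inequality caps every partial sum, and density pushes the partial sums above
  any smaller number. As the terms are nonnegative, a finite set of frequencies can be enlarged to
  an initial segment of the enumeration.\<close>

theorem parseval_cube:
  fixes h :: "real ^ 'd \<Rightarrow> complex" and \<rho> :: "nat \<Rightarrow> real ^ 'd"
  assumes \<epsilon>: "\<epsilon> > 0" and h: "h \<in> sq_int lebesgue"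
    and supp: "AE x in lebesgue. x \<notin> cube (1 / (2 * \<epsilon>)) \<longrightarrow> h x = 0"
    and \<rho>: "bij_betw \<rho> UNIV (scaled_lattice \<epsilon>)"
  shows "(\<lambda>i. (cmod (fourier h (\<rho> i)))\<^sup>2) sums ((sq_norm lebesgue h)\<^sup>2 / \<epsilon> ^ CARD('d))"
proof -
  define L where "L = 1 / (2 * \<epsilon>)"
  define \<kappa> where "\<kappa> = \<epsilon> ^ CARD('d)"
  have \<kappa>: "\<kappa> > 0"
    using \<epsilon> by (simp add: \<kappa>_def)
  note coeff = fourier_eq_cinner[OF h supp, folded L_def]
  have inj: "inj \<rho>" and range: "range \<rho> = scaled_lattice \<epsilon>"
    using \<rho> by (auto simp: bij_betw_def)
  have expand: "(sq_norm lebesgue (\<lambda>x. h x - (\<Sum>y\<in>F. c y * cube_wave L y x)))\<^sup>2 =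
      (sq_norm lebesgue h)\<^sup>2 - \<kappa> * (\<Sum>y\<in>F. (cmod (fourier h y))\<^sup>2)
       + (\<Sum>y\<in>F. (cmod (c y - \<kappa> * fourier h y))\<^sup>2) / \<kappa>"
    if "finite F" "F \<subseteq> scaled_lattice \<epsilon>" for F c
    using sq_norm_diff_waves_square[OF \<epsilon> that h, of c] by (simp add: \<kappa>_def flip: L_def coeff)
  have bessel: "\<kappa> * (\<Sum>y\<in>F. (cmod (fourier h y))\<^sup>2) \<le> (sq_norm lebesgue h)\<^sup>2"
    if F: "finite F" "F \<subseteq> scaled_lattice \<epsilon>" for F
    using expand[OF F, of "\<lambda>y. \<kappa> * fourier h y"]
      zero_le_power2[of "sq_norm lebesgue (\<lambda>x. h x - (\<Sum>y\<in>F. (\<kappa> * fourier h y) * cube_wave L y x))"]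
    by simp
  have partial: "(\<Sum>i<n. (cmod (fourier h (\<rho> i)))\<^sup>2) = (\<Sum>y\<in>\<rho> ` {..<n}. (cmod (fourier h y))\<^sup>2)" for n
    using inj by (subst sum.reindex) (auto intro: inj_on_subset)
  define S where "S = (sq_norm lebesgue h)\<^sup>2 / \<kappa>"
  have upper: "(\<Sum>i<n. (cmod (fourier h (\<rho> i)))\<^sup>2) \<le> S" for n
    using bessel[of "\<rho> ` {..<n}"] range \<kappa> by (auto simp: partial S_def field_simps)
  have lower: "\<forall>\<^sub>F n in sequentially. a < (\<Sum>i<n. (cmod (fourier h (\<rho> i)))\<^sup>2)" if a: "a < S" for a
  proof -
    \<comment> \<open>With \<open>\<kappa> * S\<close> equal to the squared norm of
      \<open>h\<close>, an error below this \<open>\<delta>\<close> leaves more than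
      \<open>\<kappa> * a\<close> for the finite coefficient sum.\<close>
    define \<delta> where "\<delta> = sqrt (\<kappa> * (S - a))"
    have \<delta>: "\<delta> > 0" "\<delta>\<^sup>2 = \<kappa> * (S - a)"
      using a \<kappa> by (simp_all add: \<delta>_def)
    obtain q where q: "trig_poly \<epsilon> q" "sq_norm lebesgue (\<lambda>x. h x - indicator (cube L) x * q x) < \<delta>"
      using trig_approx_sq_int[OF \<epsilon> h supp] \<delta>(1) unfolding trig_approx_def L_def by blast
    obtain F c where F: "finite F" "F \<subseteq> scaled_lattice \<epsilon>" "q = (\<lambda>x. \<Sum>y\<in>F. c y * wave y x)"
      using trig_poly_finite_sum[OF q(1)] by blast
    have "(\<lambda>x. h x - indicator (cube L) x * q x) = (\<lambda>x. h x - (\<Sum>y\<in>F. c y * cube_wave L y x))"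
      by (simp add: F(3) cube_wave_def sum_distrib_left mult_ac)
    then have "(sq_norm lebesgue (\<lambda>x. h x - (\<Sum>y\<in>F. c y * cube_wave L y x)))\<^sup>2 < \<delta>\<^sup>2"
      using q(2) by (intro power_strict_mono) auto
    moreover have "(\<Sum>y\<in>F. (cmod (c y - \<kappa> * fourier h y))\<^sup>2) / \<kappa> \<ge> 0"
      using \<kappa> by (intro divide_nonneg_pos sum_nonneg) auto
    ultimately have "(sq_norm lebesgue h)\<^sup>2 - \<kappa> * (\<Sum>y\<in>F. (cmod (fourier h y))\<^sup>2) < \<kappa> * (S - a)"
      using expand[OF F(1,2), of c] \<delta>(2) by linarith
    moreover have "\<kappa> * S = (sq_norm lebesgue h)\<^sup>2"
      using \<kappa> by (simp add: S_def)
    ultimately have "\<kappa> * a < \<kappa> * (\<Sum>y\<in>F. (cmod (fourier h y))\<^sup>2)"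
      by (simp add: right_diff_distrib)
    then have aF: "a < (\<Sum>y\<in>F. (cmod (fourier h y))\<^sup>2)"
      using \<kappa> by simp
    obtain G where G: "finite G" "F = \<rho> ` G"
      using finite_subset_image[OF F(1), of \<rho> UNIV] F(2) range by auto
    obtain m where m: "G \<subseteq> {..<m}"
      using finite_nat_bounded[OF G(1)] by blast
    have "a < (\<Sum>i<n. (cmod (fourier h (\<rho> i)))\<^sup>2)" if "n \<ge> m" for n
    proof -
      have "F \<subseteq> \<rho> ` {..<n}"
        using m that G(2) by fastforce
      then have "(\<Sum>y\<in>F. (cmod (fourier h y))\<^sup>2) \<le> (\<Sum>i<n. (cmod (fourier h (\<rho> i)))\<^sup>2)"
        unfolding partial by (intro sum_mono2) auto
      with aF show ?thesis
        by linarith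
    qed
    then show ?thesis
      by (auto simp: eventually_sequentially)
  qed
  have "(\<lambda>n. \<Sum>i<n. (cmod (fourier h (\<rho> i)))\<^sup>2) \<longlonglongrightarrow> S"
  proof (rule order_tendstoI)
    fix a assume "S < a"
    then show "\<forall>\<^sub>F n in sequentially. (\<Sum>i<n. (cmod (fourier h (\<rho> i)))\<^sup>2) < a"
      using upper by (intro always_eventually) (auto intro: le_less_trans)
  qed (rule lower)
  then show ?thesis
    by (simp add: sums_def S_def \<kappa>_def)
qed

subsection \<open>Fourier transforms of Riesz basis expansions\<close>

text \<open>The family of open sets on which \<open>h\<close> vanishes almost everywhere may be
  uncountable; the Lindelof property extracts a countable subfamily with the same union, so the
  exceptional sets together remain null.\<close>

lemma ess_support_AE:
  assumes "ess_support h \<subseteq> S"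
  shows "AE x in lebesgue. x \<notin> S \<longrightarrow> h x = 0"
proof -
  define \<V> where "\<V> = {V. open V \<and> (AE x in lebesgue. x \<in> V \<longrightarrow> h x = 0)}"
  obtain \<C> where C: "\<C> \<subseteq> \<V>" "countable \<C>" "\<Union>\<C> = \<Union>\<V>"
    using Lindelof[of \<V>] by (auto simp: \<V>_def)
  have "AE x in lebesgue. \<forall>V\<in>\<C>. x \<in> V \<longrightarrow> h x = 0"
    using C(1,2) by (intro AE_ball_countable') (auto simp: \<V>_def)
  then show ?thesis
  proof eventually_elim
    case (elim x)
    have "x \<in> \<Union>\<C>" if "x \<notin> S"
      using that assms unfolding C(3) by (auto simp: ess_support_def \<V>_def)
    with elim show ?case
      by blast
  qed
qed

text \<open>Rotating \<open>g\<close> by the phase of the product makes the product real, and the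
  real Cauchy-Schwarz inequality applies.\<close>

lemma sq_cinner_le:
  assumes f: "f \<in> sq_int M" and g: "g \<in> sq_int M"
  shows "cmod (sq_cinner M f g) \<le> sq_norm M f * sq_norm M g"
proof -
  define z where "z = sq_cinner M f g"
  have "cnj (sgn z) * z = complex_of_real ((cmod z)\<^sup>2) / complex_of_real (cmod z)"
    unfolding complex_norm_square by (simp add: sgn_eq mult.commute)
  then have "cmod z = Re (cnj (sgn z) * z)"
    by (simp add: power2_eq_square)
  also have "\<dots> = sq_inner M f (\<lambda>x. sgn z * g x)"
    by (simp add: sq_inner_scale_cinner[OF f g] z_def)
  also have "\<dots> \<le> sq_norm M f * (cmod (sgn z) * sq_norm M g)"
    using sq_Cauchy_Schwarz[OF f sq_int_scale[OF g, of "sgn z"]] by (simp add: sq_norm_scale)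
  also have "\<dots> \<le> sq_norm M f * (1 * sq_norm M g)"
    by (intro mult_left_mono mult_right_mono) (auto simp: norm_sgn)
  finally show ?thesis
    by (simp add: z_def)
qed

lemma sq_cinner_sum_left:
  assumes "\<And>i. i \<in> I \<Longrightarrow> f i \<in> sq_int M" "g \<in> sq_int M"
  shows "sq_cinner M (\<lambda>x. \<Sum>i\<in>I. f i x) g = (\<Sum>i\<in>I. sq_cinner M (f i) g)"
  unfolding sq_cinner_def sum_distrib_right
  by (rule Bochner_Integration.integral_sum) (intro sq_cinner_integrable assms)

lemma cmod_fourier_le:
  fixes h :: "real ^ 'd \<Rightarrow> complex"
  assumes h: "h \<in> sq_int lebesgue" and supp: "AE x in lebesgue. x \<notin> cube L \<longrightarrow> h x = 0" and L: "L \<ge> 0"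
  shows "cmod (fourier h y) \<le> sqrt ((2 * L) ^ CARD('d)) * sq_norm lebesgue h"
proof -
  have "sq_norm lebesgue (cube_wave L y) = sqrt ((2 * L) ^ CARD('d))"
    using cube_wave_norm_sq[OF L, of y] by (metis real_sqrt_unique sq_norm_nonneg)
  then show ?thesis
    using sq_cinner_le[OF h cube_wave_sq_int, of L y]
    by (simp add: fourier_eq_cinner[OF h supp] mult.commute)
qed

text \<open>Dominated convergence: waves have modulus 1, so the integrand at frequency 0 is a common
  majorant. Continuity supplies the measurability behind the essential supremum.\<close>

lemma fourier_continuous:
  fixes h :: "real ^ 'd \<Rightarrow> complex"
  assumes h: "h \<in> sq_int lebesgue" and supp: "AE x in lebesgue. x \<notin> cube L \<longrightarrow> h x = 0"
  shows "continuous_on UNIV (fourier h)"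
proof -
  have "(\<lambda>n. fourier h (z n)) \<longlonglongrightarrow> fourier h y" if z: "z \<longlonglongrightarrow> y" for z y
    unfolding fourier_eq_cinner[OF h supp] sq_cinner_def
  proof (rule integral_dominated_convergence[where w = "\<lambda>x. cmod (h x * cnj (cube_wave L 0 x))"])
    note int = sq_cinner_integrable[OF h cube_wave_sq_int]
    show "integrable lebesgue (\<lambda>x. cmod (h x * cnj (cube_wave L 0 x)))"
      by (intro integrable_norm int)
    show "(\<lambda>x. h x * cnj (cube_wave L y x)) \<in> borel_measurable lebesgue"
      "(\<lambda>x. h x * cnj (cube_wave L (z n) x)) \<in> borel_measurable lebesgue" for n
      by (rule borel_measurable_integrable[OF int])+
    show "AE x in lebesgue. (\<lambda>n. h x * cnj (cube_wave L (z n) x)) \<longlonglongrightarrow> h x * cnj (cube_wave L y x)"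
      unfolding cube_wave_def wave_def cis_conv_exp
      by (intro AE_I2 tendsto_intros z)
    show "AE x in lebesgue. norm (h x * cnj (cube_wave L (z n) x)) \<le> cmod (h x * cnj (cube_wave L 0 x))" for n
      by (intro AE_I2) (simp add: norm_mult cube_wave_def)
  qed
  then show ?thesis
    by (auto simp: continuous_on_sequentially comp_def)
qed

section \<open>Series in L2 and Riesz bounds\<close>

lemma L2_sums_iff:
  "L2_sums u h \<longleftrightarrow> (\<forall>k. u k \<in> sq_int lebesgue) \<and> h \<in> sq_int lebesgue \<and>
     (\<lambda>N. sq_norm lebesgue (\<lambda>x. h x - (\<Sum>k<N. u k x))) \<longlonglongrightarrow> 0"
  by (simp add: L2_sums_def L2_eq L2_norm_eq)

lemma L2_sums_norm_tendsto:
  assumes "L2_sums u h"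
  shows "(\<lambda>N. sq_norm lebesgue (\<lambda>x. \<Sum>k<N. u k x)) \<longlonglongrightarrow> sq_norm lebesgue h"
proof (rule LIM_zero_cancel, rule Lim_null_comparison)
  have u: "u k \<in> sq_int lebesgue" and h: "h \<in> sq_int lebesgue" for k
    using assms by (auto simp: L2_sums_iff)
  show "(\<lambda>N. sq_norm lebesgue (\<lambda>x. h x - (\<Sum>k<N. u k x))) \<longlonglongrightarrow> 0"
    using assms by (simp add: L2_sums_iff)
  show "\<forall>\<^sub>F N in sequentially. norm (sq_norm lebesgue (\<lambda>x. \<Sum>k<N. u k x) - sq_norm lebesgue h)
      \<le> sq_norm lebesgue (\<lambda>x. h x - (\<Sum>k<N. u k x))"
    using sq_norm_reverse_triangle[OF h sq_int_sum[of _ u lebesgue]] u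
    by (intro always_eventually allI) (simp add: abs_minus_commute)
qed

text \<open>Off \<open>S\<close>, \<open>h\<close> coincides almost everywhere with each remainder
  of the series, so its norm there is at most that of every remainder, which tends to 0.\<close>

lemma L2_sums_AE_zero:
  assumes sums: "L2_sums u h" and u0: "\<And>k. AE x in lebesgue. x \<notin> S \<longrightarrow> u k x = 0"
    and S: "S \<in> sets lebesgue"
  shows "AE x in lebesgue. x \<notin> S \<longrightarrow> h x = 0"
proof -
  have u: "u k \<in> sq_int lebesgue" and h: "h \<in> sq_int lebesgue" for k
    using sums by (auto simp: L2_sums_iff)
  define h' where "h' x = (if x \<in> S then 0 else h x)" for x
  have h'_meas: "h' \<in> borel_measurable lebesgue"
    unfolding h'_def using S sq_int_measurable[OF h] by measurable
  have h': "h' \<in> sq_int lebesgue"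
    unfolding sq_int_def
  proof (intro CollectI conjI h'_meas)
    show "integrable lebesgue (\<lambda>x. (cmod (h' x))\<^sup>2)"
      by (rule Bochner_Integration.integrable_bound[OF sq_int_integrable[OF h]])
         (use h'_meas in measurable, simp add: h'_def)
  qed
  have le: "sq_norm lebesgue h' \<le> sq_norm lebesgue (\<lambda>x. h x - (\<Sum>k<N. u k x))" for N
    unfolding sq_norm_def
  proof (intro real_sqrt_le_mono integral_mono_AE sq_int_integrable h' sq_int_diff h sq_int_sum u)
    have "AE x in lebesgue. \<forall>k. x \<notin> S \<longrightarrow> u k x = 0"
      unfolding AE_all_countable using u0 by blast
    then show "AE x in lebesgue. (cmod (h' x))\<^sup>2 \<le> (cmod (h x - (\<Sum>k<N. u k x)))\<^sup>2"
      by eventually_elim (simp add: h'_def)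
  qed
  have "sq_norm lebesgue h' \<le> 0"
    by (rule LIMSEQ_le_const[of "\<lambda>N. sq_norm lebesgue (\<lambda>x. h x - (\<Sum>k<N. u k x))"])
       (use sums le in \<open>auto simp: L2_sums_iff\<close>)
  then have "sq_norm lebesgue h' = 0"
    using sq_norm_nonneg[of lebesgue h'] by linarith
  then have "AE x in lebesgue. h' x = 0"
    using sq_norm_eq_0_AE[OF h'] by simp
  then show ?thesis
    by eventually_elim (simp add: h'_def split: if_splits)
qed

lemma L2_sums_norm_unique:
  assumes "L2_sums u g" "L2_sums u h"
  shows "sq_norm lebesgue g = sq_norm lebesgue h"
  using LIMSEQ_unique[OF assms[THEN L2_sums_norm_tendsto]] .

lemma L2_sums_finite:
  assumes "\<And>k. u k \<in> sq_int lebesgue" "\<And>k. k \<ge> n \<Longrightarrow> u k = (\<lambda>x. 0)"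
  shows "L2_sums u (\<lambda>x. \<Sum>k<n. u k x)"
proof -
  have eq: "(\<Sum>k<N. u k x) = (\<Sum>k<n. u k x)" if "N \<ge> n" for N x
    using that assms(2) by (intro sum.mono_neutral_right) (auto simp: not_less)
  have "sq_norm lebesgue (\<lambda>x. (\<Sum>k<n. u k x) - (\<Sum>k<N. u k x)) = 0" if "N \<ge> n" for N
    unfolding eq[OF that] by simp
  then have "\<forall>\<^sub>F N in sequentially. sq_norm lebesgue (\<lambda>x. (\<Sum>k<n. u k x) - (\<Sum>k<N. u k x)) = 0"
    unfolding eventually_sequentially by blast
  then have "(\<lambda>N. sq_norm lebesgue (\<lambda>x. (\<Sum>k<n. u k x) - (\<Sum>k<N. u k x))) \<longlonglongrightarrow> 0"
    by (rule tendsto_eventually)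
  then show ?thesis
    using assms(1) by (simp add: L2_sums_iff sq_int_sum)
qed

lemma L2_sums_diff_finite:
  assumes g: "L2_sums (\<lambda>k x. \<alpha> k * \<phi> k x) g" and \<phi>: "\<And>k. \<phi> k \<in> sq_int lebesgue"
    and b: "\<And>k. k \<ge> n \<Longrightarrow> b k = 0"
  shows "L2_sums (\<lambda>k x. (\<alpha> k - b k) * \<phi> k x) (\<lambda>x. g x - (\<Sum>k<n. b k * \<phi> k x))"
proof -
  have fin: "(\<Sum>k<N. b k * \<phi> k x) = (\<Sum>k<n. b k * \<phi> k x)" if "N \<ge> n" for N x
    using that b by (intro sum.mono_neutral_right) (auto simp: not_less)
  have eq: "(\<lambda>x. g x - (\<Sum>k<n. b k * \<phi> k x) - (\<Sum>k<N. (\<alpha> k - b k) * \<phi> k x)) =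
      (\<lambda>x. g x - (\<Sum>k<N. \<alpha> k * \<phi> k x))" if "N \<ge> n" for N
    unfolding left_diff_distrib sum_subtractf fin[OF that] by simp
  have "(\<lambda>N. sq_norm lebesgue (\<lambda>x. g x - (\<Sum>k<n. b k * \<phi> k x) - (\<Sum>k<N. (\<alpha> k - b k) * \<phi> k x))) \<longlonglongrightarrow> 0"
  proof (rule Lim_transform_eventually)
    show "(\<lambda>N. sq_norm lebesgue (\<lambda>x. g x - (\<Sum>k<N. \<alpha> k * \<phi> k x))) \<longlonglongrightarrow> 0"
      using g by (simp add: L2_sums_iff)
    show "\<forall>\<^sub>F N in sequentially. sq_norm lebesgue (\<lambda>x. g x - (\<Sum>k<N. \<alpha> k * \<phi> k x)) =
        sq_norm lebesgue (\<lambda>x. g x - (\<Sum>k<n. b k * \<phi> k x) - (\<Sum>k<N. (\<alpha> k - b k) * \<phi> k x))"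
      unfolding eventually_sequentially by (intro exI[of _ n] allI impI) (simp only: eq)
  qed
  moreover have "g \<in> sq_int lebesgue"
    using g by (simp add: L2_sums_iff)
  ultimately show ?thesis
    using \<phi> by (simp add: L2_sums_iff sq_int_diff sq_int_scale sq_int_sum)
qed

lemma L2_sums_orthonormal_norm:
  assumes on: "L2_orthonormal \<phi>" and \<phi>: "\<And>k. \<phi> k \<in> sq_int lebesgue" and \<alpha>: "\<alpha> \<in> ell2"
    and g: "L2_sums (\<lambda>k x. \<alpha> k * \<phi> k x) g"
  shows "(sq_norm lebesgue g)\<^sup>2 = (ell2_norm \<alpha>)\<^sup>2"
proof -
  have ip: "sq_cinner lebesgue (\<phi> i) (\<phi> j) = (if i = j then 1 else 0)" for i j
    using on by (simp add: L2_orthonormal_def sq_cinner_def)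
  have unit: "(sq_norm lebesgue (\<phi> k))\<^sup>2 = 1" for k
    using sq_inner_scale_cinner[OF \<phi> \<phi>, of k 1 k] by (simp add: sq_norm_inner ip)
  have part: "(sq_norm lebesgue (\<lambda>x. \<Sum>k<N. \<alpha> k * \<phi> k x))\<^sup>2 = (\<Sum>k<N. (cmod (\<alpha> k))\<^sup>2)" for N
  proof (induction N)
    case (Suc N)
    have s: "(\<lambda>x. \<Sum>k<N. \<alpha> k * \<phi> k x) \<in> sq_int lebesgue"
      by (intro sq_int_sum sq_int_scale \<phi>)
    have "sq_cinner lebesgue (\<lambda>x. \<Sum>k<N. \<alpha> k * \<phi> k x) (\<phi> N) = 0"
      by (subst sq_cinner_sum_left) (auto simp: sq_int_scale \<phi> sq_cinner_scale_left ip)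
    then have "sq_inner lebesgue (\<lambda>x. \<Sum>k<N. \<alpha> k * \<phi> k x) (\<lambda>x. \<alpha> N * \<phi> N x) = 0"
      by (simp add: sq_inner_scale_cinner[OF s \<phi>])
    then show ?case
      using sq_norm_add_sq[OF s sq_int_scale[OF \<phi>[of N], of "\<alpha> N"]] Suc
      by (simp add: sq_norm_scale power_mult_distrib unit)
  qed simp
  have "(\<lambda>N. (sq_norm lebesgue (\<lambda>x. \<Sum>k<N. \<alpha> k * \<phi> k x))\<^sup>2) \<longlonglongrightarrow> (sq_norm lebesgue g)\<^sup>2"
    by (intro tendsto_power L2_sums_norm_tendsto g)
  moreover have "(\<lambda>N. \<Sum>k<N. (cmod (\<alpha> k))\<^sup>2) \<longlonglongrightarrow> (ell2_norm \<alpha>)\<^sup>2"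
    unfolding ell2_norm_sq[OF \<alpha>] by (intro summable_LIMSEQ ell2_summable \<alpha>)
  ultimately show ?thesis
    unfolding part by (rule LIMSEQ_unique)
qed

text \<open>\<open>riesz_basis\<close> provides the bounds for some limit of the series; any other
  limit has the same norm, namely the limit of the norms of the partial sums.\<close>

lemma riesz_basis_bounds:
  assumes "riesz_basis \<phi> W A B" "\<alpha> \<in> ell2" "L2_sums (\<lambda>k x. \<alpha> k * \<phi> k x) g"
  shows "A * (ell2_norm \<alpha>)\<^sup>2 \<le> (sq_norm lebesgue g)\<^sup>2" "(sq_norm lebesgue g)\<^sup>2 \<le> B * (ell2_norm \<alpha>)\<^sup>2"
proof -
  obtain h where h: "L2_sums (\<lambda>k x. \<alpha> k * \<phi> k x) h"
      "A * (\<Sum>k. (cmod (\<alpha> k))\<^sup>2) \<le> (L2_norm h)\<^sup>2" "(L2_norm h)\<^sup>2 \<le> B * (\<Sum>k. (cmod (\<alpha> k))\<^sup>2)"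
    using assms(1,2) unfolding riesz_basis_def by blast
  then show "A * (ell2_norm \<alpha>)\<^sup>2 \<le> (sq_norm lebesgue g)\<^sup>2" "(sq_norm lebesgue g)\<^sup>2 \<le> B * (ell2_norm \<alpha>)\<^sup>2"
    using L2_sums_norm_unique[OF assms(3) h(1)] by (simp_all add: ell2_norm_sq assms(2) L2_norm_eq)
qed

lemma riesz_basis_L2: "riesz_basis \<phi> W A B \<Longrightarrow> \<phi> k \<in> sq_int lebesgue"
  by (simp add: riesz_basis_def L2_eq)

text \<open>The partial sums of a convergent series have bounded norms, and the lower Riesz bound
  for truncated coefficients turns this into bounded partial sums of squares.\<close>

lemma riesz_basis_coefficients_ell2:
  assumes r: "riesz_basis \<phi> W A B" and A: "A > 0" and g: "L2_sums (\<lambda>k x. \<beta> k * \<phi> k x) g"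
  shows "\<beta> \<in> ell2"
proof -
  obtain K where K: "\<And>N. sq_norm lebesgue (\<lambda>x. \<Sum>k<N. \<beta> k * \<phi> k x) \<le> K"
    using L2_sums_norm_tendsto[OF g, THEN convergentI, THEN convergent_imp_Bseq]
    unfolding Bseq_def by (auto simp: abs_of_nonneg)
  have K0: "K \<ge> 0"
    using K[of 0] sq_norm_nonneg order_trans by blast
  have "(\<Sum>k<N. (cmod (\<beta> k))\<^sup>2) \<le> (K / sqrt A)\<^sup>2" for N
  proof -
    have "L2_sums (\<lambda>k x. Pn N \<beta> k * \<phi> k x) (\<lambda>x. \<Sum>k<N. Pn N \<beta> k * \<phi> k x)"
      using riesz_basis_L2[OF r] by (intro L2_sums_finite) (auto simp: sq_int_scale)
    from riesz_basis_bounds(1)[OF r Pn_in_ell2 this]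
    have "A * (\<Sum>k<N. (cmod (\<beta> k))\<^sup>2) \<le> (sq_norm lebesgue (\<lambda>x. \<Sum>k<N. \<beta> k * \<phi> k x))\<^sup>2"
      by (simp add: Pn_norm_sq)
    also have "\<dots> \<le> K\<^sup>2"
      by (intro power_mono K sq_norm_nonneg)
    finally show ?thesis
      using A by (simp add: power_divide field_simps)
  qed
  then show ?thesis
    using ell2_boundI(1)[of \<beta> "K / sqrt A"] K0 A by simp
qed

text \<open>Pairing with a fixed truncated wave is continuous on L2, so the expansion can be
  transformed term by term at every point. At the sampling points this says that
  \<open>mat_op U\<close> sends coefficients to samples.\<close>

lemma fourier_L2_sums:
  fixes \<phi> :: "nat \<Rightarrow> real ^ 'd \<Rightarrow> complex"
  assumes g: "L2_sums (\<lambda>k x. \<alpha> k * \<phi> k x) g" and \<phi>: "\<And>k. \<phi> k \<in> sq_int lebesgue"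
    and supp: "\<And>k. AE x in lebesgue. x \<notin> cube T \<longrightarrow> \<phi> k x = 0"
  shows "(\<lambda>k. \<alpha> k * fourier (\<phi> k) y) sums fourier g y"
proof -
  have gi: "g \<in> sq_int lebesgue"
    using g by (simp add: L2_sums_iff)
  have gsupp: "AE x in lebesgue. x \<notin> cube T \<longrightarrow> g x = 0"
  proof (rule L2_sums_AE_zero[OF g])
    show "AE x in lebesgue. x \<notin> cube T \<longrightarrow> \<alpha> k * \<phi> k x = 0" for k
      using supp[of k] by eventually_elim simp
  qed (simp add: cube_def)
  define w where "w = cube_wave T y"
  have w: "w \<in> sq_int lebesgue"
    by (simp add: w_def cube_wave_sq_int)
  have s: "(\<lambda>x. \<Sum>k<N. \<alpha> k * \<phi> k x) \<in> sq_int lebesgue" for N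
    by (intro sq_int_sum sq_int_scale \<phi>)
  have part: "(\<Sum>k<N. \<alpha> k * fourier (\<phi> k) y) = sq_cinner lebesgue (\<lambda>x. \<Sum>k<N. \<alpha> k * \<phi> k x) w" for N
    by (subst sq_cinner_sum_left)
       (simp_all add: sq_int_scale \<phi> w sq_cinner_scale_left fourier_eq_cinner[OF \<phi> supp] w_def[symmetric])
  have "(\<lambda>N. \<Sum>k<N. \<alpha> k * fourier (\<phi> k) y) \<longlonglongrightarrow> fourier g y"
  proof (rule LIM_zero_cancel, rule Lim_null_comparison)
    show "(\<lambda>N. sq_norm lebesgue (\<lambda>x. g x - (\<Sum>k<N. \<alpha> k * \<phi> k x)) * sq_norm lebesgue w) \<longlonglongrightarrow> 0"
      using g by (intro tendsto_mult_left_zero) (simp add: L2_sums_iff)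
    have "cmod ((\<Sum>k<N. \<alpha> k * fourier (\<phi> k) y) - fourier g y)
        \<le> sq_norm lebesgue (\<lambda>x. g x - (\<Sum>k<N. \<alpha> k * \<phi> k x)) * sq_norm lebesgue w" for N
      using sq_cinner_le[OF sq_int_diff[OF gi s[of N]] w]
      unfolding part fourier_eq_cinner[OF gi gsupp] w_def[symmetric] sq_cinner_diff_left[OF gi s w]
      by (simp add: norm_minus_commute)
    then show "\<forall>\<^sub>F N in sequentially. norm ((\<Sum>k<N. \<alpha> k * fourier (\<phi> k) y) - fourier g y)
        \<le> sq_norm lebesgue (\<lambda>x. g x - (\<Sum>k<N. \<alpha> k * \<phi> k x)) * sq_norm lebesgue w"
      by simp
  qed
  then show ?thesis
    by (simp add: sums_def)
qed

locale sampled_riesz_basis =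
  fixes \<phi> :: "nat \<Rightarrow> real ^ 'd \<Rightarrow> complex"
    and W :: "(real ^ 'd \<Rightarrow> complex) set"
    and \<rho> :: "nat \<Rightarrow> real ^ 'd"
    and U :: "nat \<Rightarrow> nat \<Rightarrow> complex"
    and A B T \<epsilon> :: real
  assumes A: "A > 0" and B: "B > 0"
    and riesz: "riesz_basis \<phi> W A B"
    and T: "T > 0"
    and supp: "\<And>j. ess_support (\<phi> j) \<subseteq> cbox (\<chi> i. - T) (\<chi> i. T)"
    and \<epsilon>: "0 < \<epsilon>" and \<epsilon>_le: "\<epsilon> \<le> 1 / (2 * T)"
    and \<rho>: "bij_betw \<rho> UNIV (scaled_lattice \<epsilon>)"
    and U: "\<And>i j. U i j = fourier (\<phi> j) (\<rho> i)"
begin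

lemma \<phi>_sq_int: "\<phi> k \<in> sq_int lebesgue"
  by (rule riesz_basis_L2[OF riesz])

lemma \<phi>_supp: "AE x in lebesgue. x \<notin> cube T \<longrightarrow> \<phi> k x = 0"
  using ess_support_AE[OF supp[of k]] by (simp add: cube_def)

lemma sums_supp:
  assumes "L2_sums (\<lambda>k x. \<alpha> k * \<phi> k x) g"
  shows "AE x in lebesgue. x \<notin> cube T \<longrightarrow> g x = 0"
proof (rule L2_sums_AE_zero[OF assms])
  show "AE x in lebesgue. x \<notin> cube T \<longrightarrow> \<alpha> k * \<phi> k x = 0" for k
    using \<phi>_supp[of k] by eventually_elim simp
qed (simp add: cube_def)

lemma sums_sq_int: "L2_sums (\<lambda>k x. \<alpha> k * \<phi> k x) g \<Longrightarrow> g \<in> sq_int lebesgue"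
  by (simp add: L2_sums_iff)

lemma U_sums:
  assumes "L2_sums (\<lambda>k x. \<alpha> k * \<phi> k x) g"
  shows "(\<lambda>j. U i j * \<alpha> j) sums fourier g (\<rho> i)"
  using fourier_L2_sums[OF assms \<phi>_sq_int \<phi>_supp, of "\<rho> i"] by (simp add: U mult.commute)

lemma mat_op_U: "L2_sums (\<lambda>k x. \<alpha> k * \<phi> k x) g \<Longrightarrow> mat_op U \<alpha> = (\<lambda>i. fourier g (\<rho> i))"
  using U_sums by (simp add: mat_op_def sums_iff)

text \<open>Here \<open>\<epsilon> \<le> 1 / (2 * T)\<close> enters: the supports fit into one
  period cube of the exponentials, which is what Parseval's identity needs.\<close>

lemma cube_subset: "x \<in> cube T \<Longrightarrow> x \<in> cube (1 / (2 * \<epsilon>))"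
proof -
  have "T \<le> 1 / (2 * \<epsilon>)"
    using T \<epsilon> \<epsilon>_le by (simp add: field_simps)
  then show "x \<in> cube T \<Longrightarrow> x \<in> cube (1 / (2 * \<epsilon>))"
    unfolding mem_cube by (meson order_trans)
qed

lemma mat_op_U_norm:
  assumes g: "L2_sums (\<lambda>k x. \<alpha> k * \<phi> k x) g"
  shows "mat_op U \<alpha> \<in> ell2" "(ell2_norm (mat_op U \<alpha>))\<^sup>2 = (sq_norm lebesgue g)\<^sup>2 / \<epsilon> ^ CARD('d)"
proof -
  have "AE x in lebesgue. x \<notin> cube (1 / (2 * \<epsilon>)) \<longrightarrow> g x = 0"
    using sums_supp[OF g] by eventually_elim (use cube_subset in blast)
  from parseval_cube[OF \<epsilon> sums_sq_int[OF g] this \<rho>]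
  have s: "(\<lambda>i. (cmod (mat_op U \<alpha> i))\<^sup>2) sums ((sq_norm lebesgue g)\<^sup>2 / \<epsilon> ^ CARD('d))"
    by (simp add: mat_op_U[OF g])
  show ell: "mat_op U \<alpha> \<in> ell2"
    using s by (auto simp: ell2_def sums_iff)
  show "(ell2_norm (mat_op U \<alpha>))\<^sup>2 = (sq_norm lebesgue g)\<^sup>2 / \<epsilon> ^ CARD('d)"
    using s by (simp add: ell2_norm_sq[OF ell] sums_iff)
qed

lemma ell2_L2_sums:
  assumes "\<alpha> \<in> ell2"
  obtains g where "L2_sums (\<lambda>k x. \<alpha> k * \<phi> k x) g"
  using assms riesz unfolding riesz_basis_def by blast

text \<open>The Riesz constants are parameters because two instances are needed: \<open>A\<close>
  and \<open>B\<close> in general, and 1 and 1 for an orthonormal system.\<close>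

lemma frame_matrix_U:
  assumes a: "a > 0" and b: "b \<ge> 0"
    and bounds: "\<And>\<alpha> g. \<alpha> \<in> ell2 \<Longrightarrow> L2_sums (\<lambda>k x. \<alpha> k * \<phi> k x) g \<Longrightarrow>
      a * (ell2_norm \<alpha>)\<^sup>2 \<le> (sq_norm lebesgue g)\<^sup>2 \<and> (sq_norm lebesgue g)\<^sup>2 \<le> b * (ell2_norm \<alpha>)\<^sup>2"
  shows "frame_matrix U (a / \<epsilon> ^ CARD('d)) (sqrt (b / \<epsilon> ^ CARD('d)))"
proof
  have \<kappa>: "\<epsilon> ^ CARD('d) > 0"
    using \<epsilon> by simp
  fix x :: "nat \<Rightarrow> complex" assume x: "x \<in> ell2"
  obtain g where g: "L2_sums (\<lambda>k y. x k * \<phi> k y) g"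
    using ell2_L2_sums[OF x] .
  show "summable (\<lambda>j. U i j * x j)" for i
    using U_sums[OF g] sums_summable by blast
  show ell: "mat_op U x \<in> ell2"
    by (rule mat_op_U_norm[OF g])
  show "a / \<epsilon> ^ CARD('d) * (ell2_norm x)\<^sup>2 \<le> (ell2_norm (mat_op U x))\<^sup>2"
    using bounds[OF x g] \<kappa> by (simp add: mat_op_U_norm[OF g] divide_right_mono)
  have "(ell2_norm (mat_op U x))\<^sup>2 \<le> b / \<epsilon> ^ CARD('d) * (ell2_norm x)\<^sup>2"
    using bounds[OF x g] \<kappa> by (simp add: mat_op_U_norm[OF g] divide_right_mono)
  also have "\<dots> = (sqrt (b / \<epsilon> ^ CARD('d)) * ell2_norm x)\<^sup>2"
    using \<kappa> b by (simp only: power_mult_distrib real_sqrt_pow2 divide_nonneg_pos)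
  finally show "ell2_norm (mat_op U x) \<le> sqrt (b / \<epsilon> ^ CARD('d)) * ell2_norm x"
    by (rule power2_le_imp_le) (use \<kappa> b ell2_norm_nonneg[OF x] in simp)
next
  show "a / \<epsilon> ^ CARD('d) > 0" "sqrt (b / \<epsilon> ^ CARD('d)) \<ge> 0"
    using \<epsilon> a b by simp_all
qed

sublocale frame_matrix U "A / \<epsilon> ^ CARD('d)" "sqrt (B / \<epsilon> ^ CARD('d))"
  using riesz_basis_bounds[OF riesz] A B by (intro frame_matrix_U) auto

lemma K_const_orthonormal:
  assumes on: "L2_orthonormal \<phi>"
  shows "(\<lambda>m. K_const U n m) \<longlonglongrightarrow> 0"
proof -
  note norm = L2_sums_orthonormal_norm[OF on \<phi>_sq_int]
  \<comment> \<open>\<open>K_const\<close> does not mention the frame bounds, so its limit can be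
    computed in this instance, where lower and upper bound match.\<close>
  interpret iso: frame_matrix U "1 / \<epsilon> ^ CARD('d)" "sqrt (1 / \<epsilon> ^ CARD('d))"
    using norm by (intro frame_matrix_U) auto
  show ?thesis
  proof (rule iso.K_const_tendsto_0)
    fix x :: "nat \<Rightarrow> complex" assume x: "x \<in> ell2"
    obtain g where g: "L2_sums (\<lambda>k y. x k * \<phi> k y) g"
      using ell2_L2_sums[OF x] .
    show "(ell2_norm (mat_op U x))\<^sup>2 = 1 / \<epsilon> ^ CARD('d) * (ell2_norm x)\<^sup>2"
      by (simp add: mat_op_U_norm[OF g] norm[OF x g])
  qed
qed

text \<open>The error is the expansion with coefficients \<open>\<beta> k - b k\<close>. The upper
  Riesz bound controls its norm, and Cauchy-Schwarz on the cube of volume \<open>(2 T)^d\<close>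
  converts that into a bound for every value of its Fourier transform.\<close>

lemma reconstruction_error:
  assumes g: "L2_sums (\<lambda>k x. \<beta> k * \<phi> k x) g" and \<beta>: "\<beta> \<in> ell2" and b: "b \<in> Pn_space n"
    and err: "ell2_norm (\<lambda>k. \<beta> k - b k) \<le> E"
  shows "L2_norm (\<lambda>x. g x - (\<Sum>j<n. b j * \<phi> j x)) \<le> sqrt B * E"
    and "esssup lebesgue (\<lambda>y. ereal (cmod (fourier g y - (\<Sum>j<n. b j * fourier (\<phi> j) y))))
      \<le> ereal ((2 * T) powr (real CARD('d) / 2) * (sqrt B * E))"
proof -
  have b': "b \<in> ell2" "\<And>k. k \<ge> n \<Longrightarrow> b k = 0"
    using b by (auto simp: Pn_space_eq ell2_off_def)
  define d where "d x = g x - (\<Sum>j<n. b j * \<phi> j x)" for x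
  have d: "L2_sums (\<lambda>k x. (\<beta> k - b k) * \<phi> k x) d"
    unfolding d_def using L2_sums_diff_finite[OF g \<phi>_sq_int b'(2)] by simp
  note de = ell2_diff[OF \<beta> b'(1)]
  have "(sq_norm lebesgue d)\<^sup>2 \<le> B * (ell2_norm (\<lambda>k. \<beta> k - b k))\<^sup>2"
    by (rule riesz_basis_bounds(2)[OF riesz de d])
  also have "\<dots> \<le> B * E\<^sup>2"
    using B by (intro mult_left_mono power_mono err ell2_norm_nonneg de) simp
  also have "\<dots> = (sqrt B * E)\<^sup>2"
    using B by (simp add: power_mult_distrib)
  finally have dn: "sq_norm lebesgue d \<le> sqrt B * E"
    by (rule power2_le_imp_le) (use B order_trans[OF ell2_norm_nonneg[OF de] err] in simp)
  then show "L2_norm (\<lambda>x. g x - (\<Sum>j<n. b j * \<phi> j x)) \<le> sqrt B * E"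
    by (simp add: L2_norm_eq d_def[abs_def])
  have four: "fourier g y - (\<Sum>j<n. b j * fourier (\<phi> j) y) = fourier d y" for y
  proof -
    have "(\<lambda>k. b k * fourier (\<phi> k) y) sums (\<Sum>j<n. b j * fourier (\<phi> j) y)"
      by (rule sums_finite) (simp_all add: b'(2))
    from sums_diff[OF fourier_L2_sums[OF g \<phi>_sq_int \<phi>_supp, of y] this]
    have "(\<lambda>k. (\<beta> k - b k) * fourier (\<phi> k) y) sums (fourier g y - (\<Sum>j<n. b j * fourier (\<phi> j) y))"
      by (simp add: left_diff_distrib)
    then show ?thesis
      using fourier_L2_sums[OF d \<phi>_sq_int \<phi>_supp, of y] sums_unique2 by blast
  qed
  have powr: "sqrt ((2 * T) ^ CARD('d)) = (2 * T) powr (real CARD('d) / 2)"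
  proof -
    have "sqrt ((2 * T) ^ CARD('d)) = ((2 * T) powr real CARD('d)) powr (1 / 2)"
      using T by (simp add: powr_realpow powr_half_sqrt)
    then show ?thesis
      by (simp add: powr_powr)
  qed
  have "cmod (fourier d y) \<le> (2 * T) powr (real CARD('d) / 2) * (sqrt B * E)" for y
  proof -
    have "cmod (fourier d y) \<le> sqrt ((2 * T) ^ CARD('d)) * sq_norm lebesgue d"
      using T by (intro cmod_fourier_le sums_sq_int[OF d] sums_supp[OF d]) simp
    also have "\<dots> \<le> sqrt ((2 * T) ^ CARD('d)) * (sqrt B * E)"
      using T dn by (intro mult_left_mono) simp_all
    finally show ?thesis
      by (simp only: powr)
  qed
  moreover have "fourier d \<in> borel_measurable lebesgue"
    by (intro borel_imp_lebesgue_measurable borel_measurable_continuous_onI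
        fourier_continuous[OF sums_sq_int[OF d] sums_supp[OF d]])
  ultimately show "esssup lebesgue (\<lambda>y. ereal (cmod (fourier g y - (\<Sum>j<n. b j * fourier (\<phi> j) y))))
      \<le> ereal ((2 * T) powr (real CARD('d) / 2) * (sqrt B * E))"
    unfolding four by (intro esssup_I) auto
qed

end

theorem theorem4p8:
  fixes \<phi> :: "nat \<Rightarrow> real ^ 'd \<Rightarrow> complex"
    and W :: "(real ^ 'd \<Rightarrow> complex) set"
    and \<rho> :: "nat \<Rightarrow> real ^ 'd"
    and U :: "nat \<Rightarrow> nat \<Rightarrow> complex"
    and f g :: "real ^ 'd \<Rightarrow> complex"
    and \<beta> :: "nat \<Rightarrow> complex"
    and A B T \<epsilon> :: real
  assumes "A > 0" and "B > 0"
    and "riesz_basis \<phi> W A B"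
    and "T > 0"
    and "\<And>j. ess_support (\<phi> j) \<subseteq> cbox (\<chi> i. - T) (\<chi> i. T)"
    and "0 < \<epsilon>" and "\<epsilon> \<le> 1 / (2 * T)"
    and "bij_betw \<rho> UNIV (scaled_lattice \<epsilon>)"
    and "\<And>i j. U i j = fourier (\<phi> j) (\<rho> i)"
    and "L2_sums (\<lambda>j x. \<beta> j * \<phi> j x) g"
    and "f = fourier g"
  shows
    "bounded_matrix U \<and> \<beta> \<in> ell2 \<and>
     (\<forall>n\<ge>1. \<exists>M. \<forall>m\<ge>M.
        ell2_invertible (Pn_space n) (uneven_section U n m) \<and>
        (\<exists>!b. b \<in> Pn_space n \<and>
              uneven_section U n m b = Pn n (mat_op (mat_adj U) (Pn m (\<lambda>i. f (\<rho> i))))) \<and>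
        (\<forall>b gt ft. b \<in> Pn_space n \<and>
              uneven_section U n m b = Pn n (mat_op (mat_adj U) (Pn m (\<lambda>i. f (\<rho> i)))) \<and>
              gt = (\<lambda>x. \<Sum>j<n. b j * \<phi> j x) \<and>
              ft = (\<lambda>y. \<Sum>j<n. b j * fourier (\<phi> j) y) \<longrightarrow>
            L2_norm (\<lambda>x. g x - gt x) \<le> sqrt B * (1 + K_const U n m) * ell2_norm (Pn_perp n \<beta>) \<and>
            esssup lebesgue (\<lambda>y. ereal (cmod (f y - ft y)))
              \<le> ereal ((2 * T) powr (real CARD('d) / 2) * sqrt B * (1 + K_const U n m)
                       * ell2_norm (Pn_perp n \<beta>)))) \<and>
     ell2_invertible ell2 (gram_op U) \<and>
     op_norm ell2 (inv_into ell2 (gram_op U)) \<le> \<epsilon> ^ CARD('d) / A \<and>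
     (\<forall>n\<ge>1.
        ell2_invertible (Pn_space n) (gram_section U n) \<and>
        (\<lambda>m. op_norm (Pn_space n) (inv_into (Pn_space n) (uneven_section U n m)))
          \<longlonglongrightarrow> op_norm (Pn_space n) (inv_into (Pn_space n) (gram_section U n)) \<and>
        op_norm (Pn_space n) (inv_into (Pn_space n) (gram_section U n))
          \<le> op_norm ell2 (inv_into ell2 (gram_op U))) \<and>
     (L2_orthonormal \<phi> \<longrightarrow> (\<forall>n\<ge>1. (\<lambda>m. K_const U n m) \<longlonglongrightarrow> 0))"
proof -
  interpret sampled_riesz_basis \<phi> W \<rho> U A B T \<epsilon>
    using assms(1-9) by unfold_locales
  let ?rhs = "\<lambda>n m. Pn n (adj (Pn m (\<lambda>i. f (\<rho> i))))"
  have \<beta>: "\<beta> \<in> ell2"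
    by (rule riesz_basis_coefficients_ell2[OF riesz A assms(10)])
  \<comment> \<open>The sampled data are \<open>U \<beta>\<close>, so the right-hand side is that of
    \<open>solution_error\<close> and the solution is compared with \<open>\<beta>\<close>
    itself.\<close>
  have samples: "(\<lambda>i. f (\<rho> i)) = mat_op U \<beta>"
    using mat_op_U[OF assms(10)] assms(11) by simp
  have main: "\<exists>M. \<forall>m\<ge>M.
        ell2_invertible (Pn_space n) (uneven_section U n m) \<and>
        (\<exists>!b. b \<in> Pn_space n \<and> uneven_section U n m b = ?rhs n m) \<and>
        (\<forall>b gt ft. b \<in> Pn_space n \<and> uneven_section U n m b = ?rhs n m \<and>
              gt = (\<lambda>x. \<Sum>j<n. b j * \<phi> j x) \<and>
              ft = (\<lambda>y. \<Sum>j<n. b j * fourier (\<phi> j) y) \<longrightarrow>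
            L2_norm (\<lambda>x. g x - gt x) \<le> sqrt B * (1 + K_const U n m) * ell2_norm (Pn_perp n \<beta>) \<and>
            esssup lebesgue (\<lambda>y. ereal (cmod (f y - ft y)))
              \<le> ereal ((2 * T) powr (real CARD('d) / 2) * sqrt B * (1 + K_const U n m)
                       * ell2_norm (Pn_perp n \<beta>)))" for n
  proof -
    \<comment> \<open>Coercivity of the section is all that the threshold has to secure; solvability
      and both error bounds hold at every such \<open>m\<close>.\<close>
    obtain M where M: "\<And>m. m \<ge> M \<Longrightarrow> coercive_op {n..} (uneven_section U n m)
        (A / \<epsilon> ^ CARD('d) / 2) (sqrt (B / \<epsilon> ^ CARD('d)) * sqrt (B / \<epsilon> ^ CARD('d)))"
      using eventually_uneven_coercive[of n] unfolding eventually_sequentially by blast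
    show ?thesis
    proof (intro exI[of _ M] allI impI conjI)
      fix m assume m: "M \<le> m"
      show "ell2_invertible (Pn_space n) (uneven_section U n m)"
        by (rule uneven_invertible[OF M[OF m]])
      show "\<exists>!b. b \<in> Pn_space n \<and> uneven_section U n m b = ?rhs n m"
        by (rule solution_exists_unique[OF M[OF m]])
    next
      fix m b gt ft
      assume m: "M \<le> m" and "b \<in> Pn_space n \<and> uneven_section U n m b = ?rhs n m \<and>
              gt = (\<lambda>x. \<Sum>j<n. b j * \<phi> j x) \<and> ft = (\<lambda>y. \<Sum>j<n. b j * fourier (\<phi> j) y)"
      then have b: "b \<in> Pn_space n" "uneven_section U n m b = ?rhs n m"
        and gt: "gt = (\<lambda>x. \<Sum>j<n. b j * \<phi> j x)" and ft: "ft = (\<lambda>y. \<Sum>j<n. b j * fourier (\<phi> j) y)"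
        by blast+
      note err = reconstruction_error[OF assms(10) \<beta> b(1)
          solution_error[OF M[OF m] \<beta> b(1) b(2)[unfolded samples]]]
      show "L2_norm (\<lambda>x. g x - gt x) \<le> sqrt B * (1 + K_const U n m) * ell2_norm (Pn_perp n \<beta>)"
        using err(1) by (simp only: gt mult.assoc)
      show "esssup lebesgue (\<lambda>y. ereal (cmod (f y - ft y)))
          \<le> ereal ((2 * T) powr (real CARD('d) / 2) * sqrt B * (1 + K_const U n m) * ell2_norm (Pn_perp n \<beta>))"
        using err(2) by (simp only: ft assms(11) mult.assoc)
    qed
  qed
  have gram: "op_norm ell2 (inv_into ell2 (gram_op U)) \<le> \<epsilon> ^ CARD('d) / A"
    using gram_inv_norm_le by simp
  show ?thesis
    using bounded_matrix \<beta> main gram_invertible gram gram_section_invertible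
      uneven_inv_norm_tendsto gram_section_inv_norm_le K_const_orthonormal
    by (intro conjI allI impI) blast+
qed

end
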